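(* Let $0<q<1$ and let $(a,c,d)$ be an admissible triple: $a>0$ and $(c,d)$ satisfies one of: $d=\bar c\in\mathbb C\setminus\mathbb R$; or $aq^m<c,d<aq^{m-1}$ for some $m\in\mathbb Z$; or $c,d<0$ and $q<cd^{-1}<q^{-1}$. Let $\Phi^{qM}_\lambda=\Phi^{qM}_\lambda(\cdot;q;a,c,d)$ be the $q$-Meixner symmetric functions, which form a basis of $\mathrm{Sym}$; let $\mathbb E:\mathrm{Sym}\to\mathbb C$ be the linear functional with $\mathbb E(\Phi^{qM}_\lambda)=\delta_{\lambda,\emptyset}$ for all partitions $\lambda$, and put $(F,G):=\mathbb E(FG)$. Then for all partitions $\lambda,\mu$, $$(\Phi^{qM}_\lambda,\Phi^{qM}_\mu)=\delta_{\lambda,\mu}\,h^{qM}_\lambda(q;a,c,d),\qquad h^{qM}_\lambda(q;a,c,d)=q^{4\{n(\lambda)-n(\lambda')\}}\left(\frac{a^2}{c^2d^2q^3}\right)^{|\lambda|}\left(\frac{cq}a,\frac{dq}a;q\right)_\lambda .$$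
   Context: Notation: $(x;q)_n=\prod_{k=0}^{n-1}(1-xq^k)$ for $n\ge0$; for a partition $\mu$, $(x;q)_\mu=\prod_{i=1}^{\ell(\mu)}(xq^{1-i};q)_{\mu_i}$ and $(x_1,\dots,x_m;q)_\mu=\prod_j(x_j;q)_\mu$. $\ell(\lambda)$ is the number of nonzero parts, $|\lambda|=\sum\lambda_i$, $n(\lambda)=\sum_i(i-1)\lambda_i$, $\lambda'$ is the transposed partition (so $n(\lambda')=\sum_i\binom{\lambda_i}2$), $\mathbb Y(N)$ is the set of partitions with at most $N$ nonzero parts. $\mathrm{Sym}$ is the algebra of symmetric functions over $\mathbb C$, $\mathrm{Sym}(N)$ the symmetric polynomials in $N$ variables, the subscript $\le d$ means degree at most $d$. $V(x_1,\dots,x_N)=\prod_{i<j}(x_i-x_j)$. For variables $X=(x_1,x_2,\dots)$, $F(Xc)=F(cx_1,cx_2,\dots)$. Interpolation functions: $(x\mid c_0,c_1,\dots)^m=\prod_{i=0}^{m-1}(x-c_i)$; for $\mu\in\mathbb Y(N)$, $s_{\mu|N}(x_1,\dots,x_N\mid c_0,c_1,\dots)=\det[(x_j\mid c_0,c_1,\dots)^{\mu_i+N-i}]_{i,j=1}^N/V(x_1,\dots,x_N)$. $I^A_\mu(\cdot;q)\in\mathrm{Sym}$ is the limit as $N\to\infty$ (which exists) of $s_{\mu|N}(\cdot\mid q^{N-1},q^{N-2},\dots)$, where $F_N\in\mathrm{Sym}(N)$ converges to $F\in\mathrm{Sym}$ if $\sup_N\deg F_N<\infty$ and, for every sufficiently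 large $d$, $\iota_{d,N}(F_N)\to F$ in $\mathrm{Sym}_{\le d}$; for $N\ge d$, $\iota_{d,N}:\mathrm{Sym}_{\le d}(N)\to\mathrm{Sym}_{\le d}$ is the inverse of the isomorphism $F\mapsto F(x_1,\dots,x_N,0,0,\dots)$. $q$-Meixner symmetric functions: $\Phi^{qM}_\lambda(X;q;a,c,d)=\sum_{\mu\subseteq\lambda}\sigma^{qM}(\lambda,\mu;q;a,c,d)\,I^A_\mu(Xc;q)$ with $$\sigma^{qM}(\lambda,\mu;q;a,c,d)=c^{-|\lambda|}\left(\frac a{qd}\right)^{|\lambda|-|\mu|}q^{2\{n(\mu')-n(\mu)-n(\lambda')+n(\lambda)\}}\det\left[\frac{\left(\frac caq^{\mu_k+2-k};q\right)_{\lambda_j-j-\mu_k+k}}{(q;q)_{\lambda_j-j-\mu_k+k}}\right]_{j,k=1}^{\ell(\lambda)};$$ an entry with $\lambda_j-j-\mu_k+k<0$ is $0$, and the empty determinant is $1$. One has $\Phi^{qM}_\lambda=S_\lambda+$ lower degree terms ($S_\lambda$ the Schur function). *)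

theory Defs
  imports
    "HOL-Library.Poly_Mapping"
    "Jordan_Normal_Form.Determinant"
begin

section \<open>Symmetric functions\<close>

text \<open>
  A monomial in the variables \<open>x\<^sub>0, x\<^sub>1, \<dots>\<close> is its finitely supported exponent vector.
  Throughout, indices that are customarily counted from 1 (variables, parts of a partition,
  rows and columns of a matrix) are counted from 0.
\<close>

type_synonym monom = "nat \<Rightarrow>\<^sub>0 nat"
type_synonym mpoly = "monom \<Rightarrow>\<^sub>0 complex"

definition mdeg :: "monom \<Rightarrow> nat"
  where "mdeg \<alpha> = (\<Sum>i\<in>Poly_Mapping.keys \<alpha>. Poly_Mapping.lookup \<alpha> i)"

lemma mdeg_superset:
  assumes "finite A" "Poly_Mapping.keys \<alpha> \<subseteq> A"
  shows "mdeg \<alpha> = (\<Sum>i\<in>A. Poly_Mapping.lookup \<alpha> i)"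
  unfolding mdeg_def using assms by (intro sum.mono_neutral_left) (auto simp: in_keys_iff)

lemma mdeg_add: "mdeg (\<alpha> + \<beta>) = mdeg \<alpha> + mdeg \<beta>"
proof -
  let ?A = "Poly_Mapping.keys \<alpha> \<union> Poly_Mapping.keys \<beta>"
  have "Poly_Mapping.keys (\<alpha> + \<beta>) \<subseteq> ?A" by (rule Poly_Mapping.keys_add)
  then show ?thesis
    by (simp add: mdeg_superset[of ?A] lookup_add sum.distrib)
qed

lemma mdeg_zero [simp]: "mdeg 0 = 0"
  by (simp add: mdeg_def)

lemma lookup_le_mdeg: "Poly_Mapping.lookup \<alpha> i \<le> mdeg \<alpha>"
proof (cases "i \<in> Poly_Mapping.keys \<alpha>")
  case True
  then show ?thesis unfolding mdeg_def by (intro member_le_sum) auto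
qed (simp add: in_keys_iff)

lemma map_key_inv:
  fixes \<pi> :: "nat \<Rightarrow> nat"
  assumes "bij \<pi>"
  shows "Poly_Mapping.map_key \<pi> (Poly_Mapping.map_key (inv_into UNIV \<pi>) \<alpha>) = \<alpha>"
    and "Poly_Mapping.map_key (inv_into UNIV \<pi>) (Poly_Mapping.map_key \<pi> \<alpha>) = \<alpha>"
proof -
  have i: "inj \<pi>" "inj (inv_into UNIV \<pi>)" using assms by (auto simp: bij_is_inj bij_imp_bij_inv)
  show "Poly_Mapping.map_key \<pi> (Poly_Mapping.map_key (inv_into UNIV \<pi>) \<alpha>) = \<alpha>"
    by (rule poly_mapping_eqI) (use assms i in \<open>simp add: map_key.rep_eq bij_is_inj\<close>)
  show "Poly_Mapping.map_key (inv_into UNIV \<pi>) (Poly_Mapping.map_key \<pi> \<alpha>) = \<alpha>"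
    by (rule poly_mapping_eqI)
      (use assms i in \<open>simp add: map_key.rep_eq bij_is_surj surj_f_inv_f\<close>)
qed

lemma finite_monoms:
  assumes "finite K"
  shows "finite {\<alpha> :: monom. Poly_Mapping.keys \<alpha> \<subseteq> K \<and> (\<forall>i. Poly_Mapping.lookup \<alpha> i \<le> M)}"
proof (rule finite_imageD)
  have "Poly_Mapping.lookup ` {\<alpha> :: monom. Poly_Mapping.keys \<alpha> \<subseteq> K \<and> (\<forall>i. Poly_Mapping.lookup \<alpha> i \<le> M)}
    \<subseteq> {f. \<forall>x. (x \<in> K \<longrightarrow> f x \<in> {..M}) \<and> (x \<notin> K \<longrightarrow> f x = 0)}"
    by (auto simp: in_keys_iff subset_eq)
  then show "finite (Poly_Mapping.lookup `
      {\<alpha> :: monom. Poly_Mapping.keys \<alpha> \<subseteq> K \<and> (\<forall>i. Poly_Mapping.lookup \<alpha> i \<le> M)})"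
    by (rule finite_subset) (rule finite_set_of_finite_funs, use assms in auto)
  show "inj_on Poly_Mapping.lookup
      {\<alpha> :: monom. Poly_Mapping.keys \<alpha> \<subseteq> K \<and> (\<forall>i. Poly_Mapping.lookup \<alpha> i \<le> M)}"
    by (simp add: inj_on_def poly_mapping.lookup_inject)
qed

definition splits :: "monom \<Rightarrow> (monom \<times> monom) set"
  where "splits \<gamma> = {(\<alpha>, \<beta>). \<alpha> + \<beta> = \<gamma>}"

lemma finite_splits [simp]: "finite (splits \<gamma>)"
proof -
  let ?S = "{\<alpha> :: monom. Poly_Mapping.keys \<alpha> \<subseteq> Poly_Mapping.keys \<gamma> \<and>
    (\<forall>i. Poly_Mapping.lookup \<alpha> i \<le> mdeg \<gamma>)}"
  have 1: "\<alpha> \<in> ?S" if "\<alpha> + \<beta> = \<gamma>" for \<alpha> \<beta>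
  proof -
    have le: "Poly_Mapping.lookup \<alpha> i \<le> Poly_Mapping.lookup \<gamma> i" for i
      unfolding that[symmetric] by (simp add: lookup_add)
    have "Poly_Mapping.keys \<alpha> \<subseteq> Poly_Mapping.keys \<gamma>"
    proof
      fix i assume "i \<in> Poly_Mapping.keys \<alpha>"
      with le[of i] show "i \<in> Poly_Mapping.keys \<gamma>" by (simp add: in_keys_iff)
    qed
    then show ?thesis using order_trans[OF le lookup_le_mdeg] by simp
  qed
  have "splits \<gamma> \<subseteq> ?S \<times> ?S"
  proof
    fix p assume "p \<in> splits \<gamma>"
    then obtain \<alpha> \<beta> where p: "p = (\<alpha>, \<beta>)" "\<alpha> + \<beta> = \<gamma>"
      by (auto simp: splits_def)
    have "\<beta> + \<alpha> = \<gamma>" using p(2) by (simp add: add.commute)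
    then show "p \<in> ?S \<times> ?S" unfolding p(1) using 1[OF p(2)] 1 by blast
  qed
  then show ?thesis
    by (rule finite_subset) (intro finite_cartesian_product finite_monoms; simp)
qed

text \<open>
  The algebra Sym over the complex numbers: formal power series in countably many variables
  (given by their coefficients), of bounded degree and invariant under permutations of the
  variables. As monomials have finite support, it makes no difference whether finitary or
  arbitrary permutations are used.
\<close>

definition symmetric_series :: "(monom \<Rightarrow> complex) set"
  where "symmetric_series =
    {f. (\<exists>d. \<forall>\<alpha>. f \<alpha> \<noteq> 0 \<longrightarrow> mdeg \<alpha> \<le> d) \<and>
        (\<forall>\<pi> \<alpha>. bij \<pi> \<longrightarrow> f (Poly_Mapping.map_key \<pi> \<alpha>) = f \<alpha>)}"

typedef symfun = symmetric_series
  morphisms sym_coeff Abs_symfun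
  by (rule exI[of _ "\<lambda>_. 0"]) (simp add: symmetric_series_def)

setup_lifting type_definition_symfun

lemma symmetric_seriesI:
  assumes "\<And>\<alpha>. f \<alpha> \<noteq> 0 \<Longrightarrow> mdeg \<alpha> \<le> d"
    and "\<And>\<pi> \<alpha>. bij \<pi> \<Longrightarrow> f (Poly_Mapping.map_key \<pi> \<alpha>) = f \<alpha>"
  shows "f \<in> symmetric_series"
  using assms unfolding symmetric_series_def by blast

lemma symfun_eqI: "(\<And>\<alpha>. sym_coeff F \<alpha> = sym_coeff G \<alpha>) \<Longrightarrow> F = G"
  by (simp add: sym_coeff_inject[symmetric] fun_eq_iff)

lemma map_key_eq_0_iff:
  fixes \<pi> :: "nat \<Rightarrow> nat"
  assumes "bij \<pi>"
  shows "Poly_Mapping.map_key \<pi> (\<alpha> :: monom) = 0 \<longleftrightarrow> \<alpha> = 0"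
  using map_key_inv(2)[OF assms, of \<alpha>] assms by (auto simp: bij_is_inj bij_imp_bij_inv)

lemma mdeg_map_key:
  fixes \<pi> :: "nat \<Rightarrow> nat"
  assumes "bij \<pi>"
  shows "mdeg (Poly_Mapping.map_key \<pi> \<alpha>) = mdeg \<alpha>"
  unfolding mdeg_def
  by (rule sum.reindex_bij_witness[of _ "inv_into UNIV \<pi>" \<pi>])
    (use assms in \<open>auto simp: keys_map_key map_key.rep_eq bij_is_inj bij_is_surj surj_f_inv_f\<close>)

instantiation symfun :: comm_ring_1
begin

lift_definition zero_symfun :: symfun is "\<lambda>_. 0"
  by (rule symmetric_seriesI) auto

lift_definition one_symfun :: symfun is "\<lambda>\<alpha>. if \<alpha> = 0 then 1 else 0"
  by (rule symmetric_seriesI[of _ 0]) (auto simp: map_key_eq_0_iff split: if_splits)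

lift_definition plus_symfun :: "symfun \<Rightarrow> symfun \<Rightarrow> symfun" is "\<lambda>f g \<alpha>. f \<alpha> + g \<alpha>"
proof -
  fix f g assume "f \<in> symmetric_series" "g \<in> symmetric_series"
  then obtain d e where d: "\<forall>\<alpha>. f \<alpha> \<noteq> 0 \<longrightarrow> mdeg \<alpha> \<le> d" "\<forall>\<alpha>. g \<alpha> \<noteq> 0 \<longrightarrow> mdeg \<alpha> \<le> e"
    and s: "\<And>\<pi> \<alpha>. bij \<pi> \<Longrightarrow> f (Poly_Mapping.map_key \<pi> \<alpha>) = f \<alpha>"
    "\<And>\<pi> \<alpha>. bij \<pi> \<Longrightarrow> g (Poly_Mapping.map_key \<pi> \<alpha>) = g \<alpha>"
    unfolding symmetric_series_def by blast
  show "(\<lambda>\<alpha>. f \<alpha> + g \<alpha>) \<in> symmetric_series"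
  proof (rule symmetric_seriesI[of _ "max d e"])
    fix \<alpha> assume "f \<alpha> + g \<alpha> \<noteq> 0"
    then have "f \<alpha> \<noteq> 0 \<or> g \<alpha> \<noteq> 0" by auto
    then show "mdeg \<alpha> \<le> max d e" using d by (auto simp: le_max_iff_disj)
  qed (simp add: s)
qed

lift_definition uminus_symfun :: "symfun \<Rightarrow> symfun" is "\<lambda>f \<alpha>. - f \<alpha>"
  by (auto simp: symmetric_series_def)

definition minus_symfun :: "symfun \<Rightarrow> symfun \<Rightarrow> symfun" where "F - G = F + - (G :: symfun)"

lift_definition times_symfun :: "symfun \<Rightarrow> symfun \<Rightarrow> symfun"
  is "\<lambda>f g \<gamma>. \<Sum>(\<alpha>, \<beta>)\<in>splits \<gamma>. f \<alpha> * g \<beta>"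
proof -
  fix f g assume "f \<in> symmetric_series" "g \<in> symmetric_series"
  then obtain d e where d: "\<forall>\<alpha>. f \<alpha> \<noteq> 0 \<longrightarrow> mdeg \<alpha> \<le> d" "\<forall>\<alpha>. g \<alpha> \<noteq> 0 \<longrightarrow> mdeg \<alpha> \<le> e"
    and s: "\<And>\<pi> \<alpha>. bij \<pi> \<Longrightarrow> f (Poly_Mapping.map_key \<pi> \<alpha>) = f \<alpha>"
    "\<And>\<pi> \<alpha>. bij \<pi> \<Longrightarrow> g (Poly_Mapping.map_key \<pi> \<alpha>) = g \<alpha>"
    unfolding symmetric_series_def by blast
  show "(\<lambda>\<gamma>. \<Sum>(\<alpha>, \<beta>)\<in>splits \<gamma>. f \<alpha> * g \<beta>) \<in> symmetric_series"
  proof (rule symmetric_seriesI[of _ "d + e"])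
    fix \<gamma> assume "(\<Sum>(\<alpha>, \<beta>)\<in>splits \<gamma>. f \<alpha> * g \<beta>) \<noteq> 0"
    then obtain p where "p \<in> splits \<gamma>" "(case p of (\<alpha>, \<beta>) \<Rightarrow> f \<alpha> * g \<beta>) \<noteq> 0"
      by (rule sum.not_neutral_contains_not_neutral)
    then obtain \<alpha> \<beta> where "(\<alpha>, \<beta>) \<in> splits \<gamma>" "f \<alpha> * g \<beta> \<noteq> 0"
      by (cases p) auto
    then show "mdeg \<gamma> \<le> d + e"
      using d by (auto simp: splits_def mdeg_add intro!: add_mono)
  next
    fix \<pi> :: "nat \<Rightarrow> nat" and \<gamma> assume \<pi>: "bij \<pi>"
    let ?m = "Poly_Mapping.map_key \<pi>" and ?n = "Poly_Mapping.map_key (inv_into UNIV \<pi>)"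
    have i: "inj \<pi>" "inj (inv_into UNIV \<pi>)" using \<pi> by (auto simp: bij_is_inj bij_imp_bij_inv)
    show "(\<Sum>(\<alpha>, \<beta>)\<in>splits (?m \<gamma>). f \<alpha> * g \<beta>) = (\<Sum>(\<alpha>, \<beta>)\<in>splits \<gamma>. f \<alpha> * g \<beta>)"
      by (rule sum.reindex_bij_witness[of _ "\<lambda>(\<alpha>, \<beta>). (?m \<alpha>, ?m \<beta>)" "\<lambda>(\<alpha>, \<beta>). (?n \<alpha>, ?n \<beta>)"])
        (use \<pi> i s bij_imp_bij_inv[OF \<pi>] in
          \<open>auto simp: splits_def map_key_inv map_key_plus[symmetric]\<close>)
  qed
qed

instance
proof
  fix F G H :: symfun
  show "F + G + H = F + (G + H)" by transfer (simp add: add.assoc)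
  show "F + G = G + F" by transfer (simp add: add.commute)
  show "0 + F = F" by transfer simp
  show "- F + F = 0" by transfer simp
  show "F - G = F + - G" by (fact minus_symfun_def)
  show "F * G * H = F * (G * H)"
  proof (transfer, rule ext)
    fix f g h :: "monom \<Rightarrow> complex" and \<gamma>
    have "(\<Sum>(\<alpha>, \<beta>)\<in>splits \<gamma>. (\<Sum>(\<alpha>, \<beta>)\<in>splits \<alpha>. f \<alpha> * g \<beta>) * h \<beta>)
      = (\<Sum>((\<rho>, \<tau>), \<alpha>, \<beta>)\<in>Sigma (splits \<gamma>) (\<lambda>p. splits (fst p)). f \<alpha> * g \<beta> * h \<tau>)"
      by (subst sum.Sigma[symmetric])
        (auto simp: sum_distrib_right case_prod_unfold intro!: sum.cong)
    also have "\<dots> = (\<Sum>((\<alpha>, \<rho>), \<beta>, \<tau>)\<in>Sigma (splits \<gamma>) (\<lambda>p. splits (snd p)). f \<alpha> * (g \<beta> * h \<tau>))"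
      by (rule sum.reindex_bij_witness
          [of _ "\<lambda>((\<alpha>, \<rho>), \<beta>, \<tau>). ((\<alpha> + \<beta>, \<tau>), \<alpha>, \<beta>)" "\<lambda>((\<rho>, \<tau>), \<alpha>, \<beta>). ((\<alpha>, \<beta> + \<tau>), \<beta>, \<tau>)"])
        (auto simp: splits_def add.assoc mult.assoc)
    also have "\<dots> = (\<Sum>(\<alpha>, \<beta>)\<in>splits \<gamma>. f \<alpha> * (\<Sum>(\<alpha>, \<beta>)\<in>splits \<beta>. g \<alpha> * h \<beta>))"
      by (subst sum.Sigma[symmetric])
        (auto simp: sum_distrib_left case_prod_unfold intro!: sum.cong)
    finally show "(\<Sum>(\<alpha>, \<beta>)\<in>splits \<gamma>. (\<Sum>(\<alpha>, \<beta>)\<in>splits \<alpha>. f \<alpha> * g \<beta>) * h \<beta>) =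
      (\<Sum>(\<alpha>, \<beta>)\<in>splits \<gamma>. f \<alpha> * (\<Sum>(\<alpha>, \<beta>)\<in>splits \<beta>. g \<alpha> * h \<beta>))" .
  qed
  show "F * G = G * F"
  proof (transfer, rule ext)
    fix f g :: "monom \<Rightarrow> complex" and \<gamma>
    show "(\<Sum>(\<alpha>, \<beta>)\<in>splits \<gamma>. f \<alpha> * g \<beta>) = (\<Sum>(\<alpha>, \<beta>)\<in>splits \<gamma>. g \<alpha> * f \<beta>)"
      by (rule sum.reindex_bij_witness[of _ prod.swap prod.swap])
        (auto simp: splits_def add.commute mult.commute)
  qed
  show "1 * F = F"
  proof (transfer, rule ext)
    fix f :: "monom \<Rightarrow> complex" and \<gamma>
    have "(\<Sum>(\<alpha>, \<beta>)\<in>splits \<gamma>. (if \<alpha> = 0 then 1 else 0) * f \<beta>)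
      = (\<Sum>(\<alpha>, \<beta>)\<in>{(0 :: monom, \<gamma>)}. (if \<alpha> = 0 then 1 else 0) * f \<beta>)"
    proof (rule sum.mono_neutral_right)
      show "finite (splits \<gamma>)" by simp
    qed (auto simp: splits_def split: if_splits)
    then show "(\<Sum>(\<alpha>, \<beta>)\<in>splits \<gamma>. (if \<alpha> = 0 then 1 else 0) * f \<beta>) = f \<gamma>" by simp
  qed
  show "(F + G) * H = F * H + G * H"
    by transfer (simp add: fun_eq_iff case_prod_unfold distrib_right sum.distrib)
  show "(0 :: symfun) \<noteq> 1" by transfer (auto simp: fun_eq_iff)
qed

end

lift_definition sym_scale :: "complex \<Rightarrow> symfun \<Rightarrow> symfun" is "\<lambda>z f \<alpha>. z * f \<alpha>"
  by (auto simp: symmetric_series_def)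

global_interpretation Sym: vector_space sym_scale
  by unfold_locales (transfer; simp add: algebra_simps)+

text \<open>\<open>sym_dilate c F\<close> is \<open>F(Xc) = F(c x\<^sub>0, c x\<^sub>1, \<dots>)\<close>.\<close>

lift_definition sym_dilate :: "complex \<Rightarrow> symfun \<Rightarrow> symfun" is "\<lambda>c f \<alpha>. c ^ mdeg \<alpha> * f \<alpha>"
  by (auto simp: symmetric_series_def mdeg_map_key)

definition Sym_upto :: "nat \<Rightarrow> symfun set"
  where "Sym_upto d = {F. \<forall>\<alpha>. sym_coeff F \<alpha> \<noteq> 0 \<longrightarrow> mdeg \<alpha> \<le> d}"


section \<open>Symmetric polynomials and their limits\<close>

definition mpoly_var :: "nat \<Rightarrow> mpoly"
  where "mpoly_var i = Poly_Mapping.single (Poly_Mapping.single i 1) 1"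

definition mpoly_const :: "complex \<Rightarrow> mpoly"
  where "mpoly_const z = Poly_Mapping.single 0 z"

definition mpoly_deg_le :: "nat \<Rightarrow> mpoly \<Rightarrow> bool"
  where "mpoly_deg_le d p \<longleftrightarrow> (\<forall>\<alpha>\<in>Poly_Mapping.keys p. mdeg \<alpha> \<le> d)"

text \<open>\<open>SymN N\<close> is \<open>Sym(N)\<close>, the symmetric polynomials in \<open>x\<^sub>0, \<dots>, x\<^sub>N\<^sub>-\<^sub>1\<close>.\<close>

definition SymN :: "nat \<Rightarrow> mpoly set"
  where "SymN N = {p. (\<forall>\<alpha>\<in>Poly_Mapping.keys p. Poly_Mapping.keys \<alpha> \<subseteq> {..<N}) \<and>
    (\<forall>\<pi> \<alpha>. \<pi> permutes {..<N} \<longrightarrow>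
       Poly_Mapping.lookup p (Poly_Mapping.map_key \<pi> \<alpha>) = Poly_Mapping.lookup p \<alpha>)}"

text \<open>\<open>sym_restrict N F\<close> is \<open>F(x\<^sub>0, \<dots>, x\<^sub>N\<^sub>-\<^sub>1, 0, 0, \<dots>)\<close>.\<close>

lift_definition sym_restrict :: "nat \<Rightarrow> symfun \<Rightarrow> mpoly"
  is "\<lambda>N f \<alpha>. if Poly_Mapping.keys \<alpha> \<subseteq> {..<N} then f \<alpha> else 0"
proof -
  fix N :: nat and f assume "f \<in> symmetric_series"
  then obtain d where d: "\<forall>\<alpha>. f \<alpha> \<noteq> 0 \<longrightarrow> mdeg \<alpha> \<le> d"
    unfolding symmetric_series_def by blast
  have "{\<alpha>. (if Poly_Mapping.keys \<alpha> \<subseteq> {..<N} then f \<alpha> else 0) \<noteq> 0} \<subseteq>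
    {\<alpha>. Poly_Mapping.keys \<alpha> \<subseteq> {..<N} \<and> (\<forall>i. Poly_Mapping.lookup \<alpha> i \<le> d)}"
    using d by (auto split: if_splits intro: order_trans[OF lookup_le_mdeg])
  then show "finite {\<alpha>. (if Poly_Mapping.keys \<alpha> \<subseteq> {..<N} then f \<alpha> else 0) \<noteq> 0}"
    by (rule finite_subset) (simp add: finite_monoms)
qed

text \<open>
  The inverse of the restriction map from \<open>Sym\<^sub>\<le>\<^sub>d\<close> to \<open>Sym\<^sub>\<le>\<^sub>d(N)\<close>; only meaningful for
  \<open>N \<ge> d\<close> and symmetric polynomials of degree at most \<open>d\<close>.
\<close>

definition sym_iota :: "nat \<Rightarrow> nat \<Rightarrow> mpoly \<Rightarrow> symfun"
  where "sym_iota d N = the_inv_into (Sym_upto d) (sym_restrict N)"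

text \<open>
  Convergence of \<open>F\<^sub>N \<in> Sym(N)\<close> to an element of Sym. The space \<open>Sym\<^sub>\<le>\<^sub>d\<close> is
  finite-dimensional and the coefficients separate its points, so convergence in it is
  convergence of each coefficient.
\<close>

definition Sym_upto_tendsto :: "nat \<Rightarrow> (nat \<Rightarrow> symfun) \<Rightarrow> symfun \<Rightarrow> bool"
  where "Sym_upto_tendsto d F G \<longleftrightarrow>
    G \<in> Sym_upto d \<and> (\<forall>\<alpha>. (\<lambda>N. sym_coeff (F N) \<alpha>) \<longlonglongrightarrow> sym_coeff G \<alpha>)"

definition SymN_tendsto :: "(nat \<Rightarrow> mpoly) \<Rightarrow> symfun \<Rightarrow> bool"
  where "SymN_tendsto F G \<longleftrightarrow>
    (\<forall>N. F N \<in> SymN N) \<and> (\<exists>D. \<forall>N. mpoly_deg_le D (F N)) \<and>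
    (\<exists>d\<^sub>0. \<forall>d\<ge>d\<^sub>0. Sym_upto_tendsto d (\<lambda>N. sym_iota d N (F N)) G)"


section \<open>Partitions\<close>

text \<open>The parts \<open>\<lambda>\<^sub>1 \<ge> \<lambda>\<^sub>2 \<ge> \<dots>\<close> are \<open>la 0, la 1, \<dots>\<close>, followed by zeros.
  Containment of diagrams is then the pointwise order, and the empty partition is \<open>\<lambda>_. 0\<close>.\<close>

definition is_partition :: "(nat \<Rightarrow> nat) \<Rightarrow> bool"
  where "is_partition la \<longleftrightarrow> antimono la \<and> finite {i. la i \<noteq> 0}"

definition plen :: "(nat \<Rightarrow> nat) \<Rightarrow> nat"
  where "plen la = card {i. la i \<noteq> 0}"

definition psize :: "(nat \<Rightarrow> nat) \<Rightarrow> nat"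
  where "psize la = (\<Sum>i<plen la. la i)"

definition pn :: "(nat \<Rightarrow> nat) \<Rightarrow> nat"
  where "pn la = (\<Sum>i<plen la. i * la i)"

definition ptranspose :: "(nat \<Rightarrow> nat) \<Rightarrow> nat \<Rightarrow> nat"
  where "ptranspose la j = card {i. j < la i}"


section \<open>Interpolation symmetric functions\<close>

definition qpoch :: "complex \<Rightarrow> complex \<Rightarrow> nat \<Rightarrow> complex"
  where "qpoch x q n = (\<Prod>k<n. 1 - x * q ^ k)"

definition qpoch_partition :: "complex \<Rightarrow> complex \<Rightarrow> (nat \<Rightarrow> nat) \<Rightarrow> complex"
  where "qpoch_partition x q mu = (\<Prod>i<plen mu. qpoch (x * q powi (- int i)) q (mu i))"

definition vandermonde :: "nat \<Rightarrow> mpoly"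
  where "vandermonde N = (\<Prod>(i, j)\<in>{(i, j). i < j \<and> j < N}. mpoly_var i - mpoly_var j)"

definition shifted_power :: "mpoly \<Rightarrow> (nat \<Rightarrow> complex) \<Rightarrow> nat \<Rightarrow> mpoly"
  where "shifted_power x c m = (\<Prod>i<m. x - mpoly_const (c i))"

text \<open>The quotient of the determinant by \<open>V\<close>, which is exact and unique in the integral domain
  of polynomials. For more than \<open>N\<close> nonzero parts it is set to zero.\<close>

definition interp_schur :: "nat \<Rightarrow> (nat \<Rightarrow> nat) \<Rightarrow> (nat \<Rightarrow> complex) \<Rightarrow> mpoly"
  where "interp_schur N mu c =
    (if plen mu \<le> N
     then (THE s. s * vandermonde N =
       det (mat N N (\<lambda>(i, j). shifted_power (mpoly_var j) c (mu i + (N - 1 - i)))))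
     else 0)"

definition interp_A :: "(nat \<Rightarrow> nat) \<Rightarrow> complex \<Rightarrow> symfun"
  where "interp_A mu q =
    (THE F. SymN_tendsto (\<lambda>N. interp_schur N mu (\<lambda>i. q powi (int N - 1 - int i))) F)"


section \<open>q-Meixner symmetric functions\<close>

definition qM_entry ::
  "(nat \<Rightarrow> nat) \<Rightarrow> (nat \<Rightarrow> nat) \<Rightarrow> complex \<Rightarrow> complex \<Rightarrow> complex \<Rightarrow> nat \<Rightarrow> nat \<Rightarrow> complex"
  where "qM_entry la mu q a c j k =
    (let m = int (la j) - int j - int (mu k) + int k in
      if m < 0 then 0
      else qpoch (c / a * q powi (int (mu k) + 1 - int k)) q (nat m) / qpoch q q (nat m))"

definition qM_sigma ::
  "(nat \<Rightarrow> nat) \<Rightarrow> (nat \<Rightarrow> nat) \<Rightarrow> complex \<Rightarrow> complex \<Rightarrow> complex \<Rightarrow> complex \<Rightarrow> complex"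
  where "qM_sigma la mu q a c d =
    c powi (- int (psize la)) * (a / (q * d)) powi (int (psize la) - int (psize mu)) *
    q powi (2 * (int (pn (ptranspose mu)) - int (pn mu) - int (pn (ptranspose la)) + int (pn la))) *
    det (mat (plen la) (plen la) (\<lambda>(j, k). qM_entry la mu q a c j k))"

definition qM_Phi :: "complex \<Rightarrow> complex \<Rightarrow> complex \<Rightarrow> complex \<Rightarrow> (nat \<Rightarrow> nat) \<Rightarrow> symfun"
  where "qM_Phi q a c d la =
    (\<Sum>mu\<in>{mu. is_partition mu \<and> mu \<le> la}.
      sym_scale (qM_sigma la mu q a c d) (sym_dilate c (interp_A mu q)))"

definition qM_h :: "complex \<Rightarrow> complex \<Rightarrow> complex \<Rightarrow> complex \<Rightarrow> (nat \<Rightarrow> nat) \<Rightarrow> complex"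
  where "qM_h q a c d la =
    q powi (4 * (int (pn la) - int (pn (ptranspose la)))) *
    (a\<^sup>2 / (c\<^sup>2 * d\<^sup>2 * q ^ 3)) ^ psize la *
    (qpoch_partition (c * q / a) q la * qpoch_partition (d * q / a) q la)"

definition qM_admissible :: "real \<Rightarrow> real \<Rightarrow> complex \<Rightarrow> complex \<Rightarrow> bool"
  where "qM_admissible q a c d \<longleftrightarrow> a > 0 \<and>
    ((c \<notin> \<real> \<and> d = cnj c) \<or>
     (\<exists>x y :: real. c = complex_of_real x \<and> d = complex_of_real y \<and>
       ((\<exists>m :: int. a * q powi m < x \<and> x < a * q powi (m - 1) \<and>
                    a * q powi m < y \<and> y < a * q powi (m - 1)) \<or>
        (x < 0 \<and> y < 0 \<and> q < x / y \<and> x / y < inverse q))))"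

end

theory Submission
  imports Defs
    "HOL-Library.FuncSet"
    "HOL-Computational_Algebra.Formal_Power_Series"
    "Subresultants.More_Homomorphisms"
begin

text \<open>
  Restriction to \<open>N\<close> variables turns everything into determinants: by the Cauchy--Binet formula the
  \<open>N\<close>-variate functions \<open>det [p\<^sub>\<lambda>\<^sub>i\<^sub>+\<^sub>N\<^sub>-\<^sub>i(x\<^sub>j)] / V\<close> built from the one-variable \<open>q\<close>-Meixner polynomials
  \<open>p\<^sub>n\<close> with parameters proportional to \<open>q\<^sup>1\<^sup>-\<^sup>N\<close> expand in the interpolation functions with the coefficients
  \<open>\<sigma>(\<lambda>, \<mu>)\<close>, except for the extra factor
  \<open>\<Prod>\<^sub>i (q;q)\<^sub>\<lambda>\<^sub>i\<^sub>+\<^sub>N\<^sub>-\<^sub>i / (q;q)\<^sub>\<mu>\<^sub>i\<^sub>+\<^sub>N\<^sub>-\<^sub>i\<close>, which tends to 1. By Favard's theorem the \<open>p\<^sub>n\<close> are orthogonal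
  for some formal (not necessarily positive) functional, so Andreief's identity gives orthogonality of
  the \<open>N\<close>-variate functions, with squared norms that tend to \<open>h\<^sub>\<lambda>\<close>. The transition coefficients to the Schur
  functions converge and are unitriangular; hence the \<open>N\<close>-variate functionals, normalised to be 1 at 1,
  converge on every Schur function to the given functional, and orthogonality passes to the limit.
\<close>

section \<open>Determinants and partitions\<close>

text \<open>The functional is given by its values on the \<Phi> alone, so a product of two \<Phi> is
  out of its direct reach; in N variables the product is one of two alternants, which Andreief's
  identity evaluates. The nodes q^(N-1), q^(N-2), ... fix the scale of the one-variable polynomials,
  and (c/a) q^(1-N), (d/a) q^(1-N) are the parameters for which the entries of the determinant in
  \<sigma> are free of N. What then remains of N are powers of q that are quadratic in the
  exponents; they cancel up to a factor 1/q per box in \<sigma> and 1/q^3 per box in h, and this is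
  where these constants come from. To compare different N, every N-variate function is lifted to Sym
  as a combination of Jacobi--Trudi determinants. For a given partition the same finitely many Schur
  functions occur for every N, so that convergence means convergence of finitely many numbers.
  Admissibility enters through the non-vanishing of all norms, which permits the normalisation by
  the norm of the empty partition.\<close>

definition fun_det :: "nat \<Rightarrow> (nat \<Rightarrow> nat \<Rightarrow> 'a) \<Rightarrow> 'a::comm_ring_1"
  where "fun_det n f = det (mat n n (\<lambda>(i, j). f i j))"

lemma fun_det_rows:
  "fun_det n f = (\<Sum>p | p permutes {..<n}. signof p * (\<Prod>i<n. f i (p i)))"
  unfolding fun_det_def
  by (subst det_def'[of _ n]) (auto simp: atLeast0LessThan permutes_in_image intro!: sum.cong)

lemma fun_det_cols:
  "fun_det n f = (\<Sum>p | p permutes {..<n}. signof p * (\<Prod>j<n. f (p j) j))"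
  unfolding fun_det_def
  by (subst det_col[of _ n]) (auto simp: atLeast0LessThan permutes_in_image intro!: sum.cong)

lemma fun_det_0 [simp]: "fun_det 0 f = 1"
  by (simp add: fun_det_rows)

lemma fun_det_cong: "(\<And>i j. i < n \<Longrightarrow> j < n \<Longrightarrow> f i j = g i j) \<Longrightarrow> fun_det n f = fun_det n g"
  unfolding fun_det_def by (intro arg_cong[of _ _ det] eq_matI) auto

lemma fun_det_transpose: "fun_det n (\<lambda>i j. f j i) = fun_det n f"
  by (subst fun_det_rows, subst fun_det_cols) (rule refl)

lemma fun_det_permute_rows:
  assumes "p permutes {..<n}"
  shows "fun_det n (\<lambda>i. f (p i)) = signof p * fun_det n f"
  using det_permute_rows[of "mat n n (\<lambda>(i, j). f i j)" n p] assms
  unfolding fun_det_def by (auto simp: atLeast0LessThan permutes_in_image elim!: trans[rotated] intro!: arg_cong[of _ _ det])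

lemma fun_det_eq_rows:
  assumes "i < n" "i' < n" "i \<noteq> i'" "\<And>j. j < n \<Longrightarrow> f i j = f i' j"
  shows "fun_det n f = 0"
  unfolding fun_det_def using assms
  by (intro det_identical_rows[of _ n i i']) (auto intro!: eq_vecI)

lemma fun_det_zeroI:
  assumes "\<And>p. p permutes {..<n} \<Longrightarrow> \<exists>i<n. f i (p i) = 0"
  shows "fun_det n f = 0"
  unfolding fun_det_rows
proof (intro sum.neutral ballI)
  fix p assume "p \<in> {p. p permutes {..<n}}"
  then have "(\<Prod>i<n. f i (p i)) = 0" using assms by (intro prod_zero) auto
  then show "signof p * (\<Prod>i<n. f i (p i)) = 0" by simp
qed

text \<open>The last N - n rows are unitriangular, so Laplace expansion along the last row strips
  them one by one. This brings determinants of growing size N to a fixed size before a limit is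
  taken.\<close>

lemma fun_det_reduce:
  assumes "n \<le> N" "\<And>i j. n \<le> i \<Longrightarrow> i < N \<Longrightarrow> j < i \<Longrightarrow> f i j = 0"
    "\<And>i. n \<le> i \<Longrightarrow> i < N \<Longrightarrow> f i i = 1"
  shows "fun_det N f = fun_det n f"
  using assms
proof (induction N)
  case (Suc N)
  show ?case
  proof (cases "n = Suc N")
    case False
    then have n: "n \<le> N" using Suc.prems by simp
    let ?A = "mat (Suc N) (Suc N) (\<lambda>(i, j). f i j)"
    have "fun_det (Suc N) f = (\<Sum>j<Suc N. ?A $$ (N, j) * cofactor ?A N j)"
      unfolding fun_det_def by (rule laplace_expansion_row) auto
    also have "\<dots> = cofactor ?A N N"
      using Suc.prems(2)[of N] Suc.prems(3)[of N] n by (simp add: sum.neutral)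
    also have "\<dots> = det (mat_delete ?A N N)"
      by (simp add: cofactor_def)
    also have "mat_delete ?A N N = mat N N (\<lambda>(i, j). f i j)"
      by (rule eq_matI) (auto simp: mat_delete_def)
    also have "det \<dots> = fun_det n f"
      using Suc.IH n Suc.prems unfolding fun_det_def by simp
    finally show ?thesis .
  qed simp
qed simp

lemma fun_det_hom:
  assumes "comm_ring_hom h"
  shows "h (fun_det n f) = fun_det n (\<lambda>i j. h (f i j))"
proof -
  interpret comm_ring_hom h by fact
  show ?thesis unfolding fun_det_def hom_det[symmetric]
    by (intro arg_cong[of _ _ det] eq_matI) auto
qed

lemma fun_det_mult:
  "fun_det n (\<lambda>i j. \<Sum>k<n. f i k * g k j) = fun_det n f * fun_det n g"
  unfolding fun_det_def
  by (subst det_mult[symmetric, of _ n])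
    (auto simp: scalar_prod_def atLeast0LessThan intro!: arg_cong[of _ _ det])

lemma fun_det_scale:
  "fun_det n (\<lambda>i j. u i * v j * f i j) = (\<Prod>i<n. u i) * (\<Prod>j<n. v j) * fun_det n f"
proof -
  have "(\<Prod>i<n. u i * v (p i) * f i (p i)) = (\<Prod>i<n. u i) * (\<Prod>j<n. v j) * (\<Prod>i<n. f i (p i))"
    if "p permutes {..<n}" for p
    using prod.permute[OF that, of v] by (simp add: prod.distrib o_def)
  then show ?thesis
    unfolding fun_det_rows sum_distrib_left by (intro sum.cong) (auto simp: mult_ac)
qed

text \<open>Every row is a combination of the rows \<open>u k\<close>. A choice of one index per row
  is an extensional function, so that each choice is counted once.\<close>

lemma fun_det_multilinear:
  assumes "finite K"
  shows "fun_det n (\<lambda>i j. \<Sum>k\<in>K. t i k * u k j) =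
    (\<Sum>f\<in>{..<n} \<rightarrow>\<^sub>E K. (\<Prod>i<n. t i (f i)) * fun_det n (\<lambda>i j. u (f i) j))"
proof -
  have "fun_det n (\<lambda>i j. \<Sum>k\<in>K. t i k * u k j) =
    (\<Sum>p | p permutes {..<n}. signof p *
      (\<Sum>f\<in>{..<n} \<rightarrow>\<^sub>E K. \<Prod>i<n. t i (f i) * u (f i) (p i)))"
    unfolding fun_det_rows by (subst prod_sum_PiE) (use assms in auto)
  also have "\<dots> = (\<Sum>f\<in>{..<n} \<rightarrow>\<^sub>E K. \<Sum>p | p permutes {..<n}. signof p *
      (\<Prod>i<n. t i (f i) * u (f i) (p i)))"
    unfolding sum_distrib_left by (rule sum.swap)
  also have "\<dots> = (\<Sum>f\<in>{..<n} \<rightarrow>\<^sub>E K. (\<Prod>i<n. t i (f i)) * fun_det n (\<lambda>i j. u (f i) j))"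
    unfolding fun_det_rows sum_distrib_left
    by (intro sum.cong) (auto simp: prod.distrib mult_ac)
  finally show ?thesis .
qed

section \<open>Partitions as strictly decreasing exponent sequences\<close>

definition parts :: "nat \<Rightarrow> (nat \<Rightarrow> nat) set"
  where "parts N = {la. antimono la \<and> (\<forall>i\<ge>N. la i = 0)}"

text \<open>The exponents \<lambda> + \<delta> of the alternant in N variables, with rows counted
  from 0. Only indices below N are meaningful, because the subtraction truncates.\<close>

definition shifted :: "nat \<Rightarrow> (nat \<Rightarrow> nat) \<Rightarrow> nat \<Rightarrow> nat"
  where "shifted N la i = la i + (N - 1 - i)"

lemma antimono_le: "antimono (la :: nat \<Rightarrow> nat) \<Longrightarrow> i \<le> j \<Longrightarrow> la j \<le> la i"
  by (simp add: antimono_def)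

lemma shifted_strict:
  assumes "la \<in> parts N" "i < j" "j < N"
  shows "shifted N la j < shifted N la i"
proof -
  have "la j \<le> la i" using assms antimono_le[of la i j] by (auto simp: parts_def)
  then show ?thesis using assms unfolding shifted_def by linarith
qed

lemma shifted_mono: "la \<in> parts N \<Longrightarrow> i \<le> j \<Longrightarrow> j < N \<Longrightarrow> shifted N la j \<le> shifted N la i"
  using shifted_strict[of la N i j] by (cases "i = j") auto

lemma shifted_inj_on: "la \<in> parts N \<Longrightarrow> inj_on (shifted N la) {..<N}"
  by (rule linorder_inj_onI) (use shifted_strict in \<open>force+\<close>)

text \<open>Read backwards, both sequences are the sorted list of one and the same set.\<close>

lemma strict_dec_unique:
  fixes m m' :: "nat \<Rightarrow> nat"
  assumes "\<And>i j. i < j \<Longrightarrow> j < N \<Longrightarrow> m j < m i" "\<And>i j. i < j \<Longrightarrow> j < N \<Longrightarrow> m' j < m' i"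
    and "m ` {..<N} = m' ` {..<N}" and "i < N"
  shows "m i = m' i"
proof -
  have s: "sorted_wrt (>) (map k [0..<N])" if "\<And>i j. i < j \<Longrightarrow> j < N \<Longrightarrow> k j < k i" for k :: "nat \<Rightarrow> nat"
    using that by (auto simp: sorted_wrt_iff_nth_less)
  have d: "sorted (rev (map k [0..<N]))" "distinct (rev (map k [0..<N]))"
    if "\<And>i j. i < j \<Longrightarrow> j < N \<Longrightarrow> k j < k i" for k :: "nat \<Rightarrow> nat"
  proof -
    have "sorted_wrt (<) (rev (map k [0..<N]))" using s[OF that]
      by (simp add: sorted_wrt_rev)
    then show "sorted (rev (map k [0..<N]))" "distinct (rev (map k [0..<N]))"
      by (auto simp only: strict_sorted_iff)
  qed
  have "rev (map m [0..<N]) = rev (map m' [0..<N])"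
    using assms(3) by (intro sorted_distinct_set_unique d assms(1,2)) (auto simp: atLeast0LessThan)
  then have "map m [0..<N] ! i = map m' [0..<N] ! i" by (simp only: rev_is_rev_conv)
  then show ?thesis using \<open>i < N\<close> by simp
qed

lemma strict_dec_exists:
  assumes "finite (S :: nat set)" "card S = N"
  obtains la where "la \<in> parts N" "shifted N la ` {..<N} = S"
proof -
  define xs where "xs = rev (sorted_list_of_set S)"
  have len: "length xs = N" and set: "set xs = S" using assms by (auto simp: xs_def)
  have dec: "xs ! j < xs ! i" if "i < j" "j < N" for i j
  proof -
    have "sorted_wrt (<) (rev xs)" unfolding xs_def by simp
    then have "sorted_wrt (>) xs" by (simp add: sorted_wrt_rev)
    then show ?thesis using that len by (auto simp: sorted_wrt_iff_nth_less)
  qed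
  define la where "la = (\<lambda>i. if i < N then xs ! i - (N - 1 - i) else 0)"
  \<comment> \<open>Strict decrease loses at least one per step. Hence the differences from the
    staircase still decrease weakly, and none of the subtractions in \<open>la\<close>
    truncates.\<close>
  have gap: "xs ! i \<ge> xs ! j + (j - i)" if "i \<le> j" "j < N" for i j
    using that
  proof (induction j)
    case (Suc j)
    show ?case
    proof (cases "i = Suc j")
      case False
      then have "xs ! i \<ge> xs ! j + (j - i)" using Suc by simp
      with dec[of j "Suc j"] False Suc.prems show ?thesis by linarith
    qed simp
  qed simp
  have ge: "xs ! i \<ge> N - 1 - i" if "i < N" for i
    using gap[of i "N - 1"] that by linarith
  have "la j \<le> la i" if "i \<le> j" for i j
    using gap[of i j] ge[of i] ge[of j] that unfolding la_def by auto
  then have p: "la \<in> parts N" by (auto simp: parts_def antimono_def la_def)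
  have "shifted N la i = xs ! i" if "i < N" for i
    using ge[of i] that by (simp add: shifted_def la_def)
  then have "shifted N la ` {..<N} = set xs" using len by (auto simp: in_set_conv_nth image_iff)
  with p set that show ?thesis by blast
qed

text \<open>The image set determines the decreasing sequence, and injectivity of f makes the
  comparison of positions a permutation. \<open>shifted_permuted_unique\<close> adds that both are
  determined by f.\<close>

lemma sort_injective:
  assumes "inj_on f {..<N}"
  obtains la p where "la \<in> parts N" "p permutes {..<N}" "\<And>i. i < N \<Longrightarrow> f i = shifted N la (p i)"
proof -
  have "card (f ` {..<N}) = N" using assms by (simp add: card_image)
  then obtain la where la: "la \<in> parts N" "shifted N la ` {..<N} = f ` {..<N}"
    using strict_dec_exists[of "f ` {..<N}" N] by (metis finite_imageI finite_lessThan)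
  define p where "p = (\<lambda>i. if i < N then the_inv_into {..<N} (shifted N la) (f i) else i)"
  have *: "p i < N" "shifted N la (p i) = f i" if "i < N" for i
  proof -
    have "f i \<in> shifted N la ` {..<N}" using la(2) that by auto
    with the_inv_into_into[OF shifted_inj_on[OF la(1)] this] f_the_inv_into_f[OF shifted_inj_on[OF la(1)] this]
    show "p i < N" "shifted N la (p i) = f i" using that by (auto simp: p_def)
  qed
  have "inj_on p {..<N}"
  proof (rule inj_onI)
    fix i j assume "i \<in> {..<N}" "j \<in> {..<N}" "p i = p j"
    then show "i = j" using *(2)[of i] *(2)[of j] assms by (auto simp: inj_on_def)
  qed
  then have "bij_betw p {..<N} {..<N}"
    using *(1) unfolding bij_betw_def by (intro conjI endo_inj_surj) auto
  then have "p permutes {..<N}" by (rule bij_imp_permutes) (simp add: p_def)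
  with la(1) *(2) that show ?thesis by metis
qed

lemma parts_eqI:
  assumes "la \<in> parts N" "mu \<in> parts N" "\<And>i. i < N \<Longrightarrow> shifted N la i = shifted N mu i"
  shows "la = mu"
proof
  fix i show "la i = mu i"
    using assms(1,2) assms(3)[of i] by (cases "i < N") (auto simp: parts_def shifted_def)
qed

lemma shifted_permuted_unique:
  assumes "la \<in> parts N" "mu \<in> parts N" "p permutes {..<N}" "r permutes {..<N}"
    "\<And>i. i < N \<Longrightarrow> shifted N la (p i) = shifted N mu (r i)"
  shows "la = mu" "p = r"
proof -
  have "shifted N la ` {..<N} = (\<lambda>i. shifted N la (p i)) ` {..<N}"
    using permutes_image[OF assms(3)] by (metis image_image)
  also have "\<dots> = (\<lambda>i. shifted N mu (r i)) ` {..<N}" using assms(5) by auto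
  also have "\<dots> = shifted N mu ` {..<N}" using permutes_image[OF assms(4)] by (metis image_image)
  finally have im: "shifted N la ` {..<N} = shifted N mu ` {..<N}" .
  show 1: "la = mu"
  proof (rule parts_eqI[OF assms(1,2)])
    fix i assume "i < N"
    with im show "shifted N la i = shifted N mu i"
      by (intro strict_dec_unique[of N]) (use assms shifted_strict in auto)
  qed
  show "p = r"
  proof
    fix i show "p i = r i"
    proof (cases "i < N")
      case True
      then have "p i \<in> {..<N}" "r i \<in> {..<N}" using permutes_in_image[OF assms(3), of i] permutes_in_image[OF assms(4), of i] by auto
      then show ?thesis using shifted_inj_on[OF assms(1)] assms(5)[OF True] 1 by (auto simp: inj_on_def)
    next
      case False
      then show ?thesis using assms(3,4) by (auto simp: permutes_def)
    qed
  qed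
qed

text \<open>If mu exceeds la at row \<open>i0\<close>, triangularity annihilates the block of rows
  from \<open>i0\<close> on and columns up to \<open>i0\<close>. Its N - i0 rows and i0 + 1 columns
  are together more than N, so every permutation meets the block.\<close>

lemma fun_det_shift_zero:
  assumes la: "la \<in> parts N" and mu: "mu \<in> parts N" and T: "\<And>n k. n < k \<Longrightarrow> T n k = (0 :: 'a :: comm_ring_1)"
    and nle: "\<not> mu \<le> la"
  shows "fun_det N (\<lambda>i j. T (shifted N la i) (shifted N mu j)) = 0"
proof -
  obtain i0 where i0: "la i0 < mu i0" using nle by (auto simp: le_fun_def not_le)
  then have N: "i0 < N" using mu unfolding parts_def by (cases "i0 < N") auto
  have lt: "shifted N la i0 < shifted N mu i0" using i0 by (simp add: shifted_def)
  show ?thesis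
  proof (rule fun_det_zeroI)
    fix p assume p: "p permutes {..<N}"
    have "\<exists>i\<in>{i0..<N}. p i \<le> i0"
    proof (rule ccontr)
      assume "\<not> ?thesis"
      then have *: "i0 < p i" if "i0 \<le> i" "i < N" for i using that by (simp add: not_le)
      have "p i < N" if "i < N" for i using that permutes_in_image[OF p, of i] by simp
      with * have "p ` {i0..<N} \<subseteq> {Suc i0..<N}" by (auto simp: Suc_le_eq)
      then have "card (p ` {i0..<N}) \<le> card {Suc i0..<N}" by (intro card_mono) auto
      moreover have "card (p ` {i0..<N}) = card {i0..<N}"
        by (rule card_image) (rule permutes_inj_on[OF p])
      ultimately show False using N by simp
    qed
    then obtain i where i: "i0 \<le> i" "i < N" "p i \<le> i0" by auto
    have "shifted N la i \<le> shifted N la i0" "shifted N mu i0 \<le> shifted N mu (p i)"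
      using shifted_mono[OF la] shifted_mono[OF mu] i N by auto
    with lt i show "\<exists>i<N. T (shifted N la i) (shifted N mu (p i)) = 0"
      by (intro exI[of _ i]) (auto intro!: T)
  qed
qed

lemma finite_parts_bounded: "finite {mu \<in> parts N. mu 0 \<le> K}"
proof -
  have "{mu \<in> parts N. mu 0 \<le> K} \<subseteq> {f. \<forall>x. (x \<in> {..<N} \<longrightarrow> f x \<in> {..K}) \<and> (x \<notin> {..<N} \<longrightarrow> f x = 0)}"
  proof
    fix mu assume mu: "mu \<in> {mu \<in> parts N. mu 0 \<le> K}"
    then have "mu i \<le> K" for i using antimono_le[of mu 0 i] by (simp add: parts_def)
    with mu show "mu \<in> {f. \<forall>x. (x \<in> {..<N} \<longrightarrow> f x \<in> {..K}) \<and> (x \<notin> {..<N} \<longrightarrow> f x = 0)}"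
      by (simp add: parts_def)
  qed
  then show ?thesis by (rule finite_subset) (rule finite_set_of_finite_funs, auto)
qed

lemma finite_parts_below: "la \<in> parts N \<Longrightarrow> finite {mu \<in> parts N. mu \<le> la}"
  by (rule finite_subset[OF _ finite_parts_bounded[of N "la 0"]]) (auto simp: le_fun_def)

text \<open>Strictly decreasing exponent sequences of length \<open>N\<close> are encoded by partitions with at most
  \<open>N\<close> parts; triangularity of \<open>T\<close> restricts the sum to subpartitions.\<close>

lemma cauchy_binet_parts:
  fixes T :: "nat \<Rightarrow> nat \<Rightarrow> 'a :: comm_ring_1"
  assumes la: "la \<in> parts N" and T: "\<And>n k. n < k \<Longrightarrow> T n k = 0"
  shows "fun_det N (\<lambda>i j. \<Sum>k\<le>shifted N la i. T (shifted N la i) k * u k j) =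
    (\<Sum>mu\<in>{mu\<in>parts N. mu \<le> la}. fun_det N (\<lambda>i j. T (shifted N la i) (shifted N mu j)) * fun_det N (\<lambda>i j. u (shifted N mu i) j))"
proof -
  define K where "K = shifted N la 0"
  \<comment> \<open>The bound on the largest part is what the range of exponents up to
    \<open>K\<close> amounts to. The stronger condition mu \<le> la is imposed only at the end, by
    \<open>fun_det_shift_zero\<close>.\<close>
  define M where "M = {mu\<in>parts N. mu 0 \<le> la 0}"
  let ?t = "\<lambda>i. T (shifted N la i)"
  let ?P = "{p. p permutes {..<N}}"
  let ?F = "\<lambda>f. (\<Prod>i<N. ?t i (f i)) * fun_det N (\<lambda>i j. u (f i) j)"
  let ?I = "{f \<in> {..<N} \<rightarrow>\<^sub>E {..K}. inj_on f {..<N}}"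
  \<comment> \<open>The restriction makes the composite extensional, as the members of the function
    space are.\<close>
  let ?c = "\<lambda>(mu, p). restrict (\<lambda>i. shifted N mu (p i)) {..<N}"
  have finM: "finite M" unfolding M_def by (rule finite_parts_bounded)
  have "fun_det N (\<lambda>i j. \<Sum>k\<le>shifted N la i. ?t i k * u k j) = fun_det N (\<lambda>i j. \<Sum>k\<le>K. ?t i k * u k j)"
  proof (rule fun_det_cong)
    fix i j assume "i < N" "j < N"
    then have "shifted N la i \<le> K" unfolding K_def using shifted_mono[OF la] by auto
    then show "(\<Sum>k\<le>shifted N la i. ?t i k * u k j) = (\<Sum>k\<le>K. ?t i k * u k j)"
      by (intro sum.mono_neutral_left) (auto simp: T)
  qed
  also have "\<dots> = (\<Sum>f\<in>{..<N} \<rightarrow>\<^sub>E {..K}. ?F f)"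
    by (rule fun_det_multilinear) simp
  also have "\<dots> = (\<Sum>f\<in>?I. ?F f)"
  proof (rule sum.mono_neutral_right)
    show "\<forall>f\<in>({..<N} \<rightarrow>\<^sub>E {..K}) - ?I. ?F f = 0"
    proof
      fix f assume f: "f \<in> ({..<N} \<rightarrow>\<^sub>E {..K}) - ?I"
      then obtain i i' where i: "i < N" "i' < N" "i \<noteq> i'" "f i = f i'"
        by (auto simp: inj_on_def)
      then have "fun_det N (\<lambda>i j. u (f i) j) = 0" by (intro fun_det_eq_rows[of i N i']) auto
      then show "?F f = 0" by simp
    qed
  qed (auto intro: finite_PiE)
  \<comment> \<open>An injective choice is a decreasing sequence composed with a permutation, in
    exactly one way. The sum over the permutations will restore the determinant of the
    coefficients.\<close>
  also have "\<dots> = (\<Sum>x\<in>M \<times> ?P. ?F (?c x))"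
  proof (rule sum.reindex_bij_betw[symmetric], unfold bij_betw_def, intro conjI)
    show "inj_on ?c (M \<times> ?P)"
    proof (rule inj_onI)
      fix x y assume x: "x \<in> M \<times> ?P" and y: "y \<in> M \<times> ?P" and xy: "?c x = ?c y"
      obtain mu p where x': "x = (mu, p)" by (cases x)
      obtain nu r where y': "y = (nu, r)" by (cases y)
      have "shifted N mu (p i) = shifted N nu (r i)" if "i < N" for i
        using fun_cong[OF xy, of i] that by (simp add: x' y')
      then show "x = y" using shifted_permuted_unique[of mu N nu p r] x y unfolding x' y' M_def by auto
    qed
    show "?c ` (M \<times> ?P) = ?I"
    proof (intro subset_antisym subsetI)
      fix f assume "f \<in> ?c ` (M \<times> ?P)"
      then obtain mu p where mu: "mu \<in> parts N" "mu 0 \<le> la 0" and p: "p permutes {..<N}"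
        and f: "f = restrict (\<lambda>i. shifted N mu (p i)) {..<N}" by (auto simp: M_def)
      have pN: "p i < N" if "i < N" for i using that permutes_in_image[OF p, of i] by simp
      have "shifted N mu (p i) \<le> K" if "i < N" for i
      proof -
        have "shifted N mu (p i) \<le> shifted N mu 0" using pN[OF that] by (intro shifted_mono[OF mu(1)]) auto
        also have "\<dots> \<le> K" using mu by (simp add: shifted_def K_def)
        finally show ?thesis .
      qed
      moreover have "inj_on (\<lambda>i. shifted N mu (p i)) {..<N}"
      proof (rule inj_onI)
        fix i j assume "i \<in> {..<N}" "j \<in> {..<N}" "shifted N mu (p i) = shifted N mu (p j)"
        then have "p i = p j" using shifted_inj_on[OF mu(1)] pN by (auto simp: inj_on_def)
        then show "i = j" using permutes_inj[OF p] by (auto simp: inj_def)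
      qed
      ultimately show "f \<in> ?I" unfolding f by (auto simp: inj_on_def)
    next
      fix f assume f: "f \<in> ?I"
      obtain mu p where mu: "mu \<in> parts N" "p permutes {..<N}" "\<And>i. i < N \<Longrightarrow> f i = shifted N mu (p i)"
        using sort_injective[of f N] f by blast
      have "mu 0 \<le> la 0"
      proof (cases "N = 0")
        case True
        then show ?thesis using mu(1) by (simp add: parts_def)
      next
        case False
        obtain i where i: "p i = 0" using permutes_surj[OF mu(2)] by (metis surjD)
        then have "i < N" using permutes_in_image[OF mu(2), of i] False by simp
        then have "f i \<le> K" using f by (simp add: PiE_iff)
        then have "shifted N mu 0 \<le> K" using mu(3)[OF \<open>i < N\<close>] i by simp
        then show ?thesis by (simp add: shifted_def K_def)
      qed
      then have "(mu, p) \<in> M \<times> ?P" using mu by (simp add: M_def)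
      moreover have "f = ?c (mu, p)"
        using f mu(3) by (auto simp: fun_eq_iff PiE_def extensional_def)
      ultimately show "f \<in> ?c ` (M \<times> ?P)" by blast
    qed
  qed
  also have "\<dots> = (\<Sum>mu\<in>M. \<Sum>p\<in>?P. ?F (?c (mu, p)))"
    unfolding sum.cartesian_product by (rule sum.cong[OF refl], rename_tac x, case_tac x, simp only: prod.case)
  also have "\<dots> = (\<Sum>mu\<in>M. fun_det N (\<lambda>i j. ?t i (shifted N mu j)) * fun_det N (\<lambda>i j. u (shifted N mu i) j))"
  proof (rule sum.cong[OF refl])
    fix mu assume "mu \<in> M"
    have "?F (?c (mu, p)) = signof p * (\<Prod>i<N. ?t i (shifted N mu (p i))) * fun_det N (\<lambda>i j. u (shifted N mu i) j)"
      if "p \<in> ?P" for p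
    proof -
      have "fun_det N (\<lambda>i j. u (?c (mu, p) i) j) = fun_det N (\<lambda>i j. (\<lambda>i j. u (shifted N mu i) j) (p i) j)"
        by (rule fun_det_cong) simp
      also have "\<dots> = signof p * fun_det N (\<lambda>i j. u (shifted N mu i) j)"
        using that fun_det_permute_rows[of p N "\<lambda>i j. u (shifted N mu i) j"] by simp
      finally show ?thesis by (simp add: mult_ac)
    qed
    then show "(\<Sum>p\<in>?P. ?F (?c (mu, p))) =
        fun_det N (\<lambda>i j. ?t i (shifted N mu j)) * fun_det N (\<lambda>i j. u (shifted N mu i) j)"
      unfolding fun_det_rows[of N "\<lambda>i j. ?t i (shifted N mu j)"] sum_distrib_right by (rule sum.cong[OF refl])
  qed
  also have "\<dots> = (\<Sum>mu\<in>{mu\<in>parts N. mu \<le> la}. fun_det N (\<lambda>i j. ?t i (shifted N mu j)) * fun_det N (\<lambda>i j. u (shifted N mu i) j))"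
  proof (rule sum.mono_neutral_right[OF finM])
    show "{mu\<in>parts N. mu \<le> la} \<subseteq> M" by (auto simp: M_def le_fun_def)
    show "\<forall>mu\<in>M - {mu\<in>parts N. mu \<le> la}.
      fun_det N (\<lambda>i j. ?t i (shifted N mu j)) * fun_det N (\<lambda>i j. u (shifted N mu i) j) = 0"
    proof
      fix mu assume "mu \<in> M - {mu\<in>parts N. mu \<le> la}"
      then have "mu \<in> parts N" "\<not> mu \<le> la" by (auto simp: M_def)
      from fun_det_shift_zero[OF la this(1) _ this(2), of T] T
      show "fun_det N (\<lambda>i j. ?t i (shifted N mu j)) * fun_det N (\<lambda>i j. u (shifted N mu i) j) = 0" by simp
    qed
  qed
  finally show ?thesis .
qed

section \<open>Linear functionals on polynomials\<close>

text \<open>The powers are replaced by the monic polynomials \<open>w i\<close> of the same degrees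
  that vanish at all later points. This is a unitriangular change of rows, and it makes the matrix
  lower triangular.\<close>

lemma vandermonde_det:
  fixes x :: "nat \<Rightarrow> 'a :: idom"
  shows "fun_det N (\<lambda>i j. x j ^ (N - 1 - i)) = (\<Prod>(i, j)\<in>{(i, j). i < j \<and> j < N}. x i - x j)"
proof -
  define w where "w = (\<lambda>i. \<Prod>k\<in>{i<..<N}. [:- x k, 1:])"
  have deg: "degree (w i) = N - 1 - i" for i
    unfolding w_def by (subst degree_prod_eq_sum_degree) auto
  have monic: "lead_coeff (w i) = 1" for i
    unfolding w_def lead_coeff_prod by simp
  let ?c = "\<lambda>i k. coeff (w i) (N - 1 - k)"
  have ev: "poly (w i) (x j) = (\<Sum>k<N. ?c i k * x j ^ (N - 1 - k))" if "i < N" for i j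
  proof -
    have "poly (w i) (x j) = (\<Sum>k\<le>N - 1. coeff (w i) k * x j ^ k)"
      unfolding poly_altdef by (rule sum.mono_neutral_left) (auto simp: deg coeff_eq_0)
    also have "{..N - 1} = {..<N}" using that by auto
    also have "(\<Sum>k<N. coeff (w i) k * x j ^ k) = (\<Sum>k<N. ?c i k * x j ^ (N - 1 - k))"
      by (rule sum.reindex_bij_witness[of _ "\<lambda>k. N - 1 - k" "\<lambda>k. N - 1 - k"]) auto
    finally show ?thesis .
  qed
  have "fun_det N ?c = fun_det 0 ?c"
  proof (rule fun_det_reduce)
    fix i j assume "i < N" "j < i"
    then show "?c i j = 0" by (intro coeff_eq_0) (simp add: deg)
  next
    fix i assume "i < N"
    then show "?c i i = 1" using monic[of i] by (simp add: deg)
  qed simp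
  then have "fun_det N (\<lambda>i j. x j ^ (N - 1 - i)) = fun_det N (\<lambda>i j. \<Sum>k<N. ?c i k * x j ^ (N - 1 - k))"
    unfolding fun_det_mult by simp
  also have "\<dots> = fun_det N (\<lambda>i j. poly (w i) (x j))"
    by (rule fun_det_cong) (simp add: ev)
  also have "\<dots> = (\<Prod>i<N. poly (w i) (x i))"
  proof -
    have "det (mat N N (\<lambda>(i, j). poly (w i) (x j))) = prod_list (diag_mat (mat N N (\<lambda>(i, j). poly (w i) (x j))))"
      by (rule det_lower_triangular[of N]) (auto simp: w_def poly_prod)
    then show ?thesis by (simp add: fun_det_def prod_list_diag_prod atLeast0LessThan)
  qed
  also have "\<dots> = (\<Prod>i<N. \<Prod>k\<in>{i<..<N}. x i - x k)"
    by (simp add: w_def poly_prod)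
  also have "\<dots> = (\<Prod>(i, j)\<in>Sigma {..<N} (\<lambda>i. {i<..<N}). x i - x j)"
    by (subst prod.Sigma) auto
  also have "Sigma {..<N} (\<lambda>i. {i<..<N}) = {(i, j). i < j \<and> j < N}" by auto
  finally show ?thesis .
qed

section \<open>Tensor products of one-variable moment functionals\<close>

interpretation mpoly_const: comm_ring_hom mpoly_const
  by unfold_locales (simp_all add: mpoly_const_def single_add mult_single)

definition poly_at :: "nat \<Rightarrow> complex poly \<Rightarrow> mpoly"
  where "poly_at j f = poly (map_poly mpoly_const f) (mpoly_var j)"

interpretation poly_at: comm_ring_hom "poly_at j"
proof -
  interpret map_poly_comm_ring_hom mpoly_const ..
  show "comm_ring_hom (poly_at j)"
    by unfold_locales (simp_all add: poly_at_def hom_distribs)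
qed

lemma poly_at_smult: "poly_at j (smult z f) = mpoly_const z * poly_at j f"
proof -
  interpret map_poly_comm_ring_hom mpoly_const ..
  show ?thesis by (simp add: poly_at_def mpoly_const.map_poly_hom_smult)
qed

lemma poly_at_linear: "poly_at j [:- z, 1:] = mpoly_var j - mpoly_const z"
  by (simp add: poly_at_def mpoly_const.hom_uminus)

lemma poly_at_monom: "poly_at j (monom 1 k) = mpoly_var j ^ k"
  by (simp add: poly_at_def poly_monom)

lemma poly_at_shifted_power: "poly_at j (\<Prod>i<m. [:- z i, 1:]) = shifted_power (mpoly_var j) z m"
  unfolding shifted_power_def poly_at.hom_prod poly_at_linear ..

lemma poly_at_expand: "degree f \<le> D \<Longrightarrow> poly_at j f = (\<Sum>k\<le>D. mpoly_const (coeff f k) * mpoly_var j ^ k)"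
  using poly_as_sum_of_monoms'[of f D]
  by (metis (no_types, lifting) poly_at.hom_sum poly_at_monom poly_at_smult smult_monom mult.right_neutral sum.cong)

definition exponent_monom :: "nat \<Rightarrow> (nat \<Rightarrow> nat) \<Rightarrow> monom"
  where "exponent_monom N k = (\<Sum>j<N. Poly_Mapping.single j (k j))"

lemma lookup_exponent_monom: "Poly_Mapping.lookup (exponent_monom N k) i = (if i < N then k i else 0)"
proof -
  have "Poly_Mapping.lookup (exponent_monom N k) i = (\<Sum>j<N. if j = i then k j else 0)"
    unfolding exponent_monom_def by (simp add: lookup_sum lookup_single when_def)
  then show ?thesis by simp
qed

lemma mpoly_var_power: "mpoly_var j ^ k = Poly_Mapping.single (Poly_Mapping.single j k) 1"
  by (induction k) (simp_all add: mpoly_var_def mult_single single_add[symmetric])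

lemma prod_single: "(\<Prod>j<N. Poly_Mapping.single (a j) (z j)) = Poly_Mapping.single (\<Sum>j<N. a j) (\<Prod>j<N. z j)"
  for z :: "nat \<Rightarrow> complex" and a :: "nat \<Rightarrow> monom"
  by (induction N) (simp_all add: mult_single)

lemma prod_var_powers: "(\<Prod>j<N. mpoly_const (z j) * mpoly_var j ^ k j) = Poly_Mapping.single (exponent_monom N k) (\<Prod>j<N. z j)"
  by (simp add: mpoly_var_power mpoly_const_def mult_single prod_single exponent_monom_def)

text \<open>The tensor product of N one-variable functionals, where \<open>w j k\<close> is the k-th
  moment of the one acting on variable j. Equal factors give the scalar product of the orthogonal
  ensemble, delta functionals the extraction of a single coefficient.\<close>

definition tensor_fun :: "nat \<Rightarrow> (nat \<Rightarrow> nat \<Rightarrow> complex) \<Rightarrow> mpoly \<Rightarrow> complex"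
  where "tensor_fun N w p = (\<Sum>\<alpha>\<in>Poly_Mapping.keys p. Poly_Mapping.lookup p \<alpha> * (\<Prod>j<N. w j (Poly_Mapping.lookup \<alpha> j)))"

definition moment_fun :: "(nat \<Rightarrow> complex) \<Rightarrow> complex poly \<Rightarrow> complex"
  where "moment_fun m f = (\<Sum>k\<le>degree f. coeff f k * m k)"

lemma tensor_fun_superset:
  assumes "finite A" "Poly_Mapping.keys p \<subseteq> A"
  shows "tensor_fun N w p = (\<Sum>\<alpha>\<in>A. Poly_Mapping.lookup p \<alpha> * (\<Prod>j<N. w j (Poly_Mapping.lookup \<alpha> j)))"
  unfolding tensor_fun_def using assms by (intro sum.mono_neutral_left) (auto simp: in_keys_iff)

lemma moment_fun_superset: "degree f \<le> D \<Longrightarrow> moment_fun m f = (\<Sum>k\<le>D. coeff f k * m k)"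
  unfolding moment_fun_def by (intro sum.mono_neutral_left) (auto simp: coeff_eq_0)

lemma tensor_fun_zero [simp]: "tensor_fun N w 0 = 0"
  by (simp add: tensor_fun_def)

lemma tensor_fun_add: "tensor_fun N w (p + r) = tensor_fun N w p + tensor_fun N w r"
proof -
  let ?A = "Poly_Mapping.keys p \<union> Poly_Mapping.keys r"
  have "Poly_Mapping.keys (p + r) \<subseteq> ?A" by (rule Poly_Mapping.keys_add)
  then show ?thesis
    by (simp add: tensor_fun_superset[of ?A] lookup_add sum.distrib distrib_right)
qed

lemma lookup_const_mult: "Poly_Mapping.lookup (mpoly_const z * p) \<alpha> = z * Poly_Mapping.lookup p \<alpha>"
proof -
  have "mpoly_const z * p = Poly_Mapping.map ((*) z) p"
    unfolding mpoly_const_def by (rule mult_map_scale_conv_mult[symmetric])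
  then show ?thesis by (simp add: map.rep_eq when_def)
qed

lemma tensor_fun_scale: "tensor_fun N w (mpoly_const z * p) = z * tensor_fun N w p"
proof -
  have "Poly_Mapping.keys (mpoly_const z * p) \<subseteq> Poly_Mapping.keys p"
    by (auto simp: in_keys_iff lookup_const_mult)
  then show ?thesis
    by (subst (1 2) tensor_fun_superset[of "Poly_Mapping.keys p"])
      (simp_all only: finite_keys subset_refl lookup_const_mult sum_distrib_left mult.assoc)
qed

lemma tensor_fun_sum: "tensor_fun N w (sum f A) = (\<Sum>x\<in>A. tensor_fun N w (f x))"
  by (induction A rule: infinite_finite_induct) (simp_all add: tensor_fun_add)

lemma mpoly_of_int: "(of_int z :: mpoly) = mpoly_const (of_int z)"
  by (simp add: mpoly_const.hom_of_int)

lemma tensor_fun_of_int: "tensor_fun N w (of_int z * p) = of_int z * tensor_fun N w p"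
  by (simp add: mpoly_of_int tensor_fun_scale)

lemma tensor_fun_single: "tensor_fun N w (Poly_Mapping.single \<alpha> z) = z * (\<Prod>j<N. w j (Poly_Mapping.lookup \<alpha> j))"
  by (simp add: tensor_fun_def)

text \<open>Padding all degrees to a common bound allows a single expansion into monomials, on which
  the functional factors by construction.\<close>

lemma tensor_fun_prod: "tensor_fun N w (\<Prod>j<N. poly_at j (f j)) = (\<Prod>j<N. moment_fun (w j) (f j))"
proof -
  define D where "D = (\<Sum>j<N. degree (f j))"
  have D: "degree (f j) \<le> D" if "j < N" for j
    unfolding D_def using that by (intro member_le_sum) auto
  have "(\<Prod>j<N. poly_at j (f j)) = (\<Prod>j<N. \<Sum>k\<in>{..D}. mpoly_const (coeff (f j) k) * mpoly_var j ^ k)"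
    by (intro prod.cong refl poly_at_expand) (simp add: D)
  also have "\<dots> = (\<Sum>g\<in>{..<N} \<rightarrow>\<^sub>E {..D}. \<Prod>j<N. mpoly_const (coeff (f j) (g j)) * mpoly_var j ^ g j)"
    by (rule prod_sum_PiE) auto
  also have "\<dots> = (\<Sum>g\<in>{..<N} \<rightarrow>\<^sub>E {..D}. Poly_Mapping.single (exponent_monom N g) (\<Prod>j<N. coeff (f j) (g j)))"
    by (simp add: prod_var_powers)
  also have "tensor_fun N w \<dots> = (\<Sum>g\<in>{..<N} \<rightarrow>\<^sub>E {..D}. \<Prod>j<N. coeff (f j) (g j) * w j (g j))"
    by (simp add: tensor_fun_sum tensor_fun_single lookup_exponent_monom prod.distrib)
  also have "\<dots> = (\<Prod>j<N. \<Sum>k\<in>{..D}. coeff (f j) k * w j k)"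
    by (rule prod_sum_PiE[symmetric]) auto
  also have "\<dots> = (\<Prod>j<N. moment_fun (w j) (f j))"
    by (intro prod.cong refl moment_fun_superset[symmetric]) (simp add: D)
  finally show ?thesis .
qed

lemma tensor_fun_fun_det: "tensor_fun N w (fun_det N (\<lambda>i j. poly_at j (f i j))) = fun_det N (\<lambda>i j. moment_fun (w j) (f i j))"
  unfolding fun_det_cols by (simp add: tensor_fun_sum tensor_fun_of_int tensor_fun_prod)

lemma sign_square: "of_int (sign p) * (of_int (sign p) * x) = (x :: 'a :: ring_1)"
  by (simp add: sign_def)

text \<open>The first determinant is expanded and its factors are absorbed into the columns of the
  second. Each of the N! permutations then contributes the same determinant, since its sign appears
  a second time when the rows are put back in order.\<close>

lemma andreief:
  "tensor_fun N (\<lambda>_. m) (fun_det N (\<lambda>i j. poly_at j (f i)) * fun_det N (\<lambda>i j. poly_at j (g i))) =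
    fact N * fun_det N (\<lambda>i j. moment_fun m (f i * g j))"
proof -
  let ?P = "{p. p permutes {..<N}}"
  have "fun_det N (\<lambda>i j. poly_at j (f i)) * fun_det N (\<lambda>i j. poly_at j (g i)) =
    (\<Sum>p\<in>?P. signof p * fun_det N (\<lambda>i j. poly_at j (f (p j) * g i)))"
    unfolding fun_det_cols[of N "\<lambda>i j. poly_at j (f i)"] sum_distrib_right
  proof (intro sum.cong refl)
    fix p
    show "signof p * (\<Prod>j<N. poly_at j (f (p j))) * fun_det N (\<lambda>i j. poly_at j (g i)) =
      signof p * fun_det N (\<lambda>i j. poly_at j (f (p j) * g i))"
      using fun_det_scale[of N "\<lambda>_. 1" "\<lambda>j. poly_at j (f (p j))" "\<lambda>i j. poly_at j (g i)"]
      by (simp add: poly_at.hom_mult mult_ac)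
  qed
  also have "tensor_fun N (\<lambda>_. m) \<dots> = (\<Sum>p\<in>?P. signof p * fun_det N (\<lambda>i j. moment_fun m (f (p j) * g i)))"
    by (simp add: tensor_fun_sum tensor_fun_of_int tensor_fun_fun_det)
  also have "\<dots> = (\<Sum>p\<in>?P. fun_det N (\<lambda>i j. moment_fun m (f i * g j)))"
  proof (rule sum.cong[OF refl])
    fix p assume "p \<in> ?P"
    then have "fun_det N (\<lambda>i j. moment_fun m (f (p i) * g j)) = signof p * fun_det N (\<lambda>i j. moment_fun m (f i * g j))"
      using fun_det_permute_rows[of p N "\<lambda>i j. moment_fun m (f i * g j)"] by simp
    moreover have "fun_det N (\<lambda>i j. moment_fun m (f (p j) * g i)) = fun_det N (\<lambda>i j. moment_fun m (f (p i) * g j))"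
      by (rule fun_det_transpose)
    ultimately show "signof p * fun_det N (\<lambda>i j. moment_fun m (f (p j) * g i)) = fun_det N (\<lambda>i j. moment_fun m (f i * g j))"
      by (simp add: sign_square)
  qed
  also have "\<dots> = fact N * fun_det N (\<lambda>i j. moment_fun m (f i * g j))"
    by (simp add: card_permutations[of _ N])
  finally show ?thesis .
qed

lemma mpoly_var_diff_nz: "i \<noteq> j \<Longrightarrow> mpoly_var i - mpoly_var j \<noteq> 0"
proof
  assume "i \<noteq> j" "mpoly_var i - mpoly_var j = 0"
  then have "Poly_Mapping.lookup (mpoly_var i) (Poly_Mapping.single i 1) = Poly_Mapping.lookup (mpoly_var j) (Poly_Mapping.single i 1)"
    by simp
  moreover have "Poly_Mapping.single j (1 :: nat) \<noteq> Poly_Mapping.single i 1"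
    using \<open>i \<noteq> j\<close> by (metis lookup_single_eq lookup_single_not_eq zero_neq_one)
  ultimately show False by (simp add: mpoly_var_def lookup_single when_def)
qed

lemma vandermonde_nz: "vandermonde N \<noteq> 0"
proof -
  have "finite {(i, j). i < j \<and> j < N}"
    by (rule finite_subset[of _ "{..<N} \<times> {..<N}"]) auto
  then show ?thesis unfolding vandermonde_def using mpoly_var_diff_nz by (auto dest: less_imp_neq)
qed

lemma vandermonde_fun_det: "vandermonde N = fun_det N (\<lambda>i j. mpoly_var j ^ (N - 1 - i))"
  unfolding vandermonde_def by (rule vandermonde_det[symmetric])

section \<open>The Jacobi--Trudi identity\<close>

text \<open>The product of polynomials is a nested \<open>Sum_any\<close>. In this form it matches
  the convolution that defines the product of symmetric functions, so that restriction to N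
  variables is seen to be multiplicative.\<close>

lemma lookup_times_splits:
  fixes p r :: mpoly
  shows "Poly_Mapping.lookup (p * r) \<gamma> =
    (\<Sum>(\<alpha>, \<beta>)\<in>splits \<gamma>. Poly_Mapping.lookup p \<alpha> * Poly_Mapping.lookup r \<beta>)"
proof -
  let ?A = "fst ` splits \<gamma>" and ?B = "snd ` splits \<gamma>"
  have inner: "Sum_any (\<lambda>\<beta>. Poly_Mapping.lookup r \<beta> when \<gamma> = \<alpha> + \<beta>) =
    (\<Sum>\<beta>\<in>?B. Poly_Mapping.lookup r \<beta> when \<gamma> = \<alpha> + \<beta>)" for \<alpha>
  proof (rule Sum_any.expand_superset)
    show "{\<beta>. (Poly_Mapping.lookup r \<beta> when \<gamma> = \<alpha> + \<beta>) \<noteq> 0} \<subseteq> ?B"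
      by (auto simp: when_def splits_def image_iff)
  qed simp
  have "Poly_Mapping.lookup (p * r) \<gamma> =
    Sum_any (\<lambda>\<alpha>. Poly_Mapping.lookup p \<alpha> * (\<Sum>\<beta>\<in>?B. Poly_Mapping.lookup r \<beta> when \<gamma> = \<alpha> + \<beta>))"
    by (simp add: lookup_mult inner)
  also have "\<dots> = (\<Sum>\<alpha>\<in>?A. Poly_Mapping.lookup p \<alpha> * (\<Sum>\<beta>\<in>?B. Poly_Mapping.lookup r \<beta> when \<gamma> = \<alpha> + \<beta>))"
  proof (rule Sum_any.expand_superset)
    show "{\<alpha>. Poly_Mapping.lookup p \<alpha> * (\<Sum>\<beta>\<in>?B. Poly_Mapping.lookup r \<beta> when \<gamma> = \<alpha> + \<beta>) \<noteq> 0} \<subseteq> ?A"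
    proof
      fix \<alpha> assume "\<alpha> \<in> {\<alpha>. Poly_Mapping.lookup p \<alpha> * (\<Sum>\<beta>\<in>?B. Poly_Mapping.lookup r \<beta> when \<gamma> = \<alpha> + \<beta>) \<noteq> 0}"
      then have "(\<Sum>\<beta>\<in>?B. Poly_Mapping.lookup r \<beta> when \<gamma> = \<alpha> + \<beta>) \<noteq> 0" by auto
      then obtain \<beta> where "(Poly_Mapping.lookup r \<beta> when \<gamma> = \<alpha> + \<beta>) \<noteq> 0"
        by (rule sum.not_neutral_contains_not_neutral)
      then show "\<alpha> \<in> ?A" by (force simp: when_def splits_def split: if_splits)
    qed
  qed simp
  also have "\<dots> = (\<Sum>x\<in>?A \<times> ?B. if x \<in> splits \<gamma> then Poly_Mapping.lookup p (fst x) * Poly_Mapping.lookup r (snd x) else 0)"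
    unfolding sum_distrib_left sum.cartesian_product
    by (intro sum.cong) (auto simp: when_def splits_def)
  also have "\<dots> = (\<Sum>x\<in>(?A \<times> ?B) \<inter> splits \<gamma>. Poly_Mapping.lookup p (fst x) * Poly_Mapping.lookup r (snd x))"
    by (rule sum.inter_restrict[symmetric]) simp
  also have "(?A \<times> ?B) \<inter> splits \<gamma> = splits \<gamma>" by force
  finally show ?thesis by (simp add: case_prod_unfold)
qed

lemma lookup_restrict:
  "Poly_Mapping.lookup (sym_restrict N F) \<alpha> = (if Poly_Mapping.keys \<alpha> \<subseteq> {..<N} then sym_coeff F \<alpha> else 0)"
  by (simp add: sym_restrict.rep_eq)

lemma keys_add_monom: "Poly_Mapping.keys (\<alpha> + \<beta> :: monom) = Poly_Mapping.keys \<alpha> \<union> Poly_Mapping.keys \<beta>"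
  by (auto simp: in_keys_iff lookup_add)

interpretation sym_restrict: comm_ring_hom "sym_restrict N"
proof
  fix F G
  show "sym_restrict N 0 = 0"
    by (rule poly_mapping_eqI) (simp add: lookup_restrict zero_symfun.rep_eq)
  show "sym_restrict N 1 = 1"
    by (rule poly_mapping_eqI) (auto simp: lookup_restrict one_symfun.rep_eq lookup_one when_def)
  show "sym_restrict N (F + G) = sym_restrict N F + sym_restrict N G"
    by (rule poly_mapping_eqI) (simp add: lookup_restrict plus_symfun.rep_eq lookup_add)
  show "sym_restrict N (F * G) = sym_restrict N F * sym_restrict N G"
  proof (rule poly_mapping_eqI)
    fix \<gamma>
    show "Poly_Mapping.lookup (sym_restrict N (F * G)) \<gamma> =
      Poly_Mapping.lookup (sym_restrict N F * sym_restrict N G) \<gamma>"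
    proof (cases "Poly_Mapping.keys \<gamma> \<subseteq> {..<N}")
      case True
      then have "\<And>x. x \<in> splits \<gamma> \<Longrightarrow> Poly_Mapping.keys (fst x) \<subseteq> {..<N} \<and> Poly_Mapping.keys (snd x) \<subseteq> {..<N}"
        by (auto simp: splits_def keys_add_monom)
      then show ?thesis using True
        by (auto simp: lookup_times_splits lookup_restrict times_symfun.rep_eq case_prod_unfold intro!: sum.cong)
    next
      case False
      then have "\<And>x. x \<in> splits \<gamma> \<Longrightarrow> \<not> (Poly_Mapping.keys (fst x) \<subseteq> {..<N} \<and> Poly_Mapping.keys (snd x) \<subseteq> {..<N})"
        by (auto simp: splits_def keys_add_monom)
      then have "(\<Sum>x\<in>splits \<gamma>. Poly_Mapping.lookup (sym_restrict N F) (fst x) * Poly_Mapping.lookup (sym_restrict N G) (snd x)) = 0"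
        by (intro sum.neutral) (auto simp: lookup_restrict)
      then show ?thesis using False
        by (simp add: lookup_times_splits lookup_restrict[of N "F * G"] case_prod_unfold)
    qed
  qed
qed

lemma sym_restrict_scale: "sym_restrict N (sym_scale z F) = mpoly_const z * sym_restrict N F"
  by (rule poly_mapping_eqI) (simp add: lookup_restrict lookup_const_mult sym_scale.rep_eq)

text \<open>The complete homogeneous symmetric function of degree k: every monomial of that degree
  has coefficient 1.\<close>

lift_definition hsym :: "nat \<Rightarrow> symfun" is "\<lambda>k \<alpha>. if mdeg \<alpha> = k then 1 else 0"
  by (rule symmetric_seriesI) (auto simp: mdeg_map_key split: if_splits)

definition hsymi :: "int \<Rightarrow> symfun"
  where "hsymi k = (if k < 0 then 0 else hsym (nat k))"

definition hsym_restrict :: "nat \<Rightarrow> nat \<Rightarrow> mpoly"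
  where "hsym_restrict N k = sym_restrict N (hsym k)"

lemma lookup_hsym_restrict: "Poly_Mapping.lookup (hsym_restrict N k) \<alpha> = (if Poly_Mapping.keys \<alpha> \<subseteq> {..<N} \<and> mdeg \<alpha> = k then 1 else 0)"
  by (simp add: hsym_restrict_def lookup_restrict hsym.rep_eq)

lemma mdeg_eq_0_iff: "mdeg \<alpha> = 0 \<longleftrightarrow> \<alpha> = 0"
proof
  assume "mdeg \<alpha> = 0"
  then show "\<alpha> = 0" using lookup_le_mdeg[of \<alpha>] by (intro poly_mapping_eqI) simp
qed simp

lemma mdeg_single: "mdeg (Poly_Mapping.single i k) = k"
  by (simp add: mdeg_def)

lemma hsym_restrict_0: "hsym_restrict 0 k = (if k = 0 then 1 else 0)"
  by (rule poly_mapping_eqI) (auto simp: lookup_hsym_restrict lookup_one when_def)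

lemma hsym_restrict_degree_0: "hsym_restrict N 0 = 1"
  by (rule poly_mapping_eqI) (auto simp: lookup_hsym_restrict lookup_one when_def mdeg_eq_0_iff)

lemma lookup_var_mult_add:
  "Poly_Mapping.lookup (mpoly_var i * p) (Poly_Mapping.single i 1 + \<beta>) = Poly_Mapping.lookup p \<beta>"
proof -
  let ?s = "Poly_Mapping.single i (1 :: nat)"
  have "Poly_Mapping.lookup (mpoly_var i * p) (?s + \<beta>) = (\<Sum>x\<in>{(?s, \<beta>)}. Poly_Mapping.lookup (mpoly_var i) (fst x) * Poly_Mapping.lookup p (snd x))"
    unfolding lookup_times_splits case_prod_unfold
  proof (rule sum.mono_neutral_right)
    show "{(?s, \<beta>)} \<subseteq> splits (?s + \<beta>)" by (simp add: splits_def)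
  qed (auto simp: splits_def mpoly_var_def lookup_single when_def simp del: finite_splits intro: finite_splits[unfolded splits_def])
  then show ?thesis by (simp add: mpoly_var_def)
qed

lemma lookup_var_mult_0:
  "i \<notin> Poly_Mapping.keys \<gamma> \<Longrightarrow> Poly_Mapping.lookup (mpoly_var i * p) \<gamma> = 0"
  unfolding lookup_times_splits
  by (intro sum.neutral) (auto simp: splits_def mpoly_var_def lookup_single when_def keys_add_monom)

text \<open>Monomials are separated according to whether the last variable occurs in them.\<close>

lemma hsym_restrict_Suc: "hsym_restrict (Suc N) (Suc k) = hsym_restrict N (Suc k) + mpoly_var N * hsym_restrict (Suc N) k"
proof (rule poly_mapping_eqI)
  fix \<alpha> :: monom
  show "Poly_Mapping.lookup (hsym_restrict (Suc N) (Suc k)) \<alpha> =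
    Poly_Mapping.lookup (hsym_restrict N (Suc k) + mpoly_var N * hsym_restrict (Suc N) k) \<alpha>"
  proof (cases "N \<in> Poly_Mapping.keys \<alpha>")
    case True
    define \<beta> where "\<beta> = \<alpha> - Poly_Mapping.single N 1"
    have "\<alpha> = Poly_Mapping.single N 1 + \<beta>"
      using True by (intro poly_mapping_eqI) (auto simp: \<beta>_def lookup_add lookup_minus lookup_single when_def in_keys_iff)
    then show ?thesis
      by (simp add: lookup_add lookup_var_mult_add[of N, unfolded One_nat_def] lookup_hsym_restrict keys_add_monom mdeg_add mdeg_single)
  next
    case False
    then have "Poly_Mapping.keys \<alpha> \<subseteq> {..<Suc N} \<longleftrightarrow> Poly_Mapping.keys \<alpha> \<subseteq> {..<N}"
      by (auto simp: subset_iff less_Suc_eq)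
    then show ?thesis using False by (simp add: lookup_add lookup_var_mult_0 lookup_hsym_restrict)
  qed
qed

lemma fps_linear_nth:
  "fps_nth (f * (1 - fps_const c * fps_X)) n = fps_nth f n - (if n = 0 then 0 else c * fps_nth f (n - 1))"
  for c :: "'a :: comm_ring_1"
proof -
  have "f * (1 - fps_const c * fps_X) = f - fps_const c * (fps_X * f)" by (simp add: algebra_simps)
  then show ?thesis by simp
qed

definition linear_factor :: "nat \<Rightarrow> mpoly fps"
  where "linear_factor i = 1 - fps_const (mpoly_var i) * fps_X"

lemma linear_factor_mult_nth:
  "fps_nth (f * linear_factor i) n = fps_nth f n - (if n = 0 then 0 else mpoly_var i * fps_nth f (n - 1))"
  unfolding linear_factor_def by (rule fps_linear_nth)

lemma linear_factor_prod_nth_0: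
  "finite A \<Longrightarrow> card A < n \<Longrightarrow> fps_nth (\<Prod>i\<in>A. linear_factor i) n = 0"
proof (induction A arbitrary: n rule: finite_induct)
  case (insert x A)
  have "(\<Prod>i\<in>insert x A. linear_factor i) = (\<Prod>i\<in>A. linear_factor i) * linear_factor x"
    unfolding prod.insert[OF insert.hyps(1,2)] by (rule mult.commute)
  then show ?case using insert by (simp only: linear_factor_mult_nth) simp
qed simp

lemma hsym_restrict_gen: "Abs_fps (hsym_restrict N) * (\<Prod>i<N. linear_factor i) = 1"
proof (induction N)
  case 0
  have "Abs_fps (hsym_restrict 0) = 1" by (rule fps_ext) (simp add: hsym_restrict_0)
  then show ?case by simp
next
  case (Suc N)
  have "Abs_fps (hsym_restrict (Suc N)) * linear_factor N = Abs_fps (hsym_restrict N)"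
  proof (rule fps_ext)
    fix n show "fps_nth (Abs_fps (hsym_restrict (Suc N)) * linear_factor N) n = fps_nth (Abs_fps (hsym_restrict N)) n"
      by (cases n) (simp_all only: linear_factor_mult_nth, simp_all add: hsym_restrict_Suc hsym_restrict_degree_0)
  qed
  then have "Abs_fps (hsym_restrict (Suc N)) * (linear_factor N * (\<Prod>i<N. linear_factor i)) = 1"
    using Suc by (simp flip: mult.assoc)
  then show ?case by (simp add: mult.commute)
qed

text \<open>Up to the sign (-1)^r, the elementary symmetric polynomial of degree r in the N - 1
  variables other than the k-th.\<close>

definition elementary_coeff :: "nat \<Rightarrow> nat \<Rightarrow> nat \<Rightarrow> mpoly"
  where "elementary_coeff N k r = fps_nth (\<Prod>i\<in>{..<N} - {k}. linear_factor i) r"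

text \<open>The geometric series 1/(1 - x_k t) equals H(t) times the product of 1 - x_i t over i
  \<noteq> k, and the coefficients of t^m are compared. As the second factor has degree below N, the
  result is a product of N by N matrices, only the first of which involves the exponent.\<close>

lemma var_power_expand:
  assumes "k < N"
  shows "mpoly_var k ^ m = (\<Sum>j<N. sym_restrict N (hsymi (int m + int j - int (N - 1))) * elementary_coeff N k (N - 1 - j))"
proof -
  let ?P = "\<Prod>i\<in>{..<N} - {k}. linear_factor i" and ?H = "Abs_fps (hsym_restrict N)" and ?G = "Abs_fps (\<lambda>m. mpoly_var k ^ m)"
  have G: "?G * linear_factor k = 1"
    by (rule fps_ext) (simp add: linear_factor_mult_nth power_eq_if)
  have "(\<Prod>i<N. linear_factor i) = linear_factor k * ?P"
    using assms by (intro prod.remove) auto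
  then have "?H * (linear_factor k * ?P) = 1" using hsym_restrict_gen[of N] by simp
  then have "?G = ?G * (?H * (linear_factor k * ?P))" by simp
  also have "\<dots> = (?G * linear_factor k) * (?H * ?P)" by (simp only: mult_ac)
  also have "\<dots> = ?H * ?P" unfolding G by simp
  finally have "fps_nth ?G m = fps_nth (?H * ?P) m" by (rule arg_cong[of _ _ "\<lambda>f. fps_nth f m"])
  then have "mpoly_var k ^ m = fps_nth (?H * ?P) m" by (simp only: fps_nth_Abs_fps)
  also have "\<dots> = (\<Sum>r\<le>m. elementary_coeff N k r * hsym_restrict N (m - r))"
    by (subst mult.commute) (simp add: fps_mult_nth elementary_coeff_def atMost_atLeast0)
  also have "\<dots> = (\<Sum>r\<le>m. elementary_coeff N k r * sym_restrict N (hsymi (int m - int r)))"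
    by (intro sum.cong refl) (auto simp: hsym_restrict_def hsymi_def of_nat_diff[symmetric] simp del: of_nat_diff)
  \<comment> \<open>The range is first enlarged and then cut: beyond m the homogeneous factor
    vanishes, from N on the elementary one.\<close>
  also have "\<dots> = (\<Sum>r<N + m + 1. elementary_coeff N k r * sym_restrict N (hsymi (int m - int r)))"
    by (rule sum.mono_neutral_left) (auto simp: hsymi_def)
  also have "\<dots> = (\<Sum>r<N. elementary_coeff N k r * sym_restrict N (hsymi (int m - int r)))"
    using assms by (intro sum.mono_neutral_right) (auto simp: elementary_coeff_def intro!: linear_factor_prod_nth_0)
  also have "\<dots> = (\<Sum>j<N. sym_restrict N (hsymi (int m + int j - int (N - 1))) * elementary_coeff N k (N - 1 - j))"
    using assms by (intro sum.reindex_bij_witness[of _ "\<lambda>j. N - 1 - j" "\<lambda>j. N - 1 - j"])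
      (auto simp: mult.commute of_nat_diff algebra_simps)
  finally show ?thesis .
qed

lemma hsym_0: "hsym 0 = 1"
  by (rule symfun_eqI) (simp add: hsym.rep_eq one_symfun.rep_eq mdeg_eq_0_iff)

text \<open>The Jacobi--Trudi determinant for arbitrary exponents in place of \<lambda> + \<delta>.
  It lifts the quotient of the alternant by V to Sym, even when the exponents are unsorted or
  repeated.\<close>

definition exponent_schur :: "nat \<Rightarrow> (nat \<Rightarrow> nat) \<Rightarrow> symfun"
  where "exponent_schur N m = fun_det N (\<lambda>i j. hsymi (int (m i) + int j - int (N - 1)))"

text \<open>Taking determinants in \<open>var_power_expand\<close> leaves a second factor that is
  independent of the exponents. At the staircase exponents the first factor is unitriangular with
  determinant 1, which identifies the second factor as V.\<close>

lemma jacobi_trudi: "fun_det N (\<lambda>i j. mpoly_var j ^ m i) = sym_restrict N (exponent_schur N m) * vandermonde N"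
proof -
  have *: "fun_det N (\<lambda>i j. mpoly_var j ^ m i) =
    sym_restrict N (exponent_schur N m) * fun_det N (\<lambda>r k. elementary_coeff N k (N - 1 - r))" for m
  proof -
    have "fun_det N (\<lambda>i j. mpoly_var j ^ m i) = fun_det N (\<lambda>i k. \<Sum>j<N.
        sym_restrict N (hsymi (int (m i) + int j - int (N - 1))) * elementary_coeff N k (N - 1 - j))"
      by (rule fun_det_cong) (simp add: var_power_expand)
    also have "\<dots> = sym_restrict N (exponent_schur N m) * fun_det N (\<lambda>r k. elementary_coeff N k (N - 1 - r))"
      unfolding fun_det_mult exponent_schur_def by (subst fun_det_hom[OF sym_restrict.comm_ring_hom_axioms]) simp
    finally show ?thesis .
  qed
  have "exponent_schur N (\<lambda>i. N - 1 - i) = fun_det N (\<lambda>i j. hsymi (int j - int i))"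
    unfolding exponent_schur_def by (rule fun_det_cong) (simp add: of_nat_diff)
  also have "\<dots> = fun_det 0 (\<lambda>i j. hsymi (int j - int i))"
    by (rule fun_det_reduce) (auto simp: hsymi_def hsym_0)
  finally have "exponent_schur N (\<lambda>i. N - 1 - i) = 1" by simp
  then have "vandermonde N = fun_det N (\<lambda>r k. elementary_coeff N k (N - 1 - r))"
    unfolding vandermonde_fun_det *[of "\<lambda>i. N - 1 - i"] by (simp only: sym_restrict.hom_one mult_1)
  then show ?thesis unfolding *[of m] by simp
qed

section \<open>Partitions of bounded length and Schur functions\<close>

lemma is_partition_parts: "is_partition la \<Longrightarrow> la \<in> parts (plen la)"
  and parts_plen: "la \<in> parts N \<Longrightarrow> is_partition la \<and> plen la \<le> N"
proof -
  assume la: "is_partition la"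
  then have fin: "finite {i. la i \<noteq> 0}" and anti: "antimono la" by (auto simp: is_partition_def)
  have "la i = 0" if "i \<ge> plen la" for i
  proof (rule ccontr)
    assume "la i \<noteq> 0"
    then have "{..i} \<subseteq> {i. la i \<noteq> 0}" using antimono_le[OF anti] by fastforce
    then have "card {..i} \<le> plen la" unfolding plen_def by (intro card_mono fin)
    then show False using that by simp
  qed
  with anti show "la \<in> parts (plen la)" by (simp add: parts_def)
next
  assume la: "la \<in> parts N"
  then have sub: "{i. la i \<noteq> 0} \<subseteq> {..<N}" by (auto simp: parts_def not_less[symmetric])
  then have "finite {i. la i \<noteq> 0}" by (rule finite_subset) simp
  moreover have "plen la \<le> N" using card_mono[OF _ sub] by (simp add: plen_def)
  ultimately show "is_partition la \<and> plen la \<le> N" using la by (simp add: parts_def is_partition_def)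
qed

lemma parts_iff: "la \<in> parts N \<longleftrightarrow> is_partition la \<and> plen la \<le> N"
proof
  assume "is_partition la \<and> plen la \<le> N"
  then have "la \<in> parts (plen la)" "plen la \<le> N" using is_partition_parts by blast+
  then show "la \<in> parts N" unfolding parts_def by auto
qed (rule parts_plen)

lemma parts_below: "la \<in> parts N \<Longrightarrow> {mu \<in> parts N. mu \<le> la} = {mu. is_partition mu \<and> mu \<le> la}"
proof -
  assume la: "la \<in> parts N"
  have "mu \<in> parts N" if "is_partition mu" "mu \<le> la" for mu
    using la that unfolding parts_def is_partition_def le_fun_def by (auto) (metis le_zero_eq)
  then show ?thesis using parts_plen by auto
qed

lemma finite_below: "is_partition la \<Longrightarrow> finite {mu. is_partition mu \<and> mu \<le> la}"
  by (subst parts_below[OF is_partition_parts, symmetric]) (auto intro: finite_parts_below is_partition_parts)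

definition schur :: "(nat \<Rightarrow> nat) \<Rightarrow> symfun"
  where "schur la = fun_det (plen la) (\<lambda>i j. hsymi (int (la i) - int i + int j))"

lemma exponent_schur_schur:
  assumes "la \<in> parts N" shows "exponent_schur N (shifted N la) = schur la"
proof -
  have "exponent_schur N (shifted N la) = fun_det N (\<lambda>i j. hsymi (int (la i) - int i + int j))"
    unfolding exponent_schur_def by (rule fun_det_cong) (simp add: shifted_def of_nat_diff algebra_simps)
  also have "\<dots> = schur la"
    unfolding schur_def using assms is_partition_parts[of la] parts_plen[of la N]
    by (intro fun_det_reduce) (auto simp: parts_def hsymi_def hsym_0)
  finally show ?thesis .
qed

lemma restrict_schur:
  "la \<in> parts N \<Longrightarrow> sym_restrict N (schur la) * vandermonde N = fun_det N (\<lambda>i j. mpoly_var j ^ shifted N la i)"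
  by (simp only: jacobi_trudi[of N "shifted N la"] exponent_schur_schur)

section \<open>The Schur basis\<close>

lemma Sym_uptoD: "F \<in> Sym_upto d \<Longrightarrow> sym_coeff F \<alpha> \<noteq> 0 \<Longrightarrow> mdeg \<alpha> \<le> d"
  by (simp add: Sym_upto_def)

lemma Sym_upto_exists: "\<exists>d. F \<in> Sym_upto d"
  using sym_coeff[of F] unfolding symmetric_series_def Sym_upto_def by blast

lemma Sym_upto_mono: "F \<in> Sym_upto d \<Longrightarrow> d \<le> e \<Longrightarrow> F \<in> Sym_upto e"
  unfolding Sym_upto_def by (blast intro: le_trans)

lemma Sym_upto_0: "0 \<in> Sym_upto d"
  by (simp add: Sym_upto_def zero_symfun.rep_eq)

lemma Sym_upto_1: "1 \<in> Sym_upto d"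
  by (simp add: Sym_upto_def one_symfun.rep_eq)

lemma Sym_upto_add:
  assumes "F \<in> Sym_upto d" "G \<in> Sym_upto d"
  shows "F + G \<in> Sym_upto d"
proof -
  have "mdeg \<alpha> \<le> d" if "sym_coeff F \<alpha> + sym_coeff G \<alpha> \<noteq> 0" for \<alpha>
  proof -
    have "sym_coeff F \<alpha> \<noteq> 0 \<or> sym_coeff G \<alpha> \<noteq> 0" using that by auto
    then show ?thesis using assms Sym_uptoD by blast
  qed
  then show ?thesis by (simp add: Sym_upto_def plus_symfun.rep_eq)
qed

lemma Sym_upto_scale: "F \<in> Sym_upto d \<Longrightarrow> sym_scale z F \<in> Sym_upto d"
  by (simp add: Sym_upto_def sym_scale.rep_eq)

lemma Sym_upto_uminus: "F \<in> Sym_upto d \<Longrightarrow> - F \<in> Sym_upto d"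
  by (simp add: Sym_upto_def uminus_symfun.rep_eq)

lemma Sym_upto_sum: "(\<And>x. x \<in> A \<Longrightarrow> f x \<in> Sym_upto d) \<Longrightarrow> sum f A \<in> Sym_upto d"
  by (induction A rule: infinite_finite_induct) (simp_all add: Sym_upto_0 Sym_upto_add)

lemma Sym_upto_mult:
  assumes "F \<in> Sym_upto d" "G \<in> Sym_upto e"
  shows "F * G \<in> Sym_upto (d + e)"
  unfolding Sym_upto_def
proof (intro CollectI allI impI)
  fix \<gamma> assume "sym_coeff (F * G) \<gamma> \<noteq> 0"
  then have "(\<Sum>x\<in>splits \<gamma>. sym_coeff F (fst x) * sym_coeff G (snd x)) \<noteq> 0"
    by (simp add: times_symfun.rep_eq case_prod_unfold)
  then obtain x where "x \<in> splits \<gamma>" "sym_coeff F (fst x) * sym_coeff G (snd x) \<noteq> 0"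
    by (rule sum.not_neutral_contains_not_neutral)
  then have "mdeg (fst x) \<le> d" "mdeg (snd x) \<le> e" "\<gamma> = fst x + snd x"
    using Sym_uptoD[OF assms(1)] Sym_uptoD[OF assms(2)] by (auto simp: splits_def)
  then show "mdeg \<gamma> \<le> d + e" by (simp add: mdeg_add add_mono)
qed

lemma Sym_upto_prod: "finite A \<Longrightarrow> (\<And>x. x \<in> A \<Longrightarrow> f x \<in> Sym_upto (d x)) \<Longrightarrow> prod f A \<in> Sym_upto (sum d A)"
  by (induction A rule: finite_induct) (simp_all add: Sym_upto_1 Sym_upto_mult)

lemma hsymi_upto: "hsymi z \<in> Sym_upto (nat z)"
  by (auto simp: hsymi_def Sym_upto_0) (simp add: Sym_upto_def hsym.rep_eq)

lemma sign_mult_cases: "of_int (sign p) * x = x \<or> of_int (sign p) * x = - (x :: 'a :: ring_1)"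
  by (simp add: sign_def)

text \<open>In a non-zero term no index of a homogeneous function is negative, and the indices add
  up to the sum of the exponents minus that of the staircase, whatever the permutation.\<close>

lemma exponent_schur_upto:
  assumes "(\<Sum>i<N. m i) \<le> d + (\<Sum>i<N. N - 1 - i)"
  shows "exponent_schur N m \<in> Sym_upto d"
  unfolding exponent_schur_def fun_det_rows
proof (rule Sym_upto_sum)
  fix p assume "p \<in> {p. p permutes {..<N}}"
  then have p: "p permutes {..<N}" by simp
  let ?z = "\<lambda>i. int (m i) + int (p i) - int (N - 1)"
  have "(\<Prod>i<N. hsymi (?z i)) \<in> Sym_upto d"
  proof (cases "\<exists>i<N. ?z i < 0")
    case True
    then have "(\<Prod>i<N. hsymi (?z i)) = 0" by (intro prod_zero) (auto simp: hsymi_def)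
    then show ?thesis by (simp add: Sym_upto_0)
  next
    case False
    have "(\<Prod>i<N. hsymi (?z i)) \<in> Sym_upto (\<Sum>i<N. nat (?z i))"
      by (rule Sym_upto_prod) (simp_all add: hsymi_upto)
    moreover have "int (\<Sum>i<N. nat (?z i)) = (\<Sum>i<N. ?z i)"
      unfolding of_nat_sum
    proof (rule sum.cong[OF refl])
      fix i assume "i \<in> {..<N}"
      then have "\<not> ?z i < 0" using False by blast
      then show "int (nat (?z i)) = ?z i" by simp
    qed
    moreover have "(\<Sum>i<N. int (p i)) = (\<Sum>i<N. int i)"
      using sum.permute[OF p, of int] by (simp add: o_def)
    moreover have "(\<Sum>i<N. int (N - 1 - i)) = (\<Sum>i<N. int (N - 1) - int i)"
      by (intro sum.cong) (auto simp: of_nat_diff)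
    ultimately have "int (\<Sum>i<N. nat (?z i)) = int (\<Sum>i<N. m i) - int (\<Sum>i<N. N - 1 - i)"
      by (simp add: sum.distrib sum_subtractf)
    then have "(\<Sum>i<N. nat (?z i)) \<le> d" using assms by linarith
    then show ?thesis using \<open>(\<Prod>i<N. hsymi (?z i)) \<in> Sym_upto (\<Sum>i<N. nat (?z i))\<close> Sym_upto_mono by blast
  qed
  then show "signof p * (\<Prod>i<N. hsymi (?z i)) \<in> Sym_upto d"
    using sign_mult_cases[of p "\<Prod>i<N. hsymi (?z i)"] Sym_upto_uminus by (elim disjE) (simp_all only:)
qed

lemma card_keys_le_mdeg: "card (Poly_Mapping.keys \<alpha>) \<le> mdeg \<alpha>"
proof -
  have "card (Poly_Mapping.keys \<alpha>) = (\<Sum>i\<in>Poly_Mapping.keys \<alpha>. 1)" by simp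
  also have "\<dots> \<le> mdeg \<alpha>" unfolding mdeg_def by (rule sum_mono) (simp add: in_keys_iff Suc_le_eq)
  finally show ?thesis .
qed

text \<open>\<open>map_key\<close> pulls exponents back, so it is the preimage that has to lie in
  the initial segment. An initial set of the size of K is mapped onto K, and the rest of the finite
  union onto the rest.\<close>

lemma bij_into_initial:
  assumes "finite (K :: nat set)" "card K \<le> N"
  obtains \<pi> where "bij \<pi>" "\<pi> -` K \<subseteq> {..<N}"
proof -
  obtain T where T: "T \<subseteq> {..<N}" "card T = card K" "finite T"
    using obtain_subset_with_card_n[of "card K" "{..<N}"] assms by auto
  let ?S = "K \<union> {..<N}"
  obtain f where f: "bij_betw f T K" using T assms finite_same_card_bij by blast
  have "card (?S - T) = card (?S - K)" using T assms by (subst (1 2) card_Diff_subset) auto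
  then obtain g where g: "bij_betw g (?S - T) (?S - K)" using assms finite_same_card_bij by (metis finite_Diff finite_UnI finite_lessThan)
  define \<pi> where "\<pi> = (\<lambda>x. if x \<in> T then f x else if x \<in> ?S then g x else x)"
  have 1: "bij_betw \<pi> T K" using f by (rule bij_betw_cong[THEN iffD1, rotated]) (simp add: \<pi>_def)
  have 2: "bij_betw \<pi> (?S - T) (?S - K)" using g by (rule bij_betw_cong[THEN iffD1, rotated]) (simp add: \<pi>_def)
  have "bij_betw \<pi> (T \<union> (?S - T)) (K \<union> (?S - K))" by (rule bij_betw_combine[OF 1 2]) auto
  moreover have "T \<union> (?S - T) = ?S" "K \<union> (?S - K) = ?S" using T by auto
  ultimately have 3: "bij_betw \<pi> ?S ?S" by simp
  have perm: "\<pi> permutes ?S" by (rule bij_imp_permutes[OF 3]) (use T in \<open>auto simp: \<pi>_def\<close>)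
  then have b: "bij \<pi>" by (rule permutes_bij)
  have "\<pi> -` K \<subseteq> T"
  proof
    fix x assume "x \<in> \<pi> -` K"
    then obtain y where "y \<in> T" "\<pi> y = \<pi> x" using 1 by (force simp: bij_betw_def image_iff)
    then show "x \<in> T" using b by (metis bij_pointE)
  qed
  with b T that show ?thesis by blast
qed

lemma sym_coeff_permute: "bij \<pi> \<Longrightarrow> sym_coeff H (Poly_Mapping.map_key \<pi> \<alpha>) = sym_coeff H \<alpha>"
  using sym_coeff[of H] unfolding symmetric_series_def by blast

lemma poly_mapping_sum: "p = (\<Sum>a\<in>Poly_Mapping.keys p. Poly_Mapping.single a (Poly_Mapping.lookup p a))"
  by (rule poly_mapping_eqI) (simp add: lookup_sum lookup_single when_def in_keys_iff)

text \<open>A monomial of degree at most N involves at most N variables; symmetry moves them into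
  the first N, where the restriction retains the coefficient.\<close>

lemma sym_restrict_inj:
  assumes F: "F \<in> Sym_upto d" and G: "G \<in> Sym_upto d" and N: "d \<le> N" and eq: "sym_restrict N F = sym_restrict N G"
  shows "F = G"
proof (rule symfun_eqI)
  fix \<alpha>
  show "sym_coeff F \<alpha> = sym_coeff G \<alpha>"
  proof (cases "mdeg \<alpha> \<le> d")
    case True
    then have "card (Poly_Mapping.keys \<alpha>) \<le> N" using card_keys_le_mdeg[of \<alpha>] N by linarith
    then obtain \<pi> where \<pi>: "bij \<pi>" "\<pi> -` Poly_Mapping.keys \<alpha> \<subseteq> {..<N}"
      using bij_into_initial[of "Poly_Mapping.keys \<alpha>" N] by auto
    let ?b = "Poly_Mapping.map_key \<pi> \<alpha>"
    have "Poly_Mapping.keys ?b \<subseteq> {..<N}" using \<pi> by (simp add: keys_map_key bij_is_inj)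
    then have "sym_coeff F ?b = sym_coeff G ?b" using arg_cong[OF eq, of "\<lambda>p. Poly_Mapping.lookup p ?b"]
      by (simp add: lookup_restrict)
    then show ?thesis using sym_coeff_permute[OF \<pi>(1)] by simp
  next
    case False
    then have "sym_coeff F \<alpha> = 0" "sym_coeff G \<alpha> = 0" using Sym_uptoD[OF F, of \<alpha>] Sym_uptoD[OF G, of \<alpha>] by blast+
    then show ?thesis by simp
  qed
qed

lemma sym_restrict_monomials:
  "sym_restrict N F = (\<Sum>\<alpha>\<in>Poly_Mapping.keys (sym_restrict N F).
    mpoly_const (sym_coeff F \<alpha>) * (\<Prod>j<N. mpoly_var j ^ Poly_Mapping.lookup \<alpha> j))"
proof -
  let ?K = "Poly_Mapping.keys (sym_restrict N F)"
  have "Poly_Mapping.single \<alpha> (Poly_Mapping.lookup (sym_restrict N F) \<alpha>) =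
    mpoly_const (sym_coeff F \<alpha>) * (\<Prod>j<N. mpoly_var j ^ Poly_Mapping.lookup \<alpha> j)" if "\<alpha> \<in> ?K" for \<alpha>
  proof -
    have k: "Poly_Mapping.keys \<alpha> \<subseteq> {..<N}" using that by (auto simp: in_keys_iff lookup_restrict split: if_splits)
    then have "exponent_monom N (Poly_Mapping.lookup \<alpha>) = \<alpha>"
      by (intro poly_mapping_eqI) (auto simp: lookup_exponent_monom in_keys_iff subset_iff)
    then show ?thesis using prod_var_powers[of "\<lambda>_. 1" "Poly_Mapping.lookup \<alpha>" N] k
      by (simp add: mpoly_const_def mult_single lookup_restrict)
  qed
  then show ?thesis by (subst poly_mapping_sum) (rule sum.cong[OF refl])
qed

text \<open>The coefficients of F are invariant under permuting exponents, so in the term of V that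
  belongs to p the exponents of F may be permuted by p too. The signed sum over p then assembles
  alternants.\<close>

lemma restrict_vandermonde_expand:
  "sym_restrict N F * vandermonde N = (\<Sum>\<alpha>\<in>Poly_Mapping.keys (sym_restrict N F).
    mpoly_const (sym_coeff F \<alpha>) * fun_det N (\<lambda>i j. mpoly_var j ^ (Poly_Mapping.lookup \<alpha> i + (N - 1 - i))))"
proof -
  let ?K = "Poly_Mapping.keys (sym_restrict N F)" and ?P = "{p. p permutes {..<N}}"
  have per: "sym_restrict N F * (\<Prod>j<N. mpoly_var j ^ (N - 1 - p j)) =
    (\<Sum>\<alpha>\<in>?K. mpoly_const (sym_coeff F \<alpha>) * (\<Prod>j<N. mpoly_var j ^ (Poly_Mapping.lookup \<alpha> (p j) + (N - 1 - p j))))"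
    if "p \<in> ?P" for p
  proof -
    have p: "p permutes {..<N}" "bij p" using that permutes_bij by auto
    have ip: "bij (inv_into UNIV p)" using p by (simp add: bij_imp_bij_inv)
    have K: "Poly_Mapping.map_key r \<alpha> \<in> ?K" if "\<alpha> \<in> ?K" "r permutes {..<N}" for r \<alpha>
    proof -
      have "bij r" using that permutes_bij by auto
      moreover have "r -` Poly_Mapping.keys \<alpha> \<subseteq> {..<N}"
        using that(1) permutes_in_image[OF that(2)] by (auto simp: in_keys_iff lookup_restrict subset_iff split: if_splits)
      ultimately show ?thesis using that(1)
        by (auto simp: in_keys_iff lookup_restrict sym_coeff_permute keys_map_key bij_is_inj split: if_splits)
    qed
    have "sym_restrict N F * (\<Prod>j<N. mpoly_var j ^ (N - 1 - p j)) =
      (\<Sum>\<alpha>\<in>?K. mpoly_const (sym_coeff F \<alpha>) * (\<Prod>j<N. mpoly_var j ^ (Poly_Mapping.lookup \<alpha> j + (N - 1 - p j))))"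
      by (subst sym_restrict_monomials) (simp add: sum_distrib_right mult.assoc prod.distrib power_add)
    also have "\<dots> = (\<Sum>\<alpha>\<in>?K. mpoly_const (sym_coeff F \<alpha>) * (\<Prod>j<N. mpoly_var j ^ (Poly_Mapping.lookup \<alpha> (p j) + (N - 1 - p j))))"
      by (rule sum.reindex_bij_witness[of _ "Poly_Mapping.map_key p" "Poly_Mapping.map_key (inv_into UNIV p)"])
        (use p ip K permutes_inv[OF p(1)] in
          \<open>auto simp: map_key_inv sym_coeff_permute map_key.rep_eq bij_is_inj permutes_inverses\<close>)
    finally show ?thesis .
  qed
  have "sym_restrict N F * vandermonde N = (\<Sum>p\<in>?P. signof p * (sym_restrict N F * (\<Prod>j<N. mpoly_var j ^ (N - 1 - p j))))"
    unfolding vandermonde_fun_det fun_det_cols sum_distrib_left by (simp only: mult.left_commute)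
  also have "\<dots> = (\<Sum>p\<in>?P. \<Sum>\<alpha>\<in>?K. mpoly_const (sym_coeff F \<alpha>) * (signof p * (\<Prod>j<N. mpoly_var j ^ (Poly_Mapping.lookup \<alpha> (p j) + (N - 1 - p j)))))"
    by (rule sum.cong[OF refl]) (simp only: per sum_distrib_left mult.left_commute)
  also have "\<dots> = (\<Sum>\<alpha>\<in>?K. mpoly_const (sym_coeff F \<alpha>) * fun_det N (\<lambda>i j. mpoly_var j ^ (Poly_Mapping.lookup \<alpha> i + (N - 1 - i))))"
    by (subst sum.swap) (simp only: fun_det_cols sum_distrib_left)
  finally show ?thesis .
qed

text \<open>Sorting the rows yields a Schur function up to sign, and a repeated exponent yields
  0.\<close>

lemma exponent_schur_in_span: "exponent_schur N m \<in> Sym.span (schur ` {la. is_partition la})"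
proof (cases "inj_on m {..<N}")
  case True
  then obtain la p where la: "la \<in> parts N" "p permutes {..<N}" "\<And>i. i < N \<Longrightarrow> m i = shifted N la (p i)"
    using sort_injective by blast
  have "exponent_schur N m = fun_det N (\<lambda>i. (\<lambda>i j. hsymi (int (shifted N la i) + int j - int (N - 1))) (p i))"
    unfolding exponent_schur_def by (rule fun_det_cong) (simp add: la)
  also have "\<dots> = signof p * exponent_schur N (shifted N la)"
    unfolding exponent_schur_def by (rule fun_det_permute_rows[OF la(2)])
  also have "\<dots> = signof p * schur la" by (simp add: exponent_schur_schur[OF la(1)])
  finally have "exponent_schur N m = schur la \<or> exponent_schur N m = - schur la" using sign_mult_cases[of p "schur la"] by metis
  moreover have "schur la \<in> Sym.span (schur ` {la. is_partition la})"
    using la(1) by (intro Sym.span_base) (auto simp: parts_iff)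
  ultimately show ?thesis using Sym.span_neg by metis
next
  case False
  then obtain i i' where i: "i < N" "i' < N" "i \<noteq> i'" "m i = m i'" by (auto simp: inj_on_def)
  then have "exponent_schur N m = 0" unfolding exponent_schur_def by (intro fun_det_eq_rows[of i N i']) auto
  then show ?thesis using Sym.span_zero by metis
qed

lemma schur_span: "F \<in> Sym.span (schur ` {la. is_partition la})"
proof -
  obtain N where N: "F \<in> Sym_upto N" using Sym_upto_exists by blast
  let ?K = "Poly_Mapping.keys (sym_restrict N F)"
  let ?m = "\<lambda>\<alpha> i. Poly_Mapping.lookup \<alpha> i + (N - 1 - i)"
  \<comment> \<open>Each alternant in the expansion of F V is replaced by the Jacobi--Trudi
    determinant that produces it. The degree bound on these determinants makes equality in N
    variables decisive.\<close>
  define G where "G = (\<Sum>\<alpha>\<in>?K. sym_scale (sym_coeff F \<alpha>) (exponent_schur N (?m \<alpha>)))"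
  have "exponent_schur N (?m \<alpha>) \<in> Sym_upto N" if "\<alpha> \<in> ?K" for \<alpha>
  proof (rule exponent_schur_upto)
    have "Poly_Mapping.keys \<alpha> \<subseteq> {..<N}" "sym_coeff F \<alpha> \<noteq> 0"
      using that by (auto simp: in_keys_iff lookup_restrict split: if_splits)
    then have "(\<Sum>i<N. Poly_Mapping.lookup \<alpha> i) \<le> N"
      using Sym_uptoD[OF N, of \<alpha>] mdeg_superset[of "{..<N}" \<alpha>] by simp
    then show "(\<Sum>i<N. ?m \<alpha> i) \<le> N + (\<Sum>i<N. N - 1 - i)" unfolding sum.distrib by (rule add_right_mono)
  qed
  then have G: "G \<in> Sym_upto N" unfolding G_def by (intro Sym_upto_sum Sym_upto_scale)
  have "sym_restrict N F * vandermonde N =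
    (\<Sum>\<alpha>\<in>?K. mpoly_const (sym_coeff F \<alpha>) * fun_det N (\<lambda>i j. mpoly_var j ^ ?m \<alpha> i))"
    by (rule restrict_vandermonde_expand)
  also have "\<dots> = sym_restrict N G * vandermonde N"
    unfolding jacobi_trudi G_def sym_restrict.hom_sum sym_restrict_scale sum_distrib_right
    by (simp only: mult.assoc)
  finally have "sym_restrict N F * vandermonde N = sym_restrict N G * vandermonde N" .
  then have "sym_restrict N F = sym_restrict N G" using vandermonde_nz by simp
  then have "F = G" by (rule sym_restrict_inj[OF N G order_refl])
  moreover have "G \<in> Sym.span (schur ` {la. is_partition la})"
    unfolding G_def by (intro Sym.span_sum Sym.span_scale exponent_schur_in_span)
  ultimately show ?thesis by simp
qed

text \<open>The coefficient in F V of the monomial with exponents \<open>shifted N ka\<close>, which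
  isolates the Schur function of ka. Written with delta functionals, it is evaluated by
  \<open>tensor_fun_fun_det\<close>.\<close>

definition schur_coeff :: "nat \<Rightarrow> (nat \<Rightarrow> nat) \<Rightarrow> symfun \<Rightarrow> complex"
  where "schur_coeff N ka F = tensor_fun N (\<lambda>j k. if k = shifted N ka j then 1 else 0) (sym_restrict N F * vandermonde N)"

lemma schur_coeff_scale: "schur_coeff N ka (sym_scale z F) = z * schur_coeff N ka F"
  by (simp add: schur_coeff_def sym_restrict_scale mult.assoc tensor_fun_scale)

lemma schur_coeff_sum: "schur_coeff N ka (sum f A) = (\<Sum>x\<in>A. schur_coeff N ka (f x))"
  by (simp add: schur_coeff_def sym_restrict.hom_sum sum_distrib_right tensor_fun_sum)

lemma moment_fun_monom: "moment_fun m (monom 1 k) = m k"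
proof -
  have "moment_fun m (monom 1 k) = (\<Sum>i\<le>k. coeff (monom 1 k) i * m i)"
    by (rule moment_fun_superset) (simp add: degree_monom_le)
  also have "\<dots> = (\<Sum>i\<in>{k}. coeff (monom 1 k) i * m i)"
    by (rule sum.mono_neutral_right) auto
  finally show ?thesis by simp
qed

lemma fun_det_unitriangular:
  assumes la: "la \<in> parts N" and T: "\<And>n k. n < k \<Longrightarrow> T n k = (0 :: 'a :: comm_ring_1)" "\<And>n. T n n = 1"
  shows "fun_det N (\<lambda>i j. T (shifted N la i) (shifted N la j)) = 1"
proof -
  have "fun_det N (\<lambda>i j. T (shifted N la i) (shifted N la j)) = fun_det 0 (\<lambda>i j. T (shifted N la i) (shifted N la j))"
    by (rule fun_det_reduce) (use shifted_strict[OF la] T in auto)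
  then show ?thesis by simp
qed

text \<open>The delta is triangular in both directions, so a non-zero determinant forces each
  partition to contain the other. With w = 1 this serves the extraction of Schur coefficients, with
  w the squared norms the orthogonality.\<close>

lemma fun_det_delta:
  assumes "nu \<in> parts N" "ka \<in> parts N"
  shows "fun_det N (\<lambda>i j. if shifted N nu i = shifted N ka j then w (shifted N nu i) else 0) =
    (if nu = ka then \<Prod>i<N. w (shifted N nu i) else (0 :: 'a :: comm_ring_1))"
proof -
  let ?T = "\<lambda>n k. if n = k then 1 else (0 :: 'a)"
  have "fun_det N (\<lambda>i j. if shifted N nu i = shifted N ka j then w (shifted N nu i) else 0) =
    fun_det N (\<lambda>i j. w (shifted N nu i) * 1 * ?T (shifted N nu i) (shifted N ka j))"
    by (rule fun_det_cong) simp
  also have "\<dots> = (\<Prod>i<N. w (shifted N nu i)) * fun_det N (\<lambda>i j. ?T (shifted N nu i) (shifted N ka j))"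
    by (subst fun_det_scale) simp
  also have "fun_det N (\<lambda>i j. ?T (shifted N nu i) (shifted N ka j)) = (if nu = ka then 1 else 0)"
  proof (cases "nu = ka")
    case True
    then show ?thesis using fun_det_unitriangular[OF assms(1), of ?T] by simp
  next
    case False
    then consider "\<not> ka \<le> nu" | "\<not> nu \<le> ka" by (metis antisym)
    then show ?thesis
    proof cases
      case 1
      then show ?thesis using fun_det_shift_zero[OF assms, of ?T] False by simp
    next
      case 2
      then have "fun_det N (\<lambda>i j. ?T (shifted N ka i) (shifted N nu j)) = 0"
        using fun_det_shift_zero[OF assms(2,1), of ?T] by simp
      then have "fun_det N (\<lambda>i j. ?T (shifted N ka j) (shifted N nu i)) = 0"
        using fun_det_transpose[of N "\<lambda>i j. ?T (shifted N ka i) (shifted N nu j)"] by simp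
      moreover have "fun_det N (\<lambda>i j. ?T (shifted N nu i) (shifted N ka j)) = fun_det N (\<lambda>i j. ?T (shifted N ka j) (shifted N nu i))"
        by (rule fun_det_cong) auto
      ultimately show ?thesis using False by simp
    qed
  qed
  finally show ?thesis by simp
qed

lemma schur_coeff_schur:
  assumes "nu \<in> parts N" "ka \<in> parts N"
  shows "schur_coeff N ka (schur nu) = (if nu = ka then 1 else 0)"
proof -
  let ?T = "\<lambda>n k. if n = k then 1 else (0 :: complex)"
  have "schur_coeff N ka (schur nu) = tensor_fun N (\<lambda>j k. ?T k (shifted N ka j)) (fun_det N (\<lambda>i j. poly_at j (monom 1 (shifted N nu i))))"
    by (simp add: schur_coeff_def restrict_schur[OF assms(1)] poly_at_monom)
  also have "\<dots> = fun_det N (\<lambda>i j. ?T (shifted N nu i) (shifted N ka j))"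
    by (simp add: tensor_fun_fun_det moment_fun_monom)
  also have "\<dots> = (if nu = ka then 1 else 0)"
    using fun_det_delta[OF assms, of "\<lambda>_. 1 :: complex"] by simp
  finally show ?thesis .
qed

lemma psize_parts: "la \<in> parts N \<Longrightarrow> psize la = (\<Sum>i<N. la i)"
  unfolding psize_def using is_partition_parts[of la] parts_plen[of la N]
  by (intro sum.mono_neutral_left) (auto simp: parts_def)

lemma psize_less:
  assumes "is_partition la" "is_partition ka" "ka \<le> la" "ka \<noteq> la"
  shows "psize ka < psize la"
proof -
  have la: "la \<in> parts (plen la)" using assms by (simp add: is_partition_parts)
  then have ka: "ka \<in> parts (plen la)" using parts_below[OF la] assms by auto
  obtain i where i: "ka i \<noteq> la i" using assms(4) by auto
  moreover have "ka i \<le> la i" using assms(3) by (rule le_funD)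
  ultimately have "ka i < la i" by simp
  moreover from this have "i < plen la" using la unfolding parts_def by (cases "i < plen la") auto
  ultimately show ?thesis unfolding psize_parts[OF la] psize_parts[OF ka]
    using assms(3) by (intro sum_strict_mono_ex1) (auto simp: le_fun_def)
qed

abbreviation below :: "(nat \<Rightarrow> nat) \<Rightarrow> (nat \<Rightarrow> nat) set"
  where "below la \<equiv> {ka. is_partition ka \<and> ka \<le> la}"

lemma triangular_span:
  assumes B: "\<And>la. is_partition la \<Longrightarrow> B la = (\<Sum>ka\<in>below la. sym_scale (D la ka) (S ka))"
    and D: "\<And>la. is_partition la \<Longrightarrow> D la la = 1"
    and la: "is_partition la"
  shows "S la \<in> Sym.span (B ` {la. is_partition la})"
  using la
proof (induction "psize la" arbitrary: la rule: less_induct)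
  case less
  let ?r = "\<Sum>ka\<in>below la - {la}. sym_scale (D la ka) (S ka)"
  have "B la = sym_scale (D la la) (S la) + ?r"
    unfolding B[OF less.prems] by (rule sum.remove) (use finite_below less.prems in auto)
  then have "S la = B la - ?r" using D[OF less.prems] by (simp add: Sym.scale_one)
  moreover have "S ka \<in> Sym.span (B ` {la. is_partition la})" if "ka \<in> below la - {la}" for ka
    using that less.prems psize_less[of la ka] by (intro less.hyps) auto
  then have "?r \<in> Sym.span (B ` {la. is_partition la})" by (intro Sym.span_sum Sym.span_scale)
  moreover have "B la \<in> Sym.span (B ` {la. is_partition la})" using less.prems by (intro Sym.span_base) auto
  ultimately show ?case by (simp add: Sym.span_diff)
qed

text \<open>Among the indices with non-zero coefficient, one of maximal size is chosen. Its Schur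
  function occurs in no other term with non-zero coefficient, so extracting it from the vanishing
  sum gives its coefficient.\<close>

lemma triangular_independent:
  assumes B: "\<And>la. is_partition la \<Longrightarrow> B la = (\<Sum>ka\<in>below la. sym_scale (D la ka) (schur ka))"
    and D: "\<And>la. is_partition la \<Longrightarrow> D la la = 1"
    and J: "finite J" "\<And>la. la \<in> J \<Longrightarrow> is_partition la"
    and z: "(\<Sum>la\<in>J. sym_scale (c la) (B la)) = 0" and mu: "mu \<in> J"
  shows "c mu = 0"
proof (rule ccontr)
  assume "c mu \<noteq> 0"
  define J' where "J' = {la \<in> J. c la \<noteq> 0}"
  have "finite J'" "J' \<noteq> {}" using J mu \<open>c mu \<noteq> 0\<close> by (auto simp: J'_def)
  then have "Max (psize ` J') \<in> psize ` J'" by (intro Max_in) auto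
  then obtain la where la: "la \<in> J'" and Max: "Max (psize ` J') = psize la" by auto
  have max: "psize nu \<le> psize la" if "nu \<in> J'" for nu
    using that \<open>finite J'\<close> unfolding Max[symmetric] by (intro Max_ge) auto
  define N where "N = Max (plen ` J)"
  have N: "nu \<in> parts N" if "nu \<in> J" for nu
    using that J by (auto simp: parts_iff N_def)
  have laJ: "la \<in> J" "c la \<noteq> 0" "is_partition la" using la J by (auto simp: J'_def)
  have co: "schur_coeff N la (B nu) = (if la \<in> below nu then D nu la else 0)" if "nu \<in> J" for nu
  proof -
    have "schur_coeff N la (B nu) = (\<Sum>ka\<in>below nu. D nu ka * (if ka = la then 1 else 0))"
      unfolding B[OF J(2)[OF that]] schur_coeff_sum schur_coeff_scale
    proof (intro sum.cong refl arg_cong2[of _ _ _ _ "(*)"] schur_coeff_schur)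
      fix ka assume "ka \<in> below nu"
      then show "ka \<in> parts N" using parts_below[OF N[OF that]] by blast
    qed (rule N[OF laJ(1)])
    then show ?thesis using finite_below[OF J(2)[OF that]] by (simp add: if_distrib cong: if_cong)
  qed
  have "0 = schur_coeff N la (\<Sum>nu\<in>J. sym_scale (c nu) (B nu))"
    unfolding z using schur_coeff_sum[of N la "\<lambda>_. 0" "{}"] by simp
  also have "\<dots> = (\<Sum>nu\<in>J. c nu * (if la \<in> below nu then D nu la else 0))"
    by (simp add: schur_coeff_sum schur_coeff_scale co)
  also have "\<dots> = (\<Sum>nu\<in>{la}. c nu * (if la \<in> below nu then D nu la else 0))"
  proof (rule sum.mono_neutral_right)
    show "\<forall>nu\<in>J - {la}. c nu * (if la \<in> below nu then D nu la else 0) = 0"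
    proof
      fix nu assume nu: "nu \<in> J - {la}"
      show "c nu * (if la \<in> below nu then D nu la else 0) = 0"
      proof (cases "c nu = 0")
        case False
        then have "psize nu \<le> psize la" using nu max by (simp add: J'_def)
        then have "\<not> la \<le> nu" using psize_less[of nu la] J(2)[of nu] laJ(3) nu by force
        then show ?thesis by simp
      qed simp
    qed
  qed (use J laJ in auto)
  also have "\<dots> = c la" using laJ D by simp
  finally show False using laJ by simp
qed

section \<open>One-variable \<open>q\<close>-Meixner polynomials\<close>

lemma moment_fun_add: "moment_fun m (f + g) = moment_fun m f + moment_fun m g"
  using moment_fun_superset[of f "max (degree f) (degree g)" m] moment_fun_superset[of g "max (degree f) (degree g)" m]
    moment_fun_superset[of "f + g" "max (degree f) (degree g)" m]
  by (simp add: degree_add_le distrib_right sum.distrib)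

lemma moment_fun_smult: "moment_fun m (smult z f) = z * moment_fun m f"
  using moment_fun_superset[of "smult z f" "degree f" m]
  by (simp add: degree_smult_le moment_fun_def sum_distrib_left mult.assoc)

lemma moment_fun_pCons: "moment_fun m (pCons 0 f) = moment_fun (\<lambda>k. m (Suc k)) f"
proof -
  have "moment_fun m (pCons 0 f) = (\<Sum>k\<le>Suc (degree f). coeff (pCons 0 f) k * m k)"
    by (rule moment_fun_superset) (simp add: degree_pCons_le)
  also have "\<dots> = moment_fun (\<lambda>k. m (Suc k)) f"
    by (subst sum.atMost_Suc_shift) (simp add: moment_fun_def)
  finally show ?thesis .
qed

lemma moment_fun_linear_functional:
  "moment_fun (\<lambda>k. x * m k + y * m' k + z * m'' k) f = x * moment_fun m f + y * moment_fun m' f + z * moment_fun m'' f"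
  by (simp add: moment_fun_def sum_distrib_left sum.distrib algebra_simps)

text \<open>Component n of J^k e_0 for the tridiagonal operator J that represents multiplication by
  x in the basis of the \<open>p n\<close>. The first factor suppresses the neighbour n - 1 at n =
  0, where the subtraction yields 0 again.\<close>

fun jacobi_vec :: "(nat \<Rightarrow> complex) \<Rightarrow> (nat \<Rightarrow> complex) \<Rightarrow> nat \<Rightarrow> nat \<Rightarrow> complex"
  where "jacobi_vec \<beta> \<gamma> 0 n = (if n = 0 then 1 else 0)"
  | "jacobi_vec \<beta> \<gamma> (Suc k) n = (if n = 0 then 0 else 1) * jacobi_vec \<beta> \<gamma> k (n - 1) + \<beta> n * jacobi_vec \<beta> \<gamma> k n
      + \<gamma> (Suc n) * jacobi_vec \<beta> \<gamma> k (Suc n)"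

text \<open>The moments are the vacuum expectations of the powers of
  the Jacobi operator.\<close>

lemma favard:
  fixes p :: "nat \<Rightarrow> complex poly"
  assumes p0: "p 0 = 1" and \<gamma>0: "\<gamma> 0 = 0"
    and rec: "\<And>n. pCons 0 (p n) = p (Suc n) + smult (\<beta> n) (p n) + smult (\<gamma> n) (p (n - 1))"
  shows "\<exists>m. \<forall>i j. moment_fun m (p i * p j) = (if i = j then \<Prod>k=1..i. \<gamma> k else 0)"
proof -
  \<comment> \<open>Component n of f(J) e_0. It proves to be the coordinate of f at
    \<open>p n\<close>, and the component 0 is the functional sought.\<close>
  define V where "V = (\<lambda>f n. moment_fun (\<lambda>k. jacobi_vec \<beta> \<gamma> k n) f)"
  have VX: "V (pCons 0 f) n = (if n = 0 then 0 else 1) * V f (n - 1) + \<beta> n * V f n + \<gamma> (Suc n) * V f (Suc n)" for f n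
    unfolding V_def moment_fun_pCons jacobi_vec.simps(2) by (rule moment_fun_linear_functional)
  have Vadd: "V (f + g) n = V f n + V g n" and Vsm: "V (smult z f) n = z * V f n" for f g z n
    by (simp_all add: V_def moment_fun_add moment_fun_smult)
  have Vp: "V (p i) n = (if n = i then 1 else 0)" for i n
  proof (induction i arbitrary: n rule: less_induct)
    case (less i)
    show ?case
    proof (cases i)
      case 0
      then show ?thesis by (simp add: p0 V_def moment_fun_def)
    next
      case (Suc k)
      have "V (p (Suc k)) n = V (pCons 0 (p k)) n - \<beta> k * V (p k) n - \<gamma> k * V (p (k - 1)) n"
        unfolding rec by (simp add: Vadd Vsm)
      then have e: "V (p i) n = (if n = 0 then 0 else 1) * V (p k) (n - 1) + \<beta> n * V (p k) n + \<gamma> (Suc n) * V (p k) (Suc n)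
          - \<beta> k * V (p k) n - \<gamma> k * V (p (k - 1)) n"
        unfolding VX Suc .
      show ?thesis unfolding e using less.IH[of k] less.IH[of "k - 1"] \<gamma>0 Suc
        by (cases n; cases k) auto
    qed
  qed
  define m where "m = (\<lambda>k. jacobi_vec \<beta> \<gamma> k 0)"
  have m: "moment_fun m f = V f 0" for f by (simp add: V_def m_def)
  define h where "h = (\<lambda>i. \<Prod>k=1..i. \<gamma> k)"
  have h0: "h 0 = 1" and hS: "h (Suc i) = \<gamma> (Suc i) * h i" for i
    by (simp_all add: h_def prod.nat_ivl_Suc')
  have orth: "moment_fun m (p i * p j) = (if i = j then h i else 0)" for i j
  proof (induction i arbitrary: j rule: less_induct)
    case (less i)
    show ?case
    proof (cases i)
      case 0
      then show ?thesis by (simp add: p0 m Vp h0)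
    next
      case (Suc k)
      have "p (Suc k) * p j = pCons 0 (p k) * p j - smult (\<beta> k) (p k * p j) - smult (\<gamma> k) (p (k - 1) * p j)"
        unfolding rec by (simp add: algebra_simps)
      \<comment> \<open>Multiplication by x is moved from one factor to the other. This lowers the
        first index, at the price of changing the second, hence an induction on i with j
        arbitrary.\<close>
      also have "pCons 0 (p k) * p j = p k * pCons 0 (p j)" by simp
      also have "\<dots> = p k * p (Suc j) + smult (\<beta> j) (p k * p j) + smult (\<gamma> j) (p k * p (j - 1))"
        unfolding rec by (simp add: algebra_simps)
      finally have "p (Suc k) * p j = p k * p (Suc j) + smult (\<beta> j) (p k * p j) + smult (\<gamma> j) (p k * p (j - 1))
          + smult (- \<beta> k) (p k * p j) + smult (- \<gamma> k) (p (k - 1) * p j)"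
        by simp
      from arg_cong[OF this, of "moment_fun m"]
      have e: "moment_fun m (p i * p j) = moment_fun m (p k * p (Suc j)) + \<beta> j * moment_fun m (p k * p j) + \<gamma> j * moment_fun m (p k * p (j - 1))
          - \<beta> k * moment_fun m (p k * p j) - \<gamma> k * moment_fun m (p (k - 1) * p j)"
        by (simp only: Suc moment_fun_add moment_fun_smult) simp
      show ?thesis unfolding e using less.IH[of k] less.IH[of "k - 1"] \<gamma>0 Suc
        by (cases j; cases k) (auto simp: hS h0)
    qed
  qed
  then show ?thesis unfolding h_def by blast
qed

section \<open>Expansion, recurrence and norms of the \<open>q\<close>-Meixner polynomials\<close>

lemma qpoch_Suc: "qpoch x q (Suc n) = qpoch x q n * (1 - x * q ^ n)"
  by (simp add: qpoch_def)

lemma qpoch_Suc': "qpoch x q (Suc n) = (1 - x) * qpoch (x * q) q n"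
  unfolding qpoch_def by (subst prod.lessThan_Suc_shift) (simp add: mult.assoc power_Suc)

lemma qpoch_0 [simp]: "qpoch x q 0 = 1"
  by (simp add: qpoch_def)

text \<open>The three-term recurrence after division by the common coefficient, with \<open>Q = q\<^sup>n\<close> and
  \<open>R = q\<^sup>m\<close>.\<close>

lemma rec_identity:
  fixes u q Q R \<alpha> \<beta> s :: complex
  assumes nz: "R \<noteq> 0" "Q \<noteq> 0" "q \<noteq> 0" "\<beta> \<noteq> 0" "R - q * Q \<noteq> 0" and s: "s = u * \<beta>"
  shows "u * q / (R * R) * (1 - \<alpha> * R) * (1 - R) / (1 - q * Q / R) + s / R =
      u / (q * Q * Q) * (1 - \<alpha> * q * Q) * (1 - q * Q) / (1 - q * Q / R) +
      (s + s / (q * Q * Q) * (- (1 - \<alpha> * q * Q) / \<beta> + q * (1 - Q) * (Q - 1 / \<beta>))) +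
      u / (Q * Q) * (1 - \<beta> * Q) * (1 - Q / R)"
proof -
  define e where "e = R - q * Q"
  \<comment> \<open>A common denominator of all terms. Once each term is written over it, a
    polynomial identity remains, which is checked by expansion.\<close>
  define D where "D = q * Q * Q * R * e"
  have e: "e \<noteq> 0" "1 - q * Q / R = e / R" using nz by (simp_all add: e_def field_simps)
  have "u * q / (R * R) * (1 - \<alpha> * R) * (1 - R) / (e / R) = u * q * q * Q * Q * (1 - \<alpha> * R) * (1 - R) / D"
    using nz(1-4) e(1) by (simp add: D_def)
  moreover have "s / R = u * \<beta> * q * Q * Q * e / D"
    using nz(1-4) e(1) by (simp add: D_def s)
  moreover have "u / (q * Q * Q) * (1 - \<alpha> * q * Q) * (1 - q * Q) / (e / R) = u * (1 - \<alpha> * q * Q) * (1 - q * Q) * R * R / D"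
    using nz(1-4) e(1) by (simp add: D_def mult.assoc)
  moreover have "s + s / (q * Q * Q) * (- (1 - \<alpha> * q * Q) / \<beta> + q * (1 - Q) * (Q - 1 / \<beta>)) =
    (u * \<beta> * q * Q * Q + u * (- (1 - \<alpha> * q * Q) + q * (1 - Q) * (Q * \<beta> - 1))) * R * e / D"
  proof -
    have "s / (q * Q * Q) * (- (1 - \<alpha> * q * Q) / \<beta> + q * (1 - Q) * (Q - 1 / \<beta>)) =
      u / (q * Q * Q) * (- (1 - \<alpha> * q * Q) + q * (1 - Q) * (Q * \<beta> - 1))"
    proof -
      have "- (1 - \<alpha> * q * Q) / \<beta> + q * (1 - Q) * (Q - 1 / \<beta>) = (- (1 - \<alpha> * q * Q) + q * (1 - Q) * (Q * \<beta> - 1)) / \<beta>"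
        using nz(4) by (simp add: field_simps)
      then show ?thesis using nz(4) by (simp only: s) simp
    qed
    moreover have "s = u * \<beta> * q * Q * Q * R * e / D" using nz(1-4) e(1) by (simp add: D_def s)
    moreover have "u / (q * Q * Q) * x = u * x * R * e / D" for x using nz(1-4) e(1) by (simp add: D_def)
    ultimately show ?thesis by (simp only: add_divide_distrib distrib_right)
  qed
  moreover have "u / (Q * Q) * (1 - \<beta> * Q) * (1 - Q / R) = u * q * (1 - \<beta> * Q) * (R - Q) * e / D"
  proof -
    have "1 - Q / R = (R - Q) / R" using nz(1) by (simp add: field_simps)
    then show ?thesis using nz(1-4) e(1) by (simp add: D_def mult.assoc)
  qed
  moreover have "u * q * q * Q * Q * (1 - \<alpha> * R) * (1 - R) + u * \<beta> * q * Q * Q * e =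
    u * (1 - \<alpha> * q * Q) * (1 - q * Q) * R * R +
    (u * \<beta> * q * Q * Q + u * (- (1 - \<alpha> * q * Q) + q * (1 - Q) * (Q * \<beta> - 1))) * R * e +
    u * q * (1 - \<beta> * Q) * (R - Q) * e"
    unfolding e_def by (simp add: algebra_simps)
  ultimately show ?thesis unfolding e(2) by (simp only: add_divide_distrib[symmetric])
qed

locale qmeixner =
  fixes q s \<alpha> \<beta> :: complex
  assumes q0: "q \<noteq> 0" and qn: "\<And>n. n > 0 \<Longrightarrow> q ^ n \<noteq> 1" and b0: "\<beta> \<noteq> 0"
begin

definition "u = s / \<beta>"

text \<open>For s \<noteq> 0 these are, in the basis \<open>omega\<close>, the coefficients of the
  monic multiple of 2phi1(q^-n, x/s; \<alpha> q; q; \<beta> q^(n+1)), the q-Meixner polynomial in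
  x/s with the usual parameters b = \<alpha> and c = -1/\<beta>. Multiplication by (\<alpha> q; q)_n
  has cleared the denominators.\<close>

definition expansion_coeff :: "nat \<Rightarrow> nat \<Rightarrow> complex"
  where "expansion_coeff n m = (if m \<le> n then u ^ (n - m) * (q ^ (m * m) / q ^ (n * n)) * qpoch (\<alpha> * q ^ Suc m) q (n - m)
    * (qpoch q q n / (qpoch q q m * qpoch q q (n - m))) else 0)"

definition rec_beta :: "nat \<Rightarrow> complex"
  where "rec_beta n = s + s / (q * q ^ n * q ^ n) * (- (1 - \<alpha> * q * q ^ n) / \<beta> + q * (1 - q ^ n) * (q ^ n - 1 / \<beta>))"

definition rec_gamma :: "nat \<Rightarrow> complex"
  where "rec_gamma n = u\<^sup>2 * q / (q ^ n) ^ 4 * (1 - q ^ n) * (1 - \<alpha> * q ^ n) * (1 - \<beta> * q ^ n)"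

lemma qfac_nz: "qpoch q q n \<noteq> 0"
  using qn[of "Suc _"] by (auto simp: qpoch_def)

lemma expansion_coeff_diag: "expansion_coeff n n = 1"
  using qfac_nz q0 by (simp add: expansion_coeff_def)

text \<open>Neighbouring coefficients are written as rational multiples of
  \<open>expansion_coeff n m\<close>, which turns the recurrence into an identity of rational
  functions in q^n and q^m.\<close>

lemma expansion_coeff_up:
  assumes "m \<le> n"
  shows "expansion_coeff (Suc n) m = expansion_coeff n m * (u / (q * q ^ n * q ^ n) * (1 - \<alpha> * q * q ^ n) * (1 - q * q ^ n) / (1 - q * q ^ n / q ^ m))"
proof -
  obtain k where n: "n = m + k" using assms le_Suc_ex by blast
  have "q * q ^ n / q ^ m = q * q ^ k" using q0 by (simp add: n power_add)
  moreover have "q ^ (Suc n * Suc n) = q ^ (n * n) * (q * q ^ n * q ^ n)"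
    by (simp add: power_add[symmetric] flip: power_Suc) (simp add: algebra_simps)
  moreover have "1 - q * q ^ k \<noteq> 0" using qn[of "Suc k"] by simp
  moreover have "qpoch (\<alpha> * q ^ Suc m) q (Suc n - m) = qpoch (\<alpha> * q ^ Suc m) q (n - m) * (1 - \<alpha> * q * q ^ n)"
    using assms by (simp add: Suc_diff_le qpoch_Suc n power_add mult_ac)
  moreover have "qpoch q q (Suc n) = qpoch q q n * (1 - q * q ^ n)" by (rule qpoch_Suc)
  moreover have "qpoch q q (Suc n - m) = qpoch q q (n - m) * (1 - q * q ^ k)"
    by (simp add: Suc_diff_le qpoch_Suc n)
  moreover have "u ^ (Suc n - m) = u ^ (n - m) * u" using assms by (simp add: Suc_diff_le)
  ultimately show ?thesis using qfac_nz q0 assms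
    by (simp only: expansion_coeff_def le_Suc_eq simp_thms if_True) (simp add: divide_simps)
qed

lemma expansion_coeff_left:
  assumes "m < n"
  shows "expansion_coeff n m = expansion_coeff n (Suc m) * (u * q / (q ^ Suc m * q ^ Suc m) * (1 - \<alpha> * q ^ Suc m) * (1 - q ^ Suc m) / (1 - q * q ^ n / q ^ Suc m))"
proof -
  obtain k where n: "n = m + Suc k" using assms less_iff_Suc_add by auto
  have "q * q ^ n / q ^ Suc m = q * q ^ k" using q0 by (simp add: n power_add)
  moreover have "q ^ (Suc m * Suc m) * q = q ^ (m * m) * (q ^ Suc m * q ^ Suc m)"
    by (simp add: power_add[symmetric] flip: power_Suc power_Suc2) (simp add: algebra_simps)
  moreover have "1 - q * q ^ k \<noteq> 0" using qn[of "Suc k"] by simp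
  moreover have "qpoch (\<alpha> * q ^ Suc m) q (n - m) = (1 - \<alpha> * q ^ Suc m) * qpoch (\<alpha> * q ^ Suc (Suc m)) q (n - Suc m)"
    using qpoch_Suc'[of "\<alpha> * q ^ Suc m" q k] by (simp add: n mult_ac)
  moreover have "qpoch q q (Suc m) = qpoch q q m * (1 - q ^ Suc m)" by (simp add: qpoch_Suc)
  moreover have "qpoch q q (n - m) = qpoch q q (n - Suc m) * (1 - q * q ^ k)"
    by (simp add: qpoch_Suc n)
  moreover have "u ^ (n - m) = u ^ (n - Suc m) * u" by (simp add: n)
  moreover have "1 - q ^ Suc m \<noteq> 0" using qn[of "Suc m"] by simp
  moreover have "m \<le> n" "Suc m \<le> n" using assms by auto
  ultimately show ?thesis using qfac_nz[of m] qfac_nz[of n] qfac_nz[of "n - Suc m"] q0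
    by (simp only: expansion_coeff_def if_True) (simp add: divide_simps)
qed

text \<open>At m = n the last factor vanishes, and so does the left side: either n = 0 and
  \<open>rec_gamma\<close> is 0, or m lies above n - 1. Elsewhere this inverts
  \<open>expansion_coeff_up\<close>.\<close>

lemma rec_gamma_expansion_coeff:
  assumes "m \<le> n"
  shows "rec_gamma n * expansion_coeff (n - 1) m = expansion_coeff n m * (u / (q ^ n * q ^ n) * (1 - \<beta> * q ^ n) * (1 - q ^ n / q ^ m))"
proof (cases "m = n")
  case True
  then show ?thesis using q0 by (cases n) (auto simp: rec_gamma_def expansion_coeff_def)
next
  case False
  then obtain n' where n': "n = Suc n'" "m \<le> n'" using assms by (cases n) auto
  have "q ^ (Suc n' - m) \<noteq> 1" using qn n' by simp
  then have "1 - q * q ^ n' / q ^ m \<noteq> 0" using n' q0 by (simp add: power_diff Suc_diff_le)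
  then show ?thesis unfolding n' using expansion_coeff_up[OF n'(2)] q0
    by (simp add: rec_gamma_def power2_eq_square power4_eq_xxxx) (simp add: field_simps)
qed

text \<open>These are the coefficients of \<open>omega m\<close> in the recurrence, the left side
  being that of x p_n by x \<omega>_m = \<omega>_(m+1) + s q^(-m) \<omega>_m.\<close>

lemma expansion_coeff_rec:
  "(if m = 0 then 0 else expansion_coeff n (m - 1)) + s / q ^ m * expansion_coeff n m =
    expansion_coeff (Suc n) m + rec_beta n * expansion_coeff n m + rec_gamma n * expansion_coeff (n - 1) m"
proof -
  consider "m \<le> n" | "m = Suc n" | "m > Suc n" by linarith
  then show ?thesis
  proof cases
    case 1
    define Q where "Q = q ^ n" define R where "R = q ^ m"
    have R0: "R \<noteq> 0" "Q \<noteq> 0" using q0 by (simp_all add: R_def Q_def)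
    have "q ^ (Suc n - m) \<noteq> 1" using qn 1 by simp
    then have nz: "R - q * Q \<noteq> 0" using 1 q0 by (simp add: R_def Q_def power_diff Suc_diff_le field_simps)
    \<comment> \<open>At m = 0 both sides vanish, the right one through the factor 1 - R.\<close>
    have t1: "(if m = 0 then 0 else expansion_coeff n (m - 1)) = expansion_coeff n m * (u * q / (R * R) * (1 - \<alpha> * R) * (1 - R) / (1 - q * Q / R))"
      using expansion_coeff_left[of "m - 1" n] 1 by (cases m) (auto simp: R_def Q_def)
    have "u * q / (R * R) * (1 - \<alpha> * R) * (1 - R) / (1 - q * Q / R) + s / R =
      u / (q * Q * Q) * (1 - \<alpha> * q * Q) * (1 - q * Q) / (1 - q * Q / R) +
      (s + s / (q * Q * Q) * (- (1 - \<alpha> * q * Q) / \<beta> + q * (1 - Q) * (Q - 1 / \<beta>))) +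
      u / (Q * Q) * (1 - \<beta> * Q) * (1 - Q / R)"
      by (rule rec_identity) (use R0 nz b0 q0 in \<open>simp_all add: u_def\<close>)
    note arg_cong[OF this, of "\<lambda>x. expansion_coeff n m * x"]
    then show ?thesis unfolding t1 expansion_coeff_up[OF 1] rec_gamma_expansion_coeff[OF 1] rec_beta_def Q_def[symmetric] R_def[symmetric]
      by (simp add: distrib_left mult.commute)
  next
    case 2
    then show ?thesis by (simp add: expansion_coeff_diag) (simp add: expansion_coeff_def)
  next
    case 3
    then show ?thesis by (auto simp: expansion_coeff_def)
  qed
qed

definition omega :: "nat \<Rightarrow> complex poly"
  where "omega m = (\<Prod>i<m. [:- (s / q ^ i), 1:])"

definition meixner_poly :: "nat \<Rightarrow> complex poly"
  where "meixner_poly n = (\<Sum>m\<le>n. smult (expansion_coeff n m) (omega m))"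

lemma omega_rec: "pCons 0 (omega m) = omega (Suc m) + smult (s / q ^ m) (omega m)"
  by (simp add: omega_def algebra_simps)

lemma meixner_poly_superset: "n \<le> K \<Longrightarrow> meixner_poly n = (\<Sum>m\<le>K. smult (expansion_coeff n m) (omega m))"
  unfolding meixner_poly_def by (rule sum.mono_neutral_left) (auto simp: expansion_coeff_def)

lemma meixner_poly_rec: "pCons 0 (meixner_poly n) = meixner_poly (Suc n) + smult (rec_beta n) (meixner_poly n) + smult (rec_gamma n) (meixner_poly (n - 1))"
proof -
  have "pCons 0 (meixner_poly n) = (\<Sum>m\<le>n. smult (expansion_coeff n m) (pCons 0 (omega m)))"
  proof -
    have "pCons 0 (meixner_poly n) = [:0, 1:] * meixner_poly n" by simp
    also have "\<dots> = (\<Sum>m\<le>n. smult (expansion_coeff n m) ([:0, 1:] * omega m))"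
      unfolding meixner_poly_def by (simp only: sum_distrib_left mult_smult_right)
    finally show ?thesis by simp
  qed
  also have "\<dots> = (\<Sum>m\<le>n. smult (expansion_coeff n m) (omega (Suc m))) + (\<Sum>m\<le>n. smult (s / q ^ m * expansion_coeff n m) (omega m))"
    by (simp add: omega_rec smult_add_right sum.distrib mult.commute)
  also have "(\<Sum>m\<le>n. smult (expansion_coeff n m) (omega (Suc m))) = (\<Sum>m\<le>Suc n. smult (if m = 0 then 0 else expansion_coeff n (m - 1)) (omega m))"
    by (subst sum.atMost_Suc_shift) simp
  also have "(\<Sum>m\<le>n. smult (s / q ^ m * expansion_coeff n m) (omega m)) = (\<Sum>m\<le>Suc n. smult (s / q ^ m * expansion_coeff n m) (omega m))"
    by (rule sum.mono_neutral_left) (auto simp: expansion_coeff_def)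
  also have "(\<Sum>m\<le>Suc n. smult (if m = 0 then 0 else expansion_coeff n (m - 1)) (omega m)) + \<dots>
    = (\<Sum>m\<le>Suc n. smult ((if m = 0 then 0 else expansion_coeff n (m - 1)) + s / q ^ m * expansion_coeff n m) (omega m))"
    by (simp only: sum.distrib[symmetric] smult_add_left)
  also have "\<dots> = (\<Sum>m\<le>Suc n. smult (expansion_coeff (Suc n) m) (omega m)) + (\<Sum>m\<le>Suc n. smult (rec_beta n) (smult (expansion_coeff n m) (omega m)))
    + (\<Sum>m\<le>Suc n. smult (rec_gamma n) (smult (expansion_coeff (n - 1) m) (omega m)))"
    by (simp only: expansion_coeff_rec smult_add_left sum.distrib smult_smult)
  also have "\<dots> = meixner_poly (Suc n) + smult (rec_beta n) (meixner_poly n) + smult (rec_gamma n) (meixner_poly (n - 1))"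
    by (simp only: meixner_poly_superset[of n "Suc n"] meixner_poly_superset[of "Suc n" "Suc n"] meixner_poly_superset[of "n - 1" "Suc n"]
        smult_sum2 le_Suc_eq order.refl simp_thms le_SucI diff_le_self)
  finally show ?thesis .
qed

definition sq_norm :: "nat \<Rightarrow> complex"
  where "sq_norm n = (u\<^sup>2) ^ n * q ^ n / q ^ (2 * n * (n + 1)) * qpoch q q n * qpoch (\<alpha> * q) q n * qpoch (\<beta> * q) q n"

lemma sq_norm_prod: "sq_norm n = (\<Prod>k=1..n. rec_gamma k)"
proof (induction n)
  case (Suc n)
  have "q ^ (2 * Suc n * (Suc n + 1)) = q ^ (2 * n * (n + 1)) * (q ^ Suc n) ^ 4"
  proof -
    have "2 * Suc n * (Suc n + 1) = 2 * n * (n + 1) + Suc n * 4" by simp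
    then show ?thesis by (simp only: power_add power_mult)
  qed
  then have "sq_norm (Suc n) = rec_gamma (Suc n) * sq_norm n"
    using q0 by (simp only: sq_norm_def rec_gamma_def qpoch_Suc) (simp add: field_simps)
  with Suc show ?case by (simp add: prod.nat_ivl_Suc')
qed (simp add: sq_norm_def)

lemma meixner_poly_orthogonal: "\<exists>m. \<forall>i j. moment_fun m (meixner_poly i * meixner_poly j) = (if i = j then sq_norm i else 0)"
  unfolding sq_norm_prod
proof (rule favard)
  show "meixner_poly 0 = 1" by (simp add: meixner_poly_def omega_def expansion_coeff_diag)
  show "rec_gamma 0 = 0" by (simp add: rec_gamma_def)
qed (rule meixner_poly_rec)

end

section \<open>Interpolation symmetric functions\<close>

text \<open>The Newton basis for the nodes z.\<close>

definition npoly :: "(nat \<Rightarrow> complex) \<Rightarrow> nat \<Rightarrow> complex poly"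
  where "npoly z m = (\<Prod>i<m. [:- z i, 1:])"

lemma npoly_Suc: "npoly z (Suc m) = npoly z m * [:- z m, 1:]"
  by (simp add: npoly_def mult.commute)

lemma degree_npoly: "degree (npoly z m) = m"
  unfolding npoly_def by (subst degree_prod_eq_sum_degree) auto

lemma coeff_npoly_self: "coeff (npoly z m) m = 1"
proof -
  have "lead_coeff (npoly z m) = 1" unfolding npoly_def lead_coeff_prod by simp
  then show ?thesis by (simp add: degree_npoly)
qed

lemma coeff_npoly_0: "m < k \<Longrightarrow> coeff (npoly z m) k = 0"
  by (simp add: coeff_eq_0 degree_npoly)

definition interp_coeff :: "nat \<Rightarrow> (nat \<Rightarrow> complex) \<Rightarrow> (nat \<Rightarrow> nat) \<Rightarrow> (nat \<Rightarrow> nat) \<Rightarrow> complex"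
  where "interp_coeff N z mu ka = fun_det N (\<lambda>i j. coeff (npoly z (shifted N mu i)) (shifted N ka j))"

text \<open>A lift to Sym of the N-variate interpolation polynomial. The Schur functions that occur
  do not depend on N, and only their coefficients have to converge.\<close>

definition interp_sym :: "nat \<Rightarrow> (nat \<Rightarrow> complex) \<Rightarrow> (nat \<Rightarrow> nat) \<Rightarrow> symfun"
  where "interp_sym N z mu = (\<Sum>ka\<in>below mu. sym_scale (interp_coeff N z mu ka) (schur ka))"

lemma const_fun_det: "mpoly_const (fun_det N f) = fun_det N (\<lambda>i j. mpoly_const (f i j))"
  by (rule fun_det_hom) (rule mpoly_const.comm_ring_hom_axioms)

lemma restrict_interp_sym:
  assumes mu: "mu \<in> parts N"
  shows "sym_restrict N (interp_sym N z mu) * vandermonde N = fun_det N (\<lambda>i j. poly_at j (npoly z (shifted N mu i)))"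
proof -
  let ?T = "\<lambda>n k. mpoly_const (coeff (npoly z n) k)"
  have "fun_det N (\<lambda>i j. poly_at j (npoly z (shifted N mu i))) =
    fun_det N (\<lambda>i j. \<Sum>k\<le>shifted N mu i. ?T (shifted N mu i) k * mpoly_var j ^ k)"
    by (rule fun_det_cong) (rule poly_at_expand, simp add: degree_npoly)
  also have "\<dots> = (\<Sum>ka\<in>{ka\<in>parts N. ka \<le> mu}. fun_det N (\<lambda>i j. ?T (shifted N mu i) (shifted N ka j)) *
      fun_det N (\<lambda>i j. mpoly_var j ^ shifted N ka i))"
    by (rule cauchy_binet_parts[OF mu]) (simp add: coeff_npoly_0)
  also have "\<dots> = (\<Sum>ka\<in>{ka\<in>parts N. ka \<le> mu}. mpoly_const (interp_coeff N z mu ka) *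
      (sym_restrict N (schur ka) * vandermonde N))"
    by (intro sum.cong refl) (simp add: restrict_schur interp_coeff_def const_fun_det)
  also have "\<dots> = sym_restrict N (interp_sym N z mu) * vandermonde N"
    unfolding interp_sym_def parts_below[OF mu] sym_restrict.hom_sum sym_restrict_scale sum_distrib_right
    by (simp only: mult.assoc)
  finally show ?thesis by simp
qed

lemma interp_schur_eq:
  assumes mu: "mu \<in> parts N"
  shows "interp_schur N mu z = sym_restrict N (interp_sym N z mu)"
proof -
  have "det (mat N N (\<lambda>(i, j). shifted_power (mpoly_var j) z (mu i + (N - 1 - i)))) =
    sym_restrict N (interp_sym N z mu) * vandermonde N"
    unfolding restrict_interp_sym[OF mu] fun_det_def shifted_def npoly_def poly_at_shifted_power ..
  then show ?thesis using mu vandermonde_nz unfolding interp_schur_def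
    by (auto simp: parts_iff intro!: the_equality)
qed

section \<open>Convergence of the interpolation functions\<close>

lemma interp_coeff_self: "mu \<in> parts N \<Longrightarrow> interp_coeff N z mu mu = 1"
  unfolding interp_coeff_def by (rule fun_det_unitriangular) (simp_all add: coeff_npoly_0 coeff_npoly_self)

text \<open>Below row n both partitions vanish and the matrix is unitriangular. The size of the
  determinant no longer grows, so the limit can be taken entry by entry.\<close>

lemma interp_coeff_reduce:
  assumes "mu \<in> parts n" "ka \<in> parts n" "n \<le> N"
  shows "interp_coeff N z mu ka = fun_det n (\<lambda>i j. coeff (npoly z (shifted N mu i)) (shifted N ka j))"
  unfolding interp_coeff_def
proof (rule fun_det_reduce)
  fix i j assume "n \<le> i" "i < N" "j < i"
  then have "shifted N mu i < shifted N ka j" using assms by (simp add: shifted_def parts_def)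
  then show "coeff (npoly z (shifted N mu i)) (shifted N ka j) = 0" by (rule coeff_npoly_0)
next
  fix i assume "n \<le> i" "i < N"
  then have "shifted N mu i = shifted N ka i" using assms by (simp add: shifted_def parts_def)
  then show "coeff (npoly z (shifted N mu i)) (shifted N ka i) = 1" by (simp add: coeff_npoly_self)
qed (use assms in simp)

text \<open>Raising m by one changes the coefficient at distance r + 1 from the top by -z q^m times
  the one at distance r. The latter is bounded by induction, so the differences are
  summable.\<close>

lemma convergent_gpoly_coeff:
  fixes q z :: complex
  assumes q: "norm q < 1"
  shows "convergent (\<lambda>m. if r \<le> m then coeff (npoly (\<lambda>i. z * q ^ i) m) (m - r) else 0)"
proof (induction r)
  case 0
  then show ?case by (simp add: coeff_npoly_self convergent_const)
next
  case (Suc r)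
  let ?X = "\<lambda>r m. if r \<le> m then coeff (npoly (\<lambda>i. z * q ^ i) m) (m - r) else 0"
  have step: "?X (Suc r) (Suc m) - ?X (Suc r) m = - z * q ^ m * ?X r m" for m
  proof -
    have *: "coeff (npoly w (Suc n)) k = (if k = 0 then 0 else coeff (npoly w n) (k - 1)) - w n * coeff (npoly w n) k" for w n k
      unfolding npoly_Suc by (cases k) (simp_all add: mult_pCons_right)
    consider "r < m" | "r = m" | "m < r" by linarith
    then show ?thesis
      by cases (auto simp: * Suc_diff_Suc algebra_simps)
  qed
  obtain K where K: "K > 0" "\<And>m. norm (?X r m) \<le> K"
    using convergent_imp_Bseq[OF Suc] by (auto simp: Bseq_def)
  have "summable (\<lambda>m. - z * q ^ m * ?X r m)"
  proof (rule summable_comparison_test')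
    show "summable (\<lambda>m. norm z * K * norm q ^ m)" using q by (intro summable_mult summable_geometric) simp
    show "norm (- z * q ^ m * ?X r m) \<le> norm z * K * norm q ^ m" for m
    proof -
      have "norm (- z * q ^ m * ?X r m) = norm z * norm q ^ m * norm (?X r m)" by (simp only: norm_mult norm_minus_cancel norm_power)
      also have "\<dots> \<le> norm z * norm q ^ m * K" using K(2)[of m] by (intro mult_left_mono) auto
      finally show ?thesis by (simp only: mult_ac)
    qed
  qed
  then have "convergent (\<lambda>n. \<Sum>m<n. ?X (Suc r) (Suc m) - ?X (Suc r) m)"
    unfolding step by (simp only: summable_iff_convergent)
  moreover have "(\<Sum>m<n. ?X (Suc r) (Suc m) - ?X (Suc r) m) = ?X (Suc r) n - ?X (Suc r) 0" for n
    by (rule sum_lessThan_telescope)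
  ultimately have "convergent (\<lambda>n. ?X (Suc r) n - ?X (Suc r) 0)" by (simp only:)
  then show ?case by simp
qed

text \<open>The degrees \<open>shifted N mu i\<close> can exceed N, so nodes of index N and beyond
  occur; there the exponent is negative.\<close>

definition qnode :: "complex \<Rightarrow> nat \<Rightarrow> nat \<Rightarrow> complex"
  where "qnode q N i = q powi (int N - 1 - int i)"

text \<open>Read backwards, the nodes are z q^e with z independent of N, and the coefficient stays
  at a fixed distance r from the leading one. A negative distance gives 0 for large N.\<close>

lemma convergent_npoly_coeff:
  fixes q :: complex
  assumes q: "q \<noteq> 0" "norm q < 1"
  shows "convergent (\<lambda>N. coeff (npoly (qnode q N) (l + (N - 1 - i))) (k + (N - 1 - j)))"
proof -
  define z where "z = q powi (int i + 1 - int l)"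
  let ?m = "\<lambda>N. l + (N - 1 - i)" and ?k = "\<lambda>N. k + (N - 1 - j)"
  define r where "r = int l + int j - int i - int k"
  let ?X = "\<lambda>m. if nat r \<le> m then coeff (npoly (\<lambda>i. z * q ^ i) m) (m - nat r) else 0"
  have np: "npoly (qnode q N) (?m N) = npoly (\<lambda>e. z * q ^ e) (?m N)" if "N > i" for N
    unfolding npoly_def
  proof (rule prod.reindex_bij_witness[of _ "\<lambda>e. ?m N - 1 - e" "\<lambda>e. ?m N - 1 - e"])
    fix t assume t: "t \<in> {..<?m N}"
    have "z * q ^ (?m N - 1 - t) = q powi (int i + 1 - int l + int (?m N - 1 - t))"
      using q by (simp add: z_def power_int_add)
    also have "int i + 1 - int l + int (?m N - 1 - t) = int N - 1 - int t"
      using t that by (simp add: of_nat_diff)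
    finally show "[:- (z * q ^ (?m N - 1 - t)), 1:] = [:- qnode q N t, 1:]" by (simp add: qnode_def)
  qed auto
  show ?thesis
  proof (cases "r < 0")
    case True
    have "eventually (\<lambda>N. 0 = coeff (npoly (qnode q N) (?m N)) (?k N)) sequentially"
      using eventually_ge_at_top[of "i + j + 1"]
    proof eventually_elim
      case (elim N)
      then have "?m N < ?k N" using True unfolding r_def by linarith
      then show ?case by (simp add: coeff_npoly_0)
    qed
    then show ?thesis by (rule convergent_cong[THEN iffD1]) (rule convergent_const)
  next
    case False
    obtain L where L: "?X \<longlonglongrightarrow> L" using convergent_gpoly_coeff[OF q(2), of "nat r" z] by (auto simp: convergent_def)
    have "filterlim ?m at_top sequentially"
    proof (rule filterlim_at_top_mono)
      show "filterlim (\<lambda>N. N - (i + 1)) at_top sequentially" by (rule filterlim_minus_const_nat_at_top)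
    qed (intro always_eventually allI, linarith)
    then have "(\<lambda>N. ?X (?m N)) \<longlonglongrightarrow> L" using L by (rule filterlim_compose[rotated])
    moreover have "eventually (\<lambda>N. ?X (?m N) = coeff (npoly (qnode q N) (?m N)) (?k N)) sequentially"
      using eventually_ge_at_top[of "i + j + k + 1"]
    proof eventually_elim
      case (elim N)
      then have "nat r \<le> ?m N" "?m N - nat r = ?k N" using False unfolding r_def by linarith+
      moreover have "npoly (qnode q N) (?m N) = npoly (\<lambda>e. z * q ^ e) (?m N)" using elim by (intro np) simp
      ultimately show ?case by simp
    qed
    ultimately have "(\<lambda>N. coeff (npoly (qnode q N) (?m N)) (?k N)) \<longlonglongrightarrow> L" by (rule Lim_transform_eventually)
    then show ?thesis by (auto simp: convergent_def)
  qed
qed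

lemma tendsto_fun_det:
  fixes f :: "nat \<Rightarrow> nat \<Rightarrow> nat \<Rightarrow> complex"
  assumes "\<And>i j. i < n \<Longrightarrow> j < n \<Longrightarrow> (\<lambda>N. f N i j) \<longlonglongrightarrow> g i j"
  shows "(\<lambda>N. fun_det n (f N)) \<longlonglongrightarrow> fun_det n g"
  unfolding fun_det_rows
proof (intro tendsto_intros assms)
  fix p i assume "p \<in> {p. p permutes {..<n}}" "i \<in> {..<n}"
  then show "i < n" "p i < n" using permutes_in_image[of p "{..<n}" i] by auto
qed

lemma interp_coeff_convergent:
  fixes q :: complex
  assumes q: "q \<noteq> 0" "norm q < 1" and mu: "is_partition mu" and ka: "ka \<in> below mu"
  shows "convergent (\<lambda>N. interp_coeff N (qnode q N) mu ka)"
proof -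
  let ?n = "plen mu"
  have p: "mu \<in> parts ?n" "ka \<in> parts ?n" using is_partition_parts[OF mu] parts_below[of mu ?n] ka by blast+
  define g where "g = (\<lambda>i j. lim (\<lambda>N. coeff (npoly (qnode q N) (mu i + (N - 1 - i))) (ka j + (N - 1 - j))))"
  have "(\<lambda>N. coeff (npoly (qnode q N) (mu i + (N - 1 - i))) (ka j + (N - 1 - j))) \<longlonglongrightarrow> g i j" for i j
    unfolding g_def using convergent_npoly_coeff[OF q] by (simp only: convergent_LIMSEQ_iff)
  then have "(\<lambda>N. fun_det ?n (\<lambda>i j. coeff (npoly (qnode q N) (shifted N mu i)) (shifted N ka j))) \<longlonglongrightarrow> fun_det ?n g"
    unfolding shifted_def by (intro tendsto_fun_det)
  moreover have "eventually (\<lambda>N. fun_det ?n (\<lambda>i j. coeff (npoly (qnode q N) (shifted N mu i)) (shifted N ka j)) =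
      interp_coeff N (qnode q N) mu ka) sequentially"
    using eventually_ge_at_top[of ?n] by eventually_elim (simp add: interp_coeff_reduce[OF p])
  ultimately have "(\<lambda>N. interp_coeff N (qnode q N) mu ka) \<longlonglongrightarrow> fun_det ?n g"
    by (rule Lim_transform_eventually)
  then show ?thesis by (auto simp: convergent_def)
qed

lemma sym_coeff_sum: "sym_coeff (sum f A) \<alpha> = (\<Sum>x\<in>A. sym_coeff (f x) \<alpha>)"
  by (induction A rule: infinite_finite_induct) (simp_all add: zero_symfun.rep_eq plus_symfun.rep_eq)

lemma sym_restrict_SymN: "sym_restrict N F \<in> SymN N"
  unfolding SymN_def
proof (intro CollectI conjI ballI allI impI)
  fix \<alpha> assume "\<alpha> \<in> Poly_Mapping.keys (sym_restrict N F)"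
  then show "Poly_Mapping.keys \<alpha> \<subseteq> {..<N}" by (auto simp: in_keys_iff lookup_restrict split: if_splits)
next
  fix \<pi> and \<alpha> :: monom assume \<pi>: "\<pi> permutes {..<N}"
  then have b: "bij \<pi>" by (rule permutes_bij)
  have "\<pi> -` Poly_Mapping.keys \<alpha> \<subseteq> {..<N} \<longleftrightarrow> Poly_Mapping.keys \<alpha> \<subseteq> {..<N}"
  proof
    assume v: "\<pi> -` Poly_Mapping.keys \<alpha> \<subseteq> {..<N}"
    show "Poly_Mapping.keys \<alpha> \<subseteq> {..<N}"
    proof
      fix x assume "x \<in> Poly_Mapping.keys \<alpha>"
      moreover obtain y where "x = \<pi> y" using b by (metis bij_pointE)
      ultimately show "x \<in> {..<N}" using v permutes_in_image[OF \<pi>, of y] by auto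
    qed
  next
    assume "Poly_Mapping.keys \<alpha> \<subseteq> {..<N}"
    then show "\<pi> -` Poly_Mapping.keys \<alpha> \<subseteq> {..<N}" using permutes_in_image[OF \<pi>] by blast
  qed
  then show "Poly_Mapping.lookup (sym_restrict N F) (Poly_Mapping.map_key \<pi> \<alpha>) = Poly_Mapping.lookup (sym_restrict N F) \<alpha>"
    using b by (simp add: lookup_restrict keys_map_key bij_is_inj sym_coeff_permute)
qed

lemma SymN_tendsto_unique:
  assumes "SymN_tendsto F G" "SymN_tendsto F H" shows "G = H"
proof -
  obtain d e where "\<forall>k\<ge>d. Sym_upto_tendsto k (\<lambda>N. sym_iota k N (F N)) G"
    "\<forall>k\<ge>e. Sym_upto_tendsto k (\<lambda>N. sym_iota k N (F N)) H"
    using assms unfolding SymN_tendsto_def by blast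
  then have "Sym_upto_tendsto (max d e) (\<lambda>N. sym_iota (max d e) N (F N)) G"
    "Sym_upto_tendsto (max d e) (\<lambda>N. sym_iota (max d e) N (F N)) H" by auto
  then have "(\<lambda>N. sym_coeff (sym_iota (max d e) N (F N)) \<alpha>) \<longlonglongrightarrow> sym_coeff G \<alpha>"
    "(\<lambda>N. sym_coeff (sym_iota (max d e) N (F N)) \<alpha>) \<longlonglongrightarrow> sym_coeff H \<alpha>" for \<alpha>
    unfolding Sym_upto_tendsto_def by blast+
  then show ?thesis by (intro symfun_eqI) (rule LIMSEQ_unique)
qed

text \<open>The lifts \<open>interp_sym\<close> lie in one space \<open>Sym_upto D\<close> and have
  convergent Schur coefficients. It remains to see that \<open>sym_iota\<close> recovers them from
  the polynomials.\<close>

lemma interp_A_expand: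
  fixes q :: complex
  assumes q: "q \<noteq> 0" "norm q < 1" and mu: "is_partition mu"
    and d: "\<And>ka. ka \<in> below mu \<Longrightarrow> (\<lambda>N. interp_coeff N (qnode q N) mu ka) \<longlonglongrightarrow> d ka"
  shows "interp_A mu q = (\<Sum>ka\<in>below mu. sym_scale (d ka) (schur ka))"
proof -
  let ?G = "\<Sum>ka\<in>below mu. sym_scale (d ka) (schur ka)"
  let ?F = "\<lambda>N. interp_schur N mu (qnode q N)"
  have "\<exists>D. \<forall>ka\<in>below mu. schur ka \<in> Sym_upto D"
  proof -
    have "\<forall>ka. \<exists>e. schur ka \<in> Sym_upto e" using Sym_upto_exists by blast
    from choice[OF this] obtain e where e: "schur ka \<in> Sym_upto (e ka)" for ka by blast
    have "schur ka \<in> Sym_upto (Max (e ` below mu))" if "ka \<in> below mu" for ka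
      using that finite_below[OF mu] by (intro Sym_upto_mono[OF e] Max_ge) auto
    then show ?thesis by blast
  qed
  then obtain D where D: "\<And>ka. ka \<in> below mu \<Longrightarrow> schur ka \<in> Sym_upto D" by blast
  then have I: "interp_sym N z mu \<in> Sym_upto D" for N z
    unfolding interp_sym_def by (intro Sym_upto_sum Sym_upto_scale)
  have big: "?F N = sym_restrict N (interp_sym N (qnode q N) mu)" if "plen mu \<le> N" for N
    using mu that by (intro interp_schur_eq) (simp add: parts_iff)
  have small: "?F N = sym_restrict N 0" if "\<not> plen mu \<le> N" for N
    using that by (simp add: interp_schur_def)
  have "SymN_tendsto ?F ?G"
    unfolding SymN_tendsto_def
  proof (intro conjI allI exI[of _ D] impI)
    fix N
    show "?F N \<in> SymN N"
      by (cases "plen mu \<le> N") (simp_all only: big small sym_restrict_SymN not_False_eq_True)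
    show "mpoly_deg_le D (?F N)"
      unfolding mpoly_deg_le_def
    proof
      fix \<alpha> assume a: "\<alpha> \<in> Poly_Mapping.keys (?F N)"
      then have N: "plen mu \<le> N" using small by (cases "plen mu \<le> N") auto
      from a show "mdeg \<alpha> \<le> D" unfolding big[OF N]
        using Sym_uptoD[OF I, of N "qnode q N" \<alpha>] by (auto simp: in_keys_iff lookup_restrict split: if_splits)
    qed
  next
    fix e assume e: "D \<le> e"
    show "Sym_upto_tendsto e (\<lambda>N. sym_iota e N (?F N)) ?G"
      unfolding Sym_upto_tendsto_def
    proof (intro conjI allI)
      show "?G \<in> Sym_upto e" using D e by (intro Sym_upto_sum Sym_upto_scale) (blast intro: Sym_upto_mono)
      fix \<alpha>
      have "(\<lambda>N. \<Sum>ka\<in>below mu. interp_coeff N (qnode q N) mu ka * sym_coeff (schur ka) \<alpha>) \<longlonglongrightarrow>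
        (\<Sum>ka\<in>below mu. d ka * sym_coeff (schur ka) \<alpha>)"
        by (intro tendsto_sum tendsto_mult tendsto_const d)
      moreover have "sym_coeff (interp_sym N z mu) \<alpha> = (\<Sum>ka\<in>below mu. interp_coeff N z mu ka * sym_coeff (schur ka) \<alpha>)" for N z
        by (simp add: interp_sym_def sym_coeff_sum sym_scale.rep_eq)
      ultimately have "(\<lambda>N. sym_coeff (interp_sym N (qnode q N) mu) \<alpha>) \<longlonglongrightarrow> sym_coeff ?G \<alpha>"
        by (simp add: sym_coeff_sum sym_scale.rep_eq)
      \<comment> \<open>From N = e on the restriction is injective, and from N =
        \<open>plen mu\<close> on the polynomial is not the default 0.\<close>
      moreover have "eventually (\<lambda>N. sym_coeff (interp_sym N (qnode q N) mu) \<alpha> = sym_coeff (sym_iota e N (?F N)) \<alpha>) sequentially"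
        using eventually_ge_at_top[of "max e (plen mu)"]
      proof eventually_elim
        case (elim N)
        have "inj_on (sym_restrict N) (Sym_upto e)"
          using elim sym_restrict_inj[of _ e _ N] by (intro inj_onI) auto
        then have "sym_iota e N (?F N) = interp_sym N (qnode q N) mu"
          unfolding sym_iota_def using elim by (subst big) (auto intro!: the_inv_into_f_f Sym_upto_mono[OF I e])
        then show ?case by simp
      qed
      ultimately show "(\<lambda>N. sym_coeff (sym_iota e N (?F N)) \<alpha>) \<longlonglongrightarrow> sym_coeff ?G \<alpha>"
        by (rule Lim_transform_eventually)
    qed
  qed
  moreover have "(\<lambda>i. q powi (int N - 1 - int i)) = qnode q N" for N
    by (simp add: fun_eq_iff qnode_def)
  ultimately show ?thesis unfolding interp_A_def
    by (simp only:) (blast intro: the_equality SymN_tendsto_unique)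
qed

section \<open>Transition coefficients and norms\<close>

lemma pn_parts:
  assumes "la \<in> parts N" shows "pn la = (\<Sum>i<N. i * la i)"
  unfolding pn_def using is_partition_parts[of la] parts_plen[OF assms]
  by (intro sum.mono_neutral_left) (auto simp: parts_def)

lemma sum_lessThan_id: "2 * (\<Sum>j<n. int j) = int n * (int n - 1)"
  by (induction n) (simp_all add: algebra_simps)

text \<open>Summing j over all boxes (i, j) of the diagram by columns and by rows; doubling avoids
  the halves of the binomial coefficients.\<close>

lemma pn_ptranspose:
  assumes la: "la \<in> parts N"
  shows "2 * int (pn (ptranspose la)) = (\<Sum>i<N. int (la i) * (int (la i) - 1))"
proof -
  have fin: "finite {i. j < la i}" for j
    by (rule finite_subset[of _ "{..<N}"]) (use la in \<open>auto simp: parts_def not_less[symmetric]\<close>)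
  have T: "ptranspose la j = (\<Sum>i<N. if j < la i then 1 else 0)" for j
  proof -
    have "{i. j < la i} = {i \<in> {..<N}. j < la i}"
      using la by (auto simp: parts_def) (metis not_less_zero not_le_imp_less)
    then show ?thesis by (simp add: ptranspose_def sum.If_cases Int_def)
  qed
  have "ptranspose la k \<le> ptranspose la j" if "j \<le> k" for j k
    unfolding ptranspose_def using that by (intro card_mono fin) auto
  moreover have "ptranspose la j = 0" if "la 0 \<le> j" for j
  proof -
    have "la i \<le> la 0" for i using la antimono_le[of la 0 i] by (simp add: parts_def)
    then have "\<not> j < la i" for i using that by (metis le_trans not_le)
    then show ?thesis by (simp add: ptranspose_def)
  qed
  ultimately have "ptranspose la \<in> parts (la 0)" by (simp add: parts_def antimono_def)
  then have "int (pn (ptranspose la)) = (\<Sum>j<la 0. \<Sum>i<N. if j < la i then int j else 0)"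
    by (simp add: pn_parts T sum_distrib_left of_nat_sum if_distrib cong: if_cong)
  also have "\<dots> = (\<Sum>i<N. \<Sum>j<la 0. if j < la i then int j else 0)"
    by (rule sum.swap)
  also have "\<dots> = (\<Sum>i<N. \<Sum>j<la i. int j)"
  proof (rule sum.cong[OF refl])
    fix i
    have "la i \<le> la 0" using la antimono_le[of la 0 i] by (simp add: parts_def)
    then have "{j \<in> {..<la 0}. j < la i} = {..<la i}" by auto
    then show "(\<Sum>j<la 0. if j < la i then int j else 0) = (\<Sum>j<la i. int j)"
      by (simp add: sum.inter_filter[symmetric])
  qed
  finally have "2 * int (pn (ptranspose la)) = 2 * (\<Sum>i<N. \<Sum>j<la i. int j)" by simp
  also have "\<dots> = (\<Sum>i<N. 2 * (\<Sum>j<la i. int j))" by (rule sum_distrib_left)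
  finally show ?thesis by (simp only: sum_lessThan_id)
qed

text \<open>The contents j - i of the boxes (i, j): summing j gives n(\<lambda>'), summing i gives
  n(\<lambda>).\<close>

definition content_sum :: "(nat \<Rightarrow> nat) \<Rightarrow> int"
  where "content_sum la = int (pn (ptranspose la)) - int (pn la)"

text \<open>All powers of \<open>q\<close> in the statement come from the completion of the square
  \<open>\<Sum>\<^sub>i (\<lambda>\<^sub>i + N - 1 - i)\<^sup>2\<close>.\<close>

lemma sum_shifted_squares:
  assumes la: "la \<in> parts N"
  shows "(\<Sum>i<N. int (shifted N la i * shifted N la i)) =
    2 * content_sum la + (2 * int N - 1) * int (psize la) + (\<Sum>i<N. int ((N - 1 - i) * (N - 1 - i)))"
proof -
  have "(\<Sum>i<N. int (shifted N la i * shifted N la i)) = (\<Sum>i<N. int (la i) * (int (la i) - 1) - 2 * int (i * la i)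
      + (2 * int N - 1) * int (la i) + int ((N - 1 - i) * (N - 1 - i)))"
  proof (rule sum.cong[OF refl])
    fix i assume "i \<in> {..<N}"
    then obtain e where N: "N = Suc (i + e)" by (auto dest: less_imp_Suc_add)
    show "int (shifted N la i * shifted N la i) = int (la i) * (int (la i) - 1) - 2 * int (i * la i)
      + (2 * int N - 1) * int (la i) + int ((N - 1 - i) * (N - 1 - i))"
      by (simp add: N shifted_def algebra_simps)
  qed
  also have "\<dots> = 2 * int (pn (ptranspose la)) - 2 * int (pn la) + (2 * int N - 1) * int (psize la)
      + (\<Sum>i<N. int ((N - 1 - i) * (N - 1 - i)))"
    unfolding sum.distrib sum_subtractf pn_ptranspose[OF la] pn_parts[OF la] psize_parts[OF la]
    by (simp only: sum_distrib_left of_nat_sum)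
  finally show ?thesis by (simp add: content_sum_def algebra_simps)
qed

text \<open>Separates the dependence on the partition from the value at the empty partition, which
  cancels later. With x = u and y = 1/q it serves \<sigma>, with x = u^2/q and y = 1/q^2 the
  norms.\<close>

lemma prod_quadratic:
  fixes x y :: complex
  assumes la: "la \<in> parts N" and nz: "x \<noteq> 0" "y \<noteq> 0"
  shows "(\<Prod>i<N. x ^ shifted N la i * y ^ (shifted N la i * shifted N la i)) =
    x powi int (psize la) * y powi (2 * content_sum la + (2 * int N - 1) * int (psize la)) *
    (\<Prod>i<N. x ^ (N - 1 - i) * y ^ ((N - 1 - i) * (N - 1 - i)))"
proof -
  have *: "(\<Prod>i<N. x ^ f i * y ^ (f i * f i)) = x powi (\<Sum>i<N. int (f i)) * y powi (\<Sum>i<N. int (f i * f i))" for f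
  proof -
    have "(\<Prod>i<N. z ^ e i) = z powi (\<Sum>i<N. int (e i))" for z :: complex and e
      by (simp add: power_sum flip: of_nat_sum)
    then show ?thesis by (simp only: prod.distrib)
  qed
  have "(\<Sum>i<N. int (shifted N la i)) = int (psize la) + (\<Sum>i<N. int (N - 1 - i))"
    by (simp only: psize_parts[OF la] shifted_def of_nat_add of_nat_sum sum.distrib)
  then show ?thesis unfolding * sum_shifted_squares[OF la] using nz
    by (simp add: power_int_add mult_ac)
qed

lemma qpoch_add: "qpoch x q (m + n) = qpoch x q m * qpoch (x * q ^ m) q n"
  by (induction n) (simp_all add: qpoch_Suc power_add mult_ac)

lemma qpoch_partition_parts:
  assumes la: "la \<in> parts N"
  shows "qpoch_partition x q la = (\<Prod>i<N. qpoch (x * q powi (- int i)) q (la i))"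
  unfolding qpoch_partition_def using is_partition_parts[of la] parts_plen[OF la]
  by (intro prod.mono_neutral_left) (auto simp: parts_def)

lemma compose_below:
  assumes la: "is_partition la"
  shows "(\<Sum>mu\<in>below la. sym_scale (x mu) (\<Sum>ka\<in>below mu. sym_scale (y mu ka) (S ka))) =
    (\<Sum>ka\<in>below la. sym_scale (\<Sum>mu\<in>below la. x mu * (if ka \<le> mu then y mu ka else 0)) (S ka))"
proof -
  have "sym_scale (x mu) (\<Sum>ka\<in>below mu. sym_scale (y mu ka) (S ka)) =
    (\<Sum>ka\<in>below la. sym_scale (x mu * (if ka \<le> mu then y mu ka else 0)) (S ka))" if mu: "mu \<in> below la" for mu
  proof -
    have "(\<Sum>ka\<in>below mu. sym_scale (x mu * y mu ka) (S ka)) =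
      (\<Sum>ka\<in>below la. sym_scale (x mu * (if ka \<le> mu then y mu ka else 0)) (S ka))"
    proof (rule sum.mono_neutral_cong_left[OF finite_below[OF la]])
      show "below mu \<subseteq> below la" using mu by (auto intro: order_trans)
    qed auto
    then show ?thesis by (simp add: Sym.scale_sum_right)
  qed
  then have "(\<Sum>mu\<in>below la. sym_scale (x mu) (\<Sum>ka\<in>below mu. sym_scale (y mu ka) (S ka))) =
    (\<Sum>mu\<in>below la. \<Sum>ka\<in>below la. sym_scale (x mu * (if ka \<le> mu then y mu ka else 0)) (S ka))"
    by (rule sum.cong[OF refl])
  also have "\<dots> = (\<Sum>ka\<in>below la. \<Sum>mu\<in>below la. sym_scale (x mu * (if ka \<le> mu then y mu ka else 0)) (S ka))"
    by (rule sum.swap)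
  finally show ?thesis by (simp only: Sym.scale_sum_left)
qed

lemma is_partition_0: "is_partition (\<lambda>_. 0)"
  by (simp add: is_partition_def antimono_def)

lemma schur_0: "schur (\<lambda>_. 0) = 1"
  by (simp add: schur_def plen_def)

lemma below_0: "below (\<lambda>_. 0) = {\<lambda>_. 0}"
  using is_partition_0 by (auto simp: le_fun_def)

lemma parts_0: "(\<lambda>_. 0) \<in> parts N"
  by (simp add: parts_def antimono_def)

section \<open>Parameters depending on the number of variables\<close>

locale qM_parameters =
  fixes q a c d :: complex
  assumes q0: "q \<noteq> 0" and q1: "norm q < 1" and a0: "a \<noteq> 0" and c0: "c \<noteq> 0" and d0: "d \<noteq> 0"
    and c_lattice: "\<And>k. c \<noteq> a * q powi k" and d_lattice: "\<And>k. d \<noteq> a * q powi k"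
begin

text \<open>These choices turn the nodes s q^(-i) into q^(N-1-i), and \<alpha> q^(m+1) at the
  shifted exponent m = mu_j + N - 1 - j into (c/a) q^(mu_j + 1 - j). The same happens with \<beta>
  and d, so N leaves both.\<close>

definition "sN N = q powi (int N - 1)"
definition "alN N = c / a * q powi (1 - int N)"
definition "beN N = d / a * q powi (1 - int N)"

lemma q_power_neq_1: "n > 0 \<Longrightarrow> q ^ n \<noteq> 1"
proof
  assume "n > 0" "q ^ n = 1"
  then have "norm q ^ n = 1" by (metis norm_one norm_power)
  moreover have "norm q ^ n < 1 ^ n" using \<open>n > 0\<close> q1 by (intro power_strict_mono) auto
  ultimately show False by simp
qed

interpretation M: qmeixner q "sN N" "alN N" "beN N" for N
  by unfold_locales (use q0 q_power_neq_1 a0 d0 in \<open>auto simp: beN_def\<close>)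

abbreviation "ac N \<equiv> qmeixner.expansion_coeff q (sN N) (alN N) (beN N)"
abbreviation "op N \<equiv> qmeixner.meixner_poly q (sN N) (alN N) (beN N)"
abbreviation "nr N \<equiv> qmeixner.sq_norm q (sN N) (alN N) (beN N)"
abbreviation "uN N \<equiv> qmeixner.u (sN N) (beN N)"

lemma uN: "uN N = a / d * q powi (2 * int N - 2)"
proof -
  have "int N - 1 = (1 - int N) + (2 * int N - 2)" by simp
  then have "q powi (int N - 1) = q powi (1 - int N) * q powi (2 * int N - 2)"
    using q0 by (metis power_int_add)
  then show ?thesis unfolding M.u_def using q0 a0 d0 by (simp add: sN_def beN_def)
qed

lemma uN_nz: "uN N \<noteq> 0"
  using q0 a0 d0 by (simp add: uN)

definition qfac_ratio :: "nat \<Rightarrow> (nat \<Rightarrow> nat) \<Rightarrow> complex"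
  where "qfac_ratio N la = (\<Prod>i<N. qpoch q q (shifted N la i) / qpoch q q (N - 1 - i))"

text \<open>\<open>sigma0\<close> and \<open>h0\<close> belong to \<open>c\<^sup>|\<^sup>\<lambda>\<^sup>| \<Phi>\<^sub>\<lambda>(X/c)\<close>, which depends on \<open>c/a\<close> and \<open>d/a\<close> only.\<close>

definition sigma0 :: "(nat \<Rightarrow> nat) \<Rightarrow> (nat \<Rightarrow> nat) \<Rightarrow> complex"
  where "sigma0 la mu = (a / (q * d)) powi (int (psize la) - int (psize mu)) * q powi (2 * (content_sum mu - content_sum la)) *
    fun_det (plen la) (qM_entry la mu q a c)"

lemma qM_sigma_sigma0: "qM_sigma la mu q a c d = c powi (- int (psize la)) * sigma0 la mu"
proof -
  have "int (pn (ptranspose mu)) - int (pn mu) - int (pn (ptranspose la)) + int (pn la) = content_sum mu - content_sum la"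
    by (simp add: content_sum_def)
  then show ?thesis by (simp add: qM_sigma_def sigma0_def fun_det_def mult.assoc)
qed

definition h0 :: "(nat \<Rightarrow> nat) \<Rightarrow> complex"
  where "h0 la = q powi (- 4 * content_sum la) * (a\<^sup>2 / (d\<^sup>2 * q ^ 3)) ^ psize la *
    (qpoch_partition (c * q / a) q la * qpoch_partition (d * q / a) q la)"

lemma qM_h_h0: "qM_h q a c d la = c powi (- 2 * int (psize la)) * h0 la"
proof -
  have "a\<^sup>2 / (c\<^sup>2 * d\<^sup>2 * q ^ 3) = c powi (- 2) * (a\<^sup>2 / (d\<^sup>2 * q ^ 3))"
    by (simp add: power_int_minus divide_inverse mult_ac)
  then have e: "(a\<^sup>2 / (c\<^sup>2 * d\<^sup>2 * q ^ 3)) ^ psize la = c powi (- 2 * int (psize la)) * (a\<^sup>2 / (d\<^sup>2 * q ^ 3)) ^ psize la"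
    by (simp only: power_mult_distrib power_int_mult power_int_of_nat)
  have "4 * (int (pn la) - int (pn (ptranspose la))) = - 4 * content_sum la" by (simp add: content_sum_def)
  then show ?thesis unfolding qM_h_def h0_def e by (simp only: mult_ac)
qed

text \<open>The coefficient depends on the pair of exponents only through their difference and the
  Pochhammer argument, which are free of N. All else splits into a row factor and a column factor,
  to be pulled out by \<open>fun_det_scale\<close>.\<close>

lemma qM_entry_expansion_coeff:
  assumes la: "la \<in> parts N" and mu: "mu \<in> parts N" and ij: "i < N" "j < N"
  shows "ac N (shifted N la i) (shifted N mu j) =
    (uN N ^ shifted N la i * (1 / q) ^ (shifted N la i * shifted N la i) * qpoch q q (shifted N la i)) *
    inverse (uN N ^ shifted N mu j * (1 / q) ^ (shifted N mu j * shifted N mu j) * qpoch q q (shifted N mu j)) *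
    qM_entry la mu q a c i j"
proof -
  let ?n = "shifted N la i" and ?m = "shifted N mu j"
  have m: "int (la i) - int i - int (mu j) + int j = int ?n - int ?m"
    using ij by (simp add: shifted_def of_nat_diff)
  have "c / a * q powi (int (mu j) + 1 - int j) = alN N * q ^ Suc ?m"
  proof -
    have "q powi (int (mu j) + 1 - int j) = q powi (1 - int N + int (Suc ?m))"
      using ij by (intro arg_cong[of _ _ "\<lambda>k. q powi k"]) (simp add: shifted_def of_nat_diff)
    also have "\<dots> = q powi (1 - int N) * q ^ Suc ?m"
      using q0 by (simp only: power_int_add power_int_of_nat simp_thms)
    finally show ?thesis by (simp add: alN_def)
  qed
  then have e: "qM_entry la mu q a c i j = (if ?m \<le> ?n then qpoch (alN N * q ^ Suc ?m) q (?n - ?m) / qpoch q q (?n - ?m) else 0)"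
    unfolding qM_entry_def m Let_def by (simp add: nat_diff_distrib)
  show ?thesis
  proof (cases "?m \<le> ?n")
    case True
    then have "uN N ^ ?n = uN N ^ ?m * uN N ^ (?n - ?m)" by (simp flip: power_add)
    then show ?thesis unfolding e M.expansion_coeff_def using True uN_nz[of N] M.qfac_nz q0
      by (simp add: power_one_over field_simps)
  next
    case False
    then show ?thesis unfolding e M.expansion_coeff_def by simp
  qed
qed

definition sigmaN :: "nat \<Rightarrow> (nat \<Rightarrow> nat) \<Rightarrow> (nat \<Rightarrow> nat) \<Rightarrow> complex"
  where "sigmaN N la mu = fun_det N (\<lambda>i j. ac N (shifted N la i) (shifted N mu j))"

lemma qM_entry_reduce:
  assumes la: "la \<in> parts N" and mu: "mu \<in> below la"
  shows "fun_det N (qM_entry la mu q a c) = fun_det (plen la) (qM_entry la mu q a c)"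
proof (rule fun_det_reduce)
  show "plen la \<le> N" using la by (simp add: parts_iff)
  have z: "la i = 0" "mu i = 0" if "plen la \<le> i" for i
  proof -
    show "la i = 0" using is_partition_parts[of la] parts_plen[OF la] that by (simp add: parts_def)
    then show "mu i = 0" using mu by (metis (mono_tags, lifting) le_funD le_zero_eq mem_Collect_eq)
  qed
  show "qM_entry la mu q a c i j = 0" if "plen la \<le> i" "i < N" "j < i" for i j
    using z[OF that(1)] that by (simp add: qM_entry_def Let_def)
  show "qM_entry la mu q a c i i = 1" if "plen la \<le> i" "i < N" for i
    using z[OF that(1)] by (simp add: qM_entry_def Let_def)
qed

text \<open>With k = |la| - |mu|, the powers of u contribute (a/d)^k q^((2N-2)k), and the squares of
  the exponents contain q^(-(2N-1)k). The surplus q^(-k) is the q in a/(qd).\<close>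

lemma sigmaN_sigma0:
  assumes la: "la \<in> parts N" and mu: "mu \<in> below la"
  shows "sigmaN N la mu = qfac_ratio N la / qfac_ratio N mu * sigma0 la mu"
proof -
  have mu': "mu \<in> parts N" using parts_below[OF la] mu by blast
  let ?U = "\<lambda>n. uN N ^ n * (1 / q) ^ (n * n)" and ?Q = "qpoch q q"
  let ?k = "int (psize la) - int (psize mu)"
  let ?C = "\<Prod>i<N. ?U (N - 1 - i)"
  have U0: "?U n \<noteq> 0" for n using uN_nz q0 by simp
  have C0: "?C \<noteq> 0" using uN_nz q0 by simp
  have U: "(\<Prod>i<N. ?U (shifted N nu i)) = uN N powi int (psize nu) *
      (1 / q) powi (2 * content_sum nu + (2 * int N - 1) * int (psize nu)) * ?C" if "nu \<in> parts N" for nu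
    using that uN_nz q0 by (intro prod_quadratic) auto
  have g: "(\<Prod>i<N. ?Q (shifted N nu i)) = qfac_ratio N nu * (\<Prod>i<N. ?Q (N - 1 - i))" for nu
    by (simp add: qfac_ratio_def prod_dividef M.qfac_nz)
  have "sigmaN N la mu = fun_det N (\<lambda>i j. (?U (shifted N la i) * ?Q (shifted N la i)) * inverse (?U (shifted N mu j) * ?Q (shifted N mu j)) * qM_entry la mu q a c i j)"
    unfolding sigmaN_def by (rule fun_det_cong) (rule qM_entry_expansion_coeff[OF la mu'])
  also have "\<dots> = (\<Prod>i<N. ?U (shifted N la i) * ?Q (shifted N la i)) * (\<Prod>j<N. inverse (?U (shifted N mu j) * ?Q (shifted N mu j))) * fun_det N (qM_entry la mu q a c)"
    by (rule fun_det_scale)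
  also have "(\<Prod>j<N. inverse (?U (shifted N mu j) * ?Q (shifted N mu j))) = inverse ((\<Prod>i<N. ?U (shifted N mu i)) * (\<Prod>i<N. ?Q (shifted N mu i)))"
    by (subst prod_inversef[unfolded o_def]) (simp only: prod.distrib)
  also have "(\<Prod>i<N. ?U (shifted N la i) * ?Q (shifted N la i)) = (\<Prod>i<N. ?U (shifted N la i)) * (\<Prod>i<N. ?Q (shifted N la i))"
    by (rule prod.distrib)
  also have "(\<Prod>i<N. ?U (shifted N la i)) * (\<Prod>i<N. ?Q (shifted N la i)) * inverse ((\<Prod>i<N. ?U (shifted N mu i)) * (\<Prod>i<N. ?Q (shifted N mu i)))
    = ((\<Prod>i<N. ?U (shifted N la i)) / (\<Prod>i<N. ?U (shifted N mu i))) * (qfac_ratio N la / qfac_ratio N mu)"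
    using M.qfac_nz by (simp add: g divide_simps)
  also have "(\<Prod>i<N. ?U (shifted N la i)) / (\<Prod>i<N. ?U (shifted N mu i)) =
      uN N powi ?k * (1 / q) powi (2 * (content_sum la - content_sum mu) + (2 * int N - 1) * ?k)"
  proof -
    have e: "2 * (content_sum la - content_sum mu) + (2 * int N - 1) * ?k =
      (2 * content_sum la + (2 * int N - 1) * int (psize la)) - (2 * content_sum mu + (2 * int N - 1) * int (psize mu))"
      by (simp add: algebra_simps)
    show ?thesis unfolding U[OF la] U[OF mu'] e using C0 uN_nz q0 by (simp add: power_int_diff)
  qed
  also have "\<dots> = (a / (q * d)) powi ?k * q powi (2 * (content_sum mu - content_sum la))"
  proof -
    have "uN N powi ?k = (a / d) powi ?k * q powi ((2 * int N - 2) * ?k)"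
      unfolding uN by (simp only: power_int_mult_distrib power_int_mult)
    moreover have "(1 / q) powi (2 * (content_sum la - content_sum mu) + (2 * int N - 1) * ?k) = q powi (- (2 * (content_sum la - content_sum mu) + (2 * int N - 1) * ?k))"
      by (simp only: power_int_minus power_int_inverse inverse_eq_divide[symmetric])
    moreover have "q powi ((2 * int N - 2) * ?k) * q powi (- (2 * (content_sum la - content_sum mu) + (2 * int N - 1) * ?k)) =
      q powi (- ?k) * q powi (2 * (content_sum mu - content_sum la))"
      using q0 by (simp flip: power_int_add) (simp add: algebra_simps)
    moreover have "(a / (q * d)) powi ?k = (a / d) powi ?k * q powi (- ?k)"
    proof -
      have "a / (q * d) = (a / d) * inverse q" by (simp add: field_simps)
      then show ?thesis by (simp only: power_int_mult_distrib power_int_inverse power_int_minus)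
    qed
    ultimately show ?thesis by (simp only: mult.assoc)
  qed
  finally show ?thesis unfolding qM_entry_reduce[OF la mu] sigma0_def by (simp only: mult_ac)
qed

text \<open>The linear part of the exponents gives q^((4N-5)|la|) and the quadratic part contains
  q^(-(4N-2)|la|). The surplus q^(-3|la|) is the cube of q in h.\<close>

lemma sq_norm_h0:
  assumes la: "la \<in> parts N"
  shows "(\<Prod>i<N. nr N (shifted N la i)) = qfac_ratio N la * h0 la * (\<Prod>i<N. nr N (N - 1 - i))"
proof -
  let ?x = "(uN N)\<^sup>2 / q" and ?y = "1 / q\<^sup>2"
  let ?W = "\<lambda>n. ?x ^ n * ?y ^ (n * n)" and ?P = "\<lambda>x n. qpoch (x * q) q n"
  have nr: "nr N n = ?W n * qpoch q q n * ?P (alN N) n * ?P (beN N) n" for n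
  proof -
    have "q ^ (2 * n * (n + 1)) = (q ^ n * q ^ n) * (q\<^sup>2) ^ (n * n)"
      by (simp add: power_add[symmetric] power_mult[symmetric] algebra_simps)
    then have "((uN N)\<^sup>2) ^ n * q ^ n / q ^ (2 * n * (n + 1)) = ?W n"
      using q0 by (simp add: power_divide power_one_over field_simps)
    then show ?thesis unfolding M.sq_norm_def by simp
  qed
  have W: "(\<Prod>i<N. ?W (shifted N la i)) = ?x powi int (psize la) * ?y powi (2 * content_sum la + (2 * int N - 1) * int (psize la)) *
      (\<Prod>i<N. ?W (N - 1 - i))"
    by (rule prod_quadratic[OF la]) (use uN_nz q0 in auto)
  \<comment> \<open>Needed for e = c and e = d. After the first N - 1 - i factors of the Pochhammer
    symbol the argument is (e q/a) q^(-i), from which N has dropped out.\<close>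
  have P: "(\<Prod>i<N. ?P (e / a * q powi (1 - int N)) (shifted N la i)) = qpoch_partition (e * q / a) q la * (\<Prod>i<N. ?P (e / a * q powi (1 - int N)) (N - 1 - i))" for e
  proof -
    have "?P (e / a * q powi (1 - int N)) (shifted N la i) =
      qpoch (e * q / a * q powi (- int i)) q (la i) * ?P (e / a * q powi (1 - int N)) (N - 1 - i)" if "i < N" for i
    proof -
      have "q powi (1 - int N) * q * q ^ (N - 1 - i) = q powi (1 - int N + 1 + int (N - 1 - i))"
        by (simp only: power_int_add q0 simp_thms power_int_1_right power_int_of_nat)
      also have "1 - int N + 1 + int (N - 1 - i) = 1 + - int i" using that by (simp add: of_nat_diff)
      also have "q powi (1 + - int i) = q * q powi (- int i)"
        by (simp only: power_int_add q0 simp_thms power_int_1_right)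
      finally have "q powi (1 - int N) * q * q ^ (N - 1 - i) = q * q powi (- int i)" .
      then have e: "e / a * q powi (1 - int N) * q * q ^ (N - 1 - i) = e * q / a * q powi (- int i)"
        by (simp add: field_simps)
      have "qpoch (e / a * q powi (1 - int N) * q) q (la i + (N - 1 - i)) =
        ?P (e / a * q powi (1 - int N)) (N - 1 - i) * qpoch (e / a * q powi (1 - int N) * q * q ^ (N - 1 - i)) q (la i)"
        by (subst add.commute) (rule qpoch_add)
      then show ?thesis unfolding shifted_def e by (simp only: mult.commute)
    qed
    then show ?thesis by (simp add: qpoch_partition_parts[OF la] prod.distrib)
  qed
  have g: "(\<Prod>i<N. qpoch q q (shifted N la i)) = qfac_ratio N la * (\<Prod>i<N. qpoch q q (N - 1 - i))"
    by (simp add: qfac_ratio_def prod_dividef M.qfac_nz)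
  have x: "?x powi int (psize la) * ?y powi (2 * content_sum la + (2 * int N - 1) * int (psize la)) =
    q powi (- 4 * content_sum la) * (a\<^sup>2 / (d\<^sup>2 * q ^ 3)) ^ psize la"
  proof -
    have "?x powi int (psize la) = (a\<^sup>2 / d\<^sup>2) ^ psize la * q powi ((4 * int N - 5) * int (psize la))"
    proof -
      have "(uN N)\<^sup>2 = a\<^sup>2 / d\<^sup>2 * q powi (4 * int N - 4)"
        using q0 by (simp add: uN power_mult_distrib power_divide power2_eq_square power_int_add[symmetric])
      moreover have "q powi (4 * int N - 4) / q = q powi (4 * int N - 5)"
        using q0 power_int_diff[of q "4 * int N - 4" 1] by simp
      ultimately have "?x = a\<^sup>2 / d\<^sup>2 * q powi (4 * int N - 5)" by (metis times_divide_eq_right)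
      then show ?thesis by (simp only: power_mult_distrib power_int_mult power_int_of_nat)
    qed
    moreover have "?y powi (2 * content_sum la + (2 * int N - 1) * int (psize la)) = q powi (- 2 * (2 * content_sum la + (2 * int N - 1) * int (psize la)))"
    proof -
      have "?y = q powi (- 2)" by (simp add: power_int_minus field_simps)
      then show ?thesis by (simp only: power_int_mult)
    qed
    moreover have "q powi ((4 * int N - 5) * int (psize la)) * q powi (- 2 * (2 * content_sum la + (2 * int N - 1) * int (psize la))) =
      q powi (- 4 * content_sum la) * q powi (- 3 * int (psize la))"
      using q0 by (simp flip: power_int_add) (simp add: algebra_simps)
    moreover have "(a\<^sup>2 / (d\<^sup>2 * q ^ 3)) ^ psize la = (a\<^sup>2 / d\<^sup>2) ^ psize la * q powi (- 3 * int (psize la))"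
    proof -
      have "q powi (- 3 * int (psize la)) = (1 / q ^ 3) ^ psize la"
        by (simp add: power_int_mult power_int_minus power_one_over inverse_eq_divide)
      then show ?thesis by (simp add: power_mult_distrib[symmetric])
    qed
    ultimately show ?thesis by (simp only: mult_ac)
  qed
  have D: "(\<Prod>i<N. nr N (f i)) = (\<Prod>i<N. ?W (f i)) * (\<Prod>i<N. qpoch q q (f i)) *
      (\<Prod>i<N. ?P (alN N) (f i)) * (\<Prod>i<N. ?P (beN N) (f i))" for f
    unfolding nr by (simp only: prod.distrib)
  show ?thesis
    unfolding D W[unfolded x] g P[of c, folded alN_def] P[of d, folded beN_def] h0_def by (simp only: mult_ac)
qed

text \<open>A vanishing Pochhammer factor would put c or d on the lattice a q^k. The division in
  \<open>ensemble_mean\<close> rests on this.\<close>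

lemma nr_nz: "nr N n \<noteq> 0"
proof -
  have "qpoch (e / a * q powi (1 - int N) * q) q n \<noteq> 0" if "\<And>k. e \<noteq> a * q powi k" for e
  proof
    assume "qpoch (e / a * q powi (1 - int N) * q) q n = 0"
    then obtain k where k: "e / a * q powi (1 - int N) * q * q ^ k = 1" by (auto simp: qpoch_def)
    define K where "K = 1 - int N + 1 + int k"
    have "q powi (1 - int N) * q * q ^ k = q powi K"
      unfolding K_def by (simp only: power_int_add q0 simp_thms power_int_1_right power_int_of_nat)
    with k have "e * q powi K = a" using a0 by (simp add: field_simps)
    then have "e = a * q powi (- K)" using q0 by (simp add: power_int_minus field_simps)
    with that show False by blast
  qed
  then show ?thesis unfolding M.sq_norm_def using M.qfac_nz uN_nz q0 c_lattice d_lattice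
    by (simp add: alN_def beN_def)
qed

text \<open>Cancelling the first N - 1 - i factors leaves the Pochhammer symbol of q^(N-i) of length
  la i, whose argument tends to 0. Only the first \<open>plen la\<close> of them are
  non-empty.\<close>

lemma qfac_ratio_tendsto: "is_partition la \<Longrightarrow> (\<lambda>N. qfac_ratio N la) \<longlonglongrightarrow> 1"
proof -
  assume la: "is_partition la"
  let ?n = "plen la"
  have "(\<lambda>N. \<Prod>i<?n. qpoch (q * q ^ (N - 1 - i)) q (la i)) \<longlonglongrightarrow> (\<Prod>i<?n. \<Prod>k<la i. 1 - q * 0 * q ^ k)"
    unfolding qpoch_def
  proof (intro tendsto_intros)
    fix i
    have "filterlim (\<lambda>N. N - (1 + i)) at_top sequentially" by (rule filterlim_minus_const_nat_at_top)
    then have "filterlim (\<lambda>N. N - 1 - i) at_top sequentially" by simp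
    then show "(\<lambda>N. q ^ (N - 1 - i)) \<longlonglongrightarrow> 0"
      by (rule filterlim_compose[OF LIMSEQ_power_zero[OF q1]])
  qed
  moreover have "eventually (\<lambda>N. (\<Prod>i<?n. qpoch (q * q ^ (N - 1 - i)) q (la i)) = qfac_ratio N la) sequentially"
    using eventually_ge_at_top[of ?n]
  proof eventually_elim
    case (elim N)
    have "qfac_ratio N la = (\<Prod>i<N. qpoch (q * q ^ (N - 1 - i)) q (la i))"
      unfolding qfac_ratio_def
    proof (rule prod.cong[OF refl])
      fix i
      have "qpoch q q (shifted N la i) = qpoch q q (N - 1 - i) * qpoch (q * q ^ (N - 1 - i)) q (la i)"
        unfolding shifted_def by (subst add.commute) (rule qpoch_add)
      then show "qpoch q q (shifted N la i) / qpoch q q (N - 1 - i) = qpoch (q * q ^ (N - 1 - i)) q (la i)"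
        using M.qfac_nz by simp
    qed
    also have "\<dots> = (\<Prod>i<?n. qpoch (q * q ^ (N - 1 - i)) q (la i))"
      using elim is_partition_parts[OF la] by (intro prod.mono_neutral_right) (auto simp: parts_def)
    finally show ?case ..
  qed
  ultimately have "(\<lambda>N. qfac_ratio N la) \<longlonglongrightarrow> (\<Prod>i<?n. \<Prod>k<la i. 1 - q * 0 * q ^ k)"
    by (rule Lim_transform_eventually)
  then show "(\<lambda>N. qfac_ratio N la) \<longlonglongrightarrow> 1" by simp
qed

lemma omega_npoly: "qmeixner.omega q (sN N) = npoly (qnode q N)"
proof
  fix m
  have "sN N / q ^ i = qnode q N i" for i
    using q0 by (simp add: sN_def qnode_def power_int_diff)
  then show "qmeixner.omega q (sN N) m = npoly (qnode q N) m"
    unfolding M.omega_def npoly_def by simp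
qed

section \<open>Approximants in finitely many variables and their scalar product\<close>

definition psi :: "nat \<Rightarrow> (nat \<Rightarrow> nat) \<Rightarrow> symfun"
  where "psi N la = (\<Sum>mu\<in>below la. sym_scale (sigmaN N la mu) (interp_sym N (qnode q N) mu))"

lemma ac_0: "n < m \<Longrightarrow> ac N n m = 0"
  unfolding M.expansion_coeff_def by simp

text \<open>Cauchy--Binet for the expansion of the one-variable polynomials in the Newton basis at
  the nodes \<open>qnode q N\<close>; the minors of the coefficients are
  \<open>sigmaN\<close>.\<close>

lemma restrict_psi:
  assumes la: "la \<in> parts N"
  shows "sym_restrict N (psi N la) * vandermonde N = fun_det N (\<lambda>i j. poly_at j (op N (shifted N la i)))"
proof -
  have "fun_det N (\<lambda>i j. poly_at j (op N (shifted N la i))) =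
    fun_det N (\<lambda>i j. \<Sum>k\<le>shifted N la i. mpoly_const (ac N (shifted N la i) k) * poly_at j (npoly (qnode q N) k))"
    unfolding M.meixner_poly_def omega_npoly by (rule fun_det_cong) (simp only: poly_at.hom_sum poly_at_smult)
  also have "\<dots> = (\<Sum>mu\<in>{mu\<in>parts N. mu \<le> la}. fun_det N (\<lambda>i j. mpoly_const (ac N (shifted N la i) (shifted N mu j))) *
      fun_det N (\<lambda>i j. poly_at j (npoly (qnode q N) (shifted N mu i))))"
    by (rule cauchy_binet_parts[OF la]) (simp add: ac_0)
  also have "\<dots> = (\<Sum>mu\<in>{mu\<in>parts N. mu \<le> la}. mpoly_const (sigmaN N la mu) *
      (sym_restrict N (interp_sym N (qnode q N) mu) * vandermonde N))"
    by (intro sum.cong refl) (simp add: restrict_interp_sym sigmaN_def const_fun_det)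
  also have "\<dots> = sym_restrict N (psi N la) * vandermonde N"
    unfolding psi_def parts_below[OF la] sym_restrict.hom_sum sym_restrict_scale sum_distrib_right
    by (simp only: mult.assoc)
  finally show ?thesis by simp
qed

lemma sigmaN_self: "la \<in> parts N \<Longrightarrow> sigmaN N la la = 1"
  unfolding sigmaN_def by (rule fun_det_unitriangular) (simp_all add: ac_0 M.expansion_coeff_diag)

lemma psi_0: "psi N (\<lambda>_. 0) = 1"
  by (simp add: psi_def below_0 interp_sym_def sigmaN_self parts_0 interp_coeff_self schur_0 Sym.scale_one)

definition ensemble_moment :: "nat \<Rightarrow> nat \<Rightarrow> complex"
  where "ensemble_moment N = (SOME m. \<forall>i j. moment_fun m (op N i * op N j) = (if i = j then nr N i else 0))"

lemma moment_fun_ensemble: "moment_fun (ensemble_moment N) (op N i * op N j) = (if i = j then nr N i else 0)"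
proof -
  have "\<forall>i j. moment_fun (ensemble_moment N) (op N i * op N j) = (if i = j then nr N i else 0)"
    unfolding ensemble_moment_def
    by (rule someI_ex[of "\<lambda>m. \<forall>i j. moment_fun m (op N i * op N j) = (if i = j then nr N i else 0)", OF M.meixner_poly_orthogonal])
  then show ?thesis by (simp only:)
qed

text \<open>The formal analogue of the expectation over an orthogonal polynomial ensemble: one factor
  \<open>V\<close> is absorbed by each of the two functions in a scalar product.\<close>

definition ensemble_mean :: "nat \<Rightarrow> symfun \<Rightarrow> complex"
  where "ensemble_mean N F = tensor_fun N (\<lambda>_. ensemble_moment N) (sym_restrict N F * (vandermonde N * vandermonde N)) /
    (fact N * (\<Prod>i<N. nr N (N - 1 - i)))"

lemma ensemble_mean_add: "ensemble_mean N (F + G) = ensemble_mean N F + ensemble_mean N G"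
  by (simp add: ensemble_mean_def sym_restrict.hom_add distrib_right tensor_fun_add add_divide_distrib)

lemma ensemble_mean_scale: "ensemble_mean N (sym_scale z F) = z * ensemble_mean N F"
  by (simp add: ensemble_mean_def sym_restrict_scale mult.assoc tensor_fun_scale)

lemma ensemble_mean_zero: "ensemble_mean N 0 = 0"
  by (simp add: ensemble_mean_def)

lemma ensemble_mean_sum: "ensemble_mean N (sum f A) = (\<Sum>x\<in>A. ensemble_mean N (f x))"
  by (induction A rule: infinite_finite_induct) (simp_all add: ensemble_mean_zero ensemble_mean_add)

text \<open>Andreief's factor N! and the product of the norms over the staircase cancel against the
  normalisation, while \<open>fun_det_delta\<close> leaves only the diagonal.\<close>

lemma ensemble_mean_psi:
  assumes la: "la \<in> parts N" and mu: "mu \<in> parts N"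
  shows "ensemble_mean N (psi N la * psi N mu) = (if la = mu then qfac_ratio N la * h0 la else 0)"
proof -
  let ?V = "vandermonde N"
  have split: "sym_restrict N (psi N la * psi N mu) * (?V * ?V) =
    (sym_restrict N (psi N la) * ?V) * (sym_restrict N (psi N mu) * ?V)"
    unfolding sym_restrict.hom_mult by (simp only: mult_ac)
  have "fun_det N (\<lambda>i j. moment_fun (ensemble_moment N) (op N (shifted N la i) * op N (shifted N mu j))) =
      fun_det N (\<lambda>i j. if shifted N la i = shifted N mu j then nr N (shifted N la i) else 0)"
    by (intro fun_det_cong moment_fun_ensemble)
  then have det: "fun_det N (\<lambda>i j. moment_fun (ensemble_moment N) (op N (shifted N la i) * op N (shifted N mu j))) =
      (if la = mu then \<Prod>i<N. nr N (shifted N la i) else 0)"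
    unfolding fun_det_delta[OF la mu, of "nr N"] .
  have "tensor_fun N (\<lambda>_. ensemble_moment N) (sym_restrict N (psi N la * psi N mu) * (?V * ?V)) =
      fact N * fun_det N (\<lambda>i j. moment_fun (ensemble_moment N) (op N (shifted N la i) * op N (shifted N mu j)))"
    unfolding split restrict_psi[OF la] restrict_psi[OF mu] by (rule andreief)
  then show ?thesis unfolding ensemble_mean_def det sq_norm_h0[OF la] using nr_nz[of N] by simp
qed

section \<open>Passage to infinitely many variables\<close>

definition interp_A_coeff :: "(nat \<Rightarrow> nat) \<Rightarrow> (nat \<Rightarrow> nat) \<Rightarrow> complex"
  where "interp_A_coeff mu ka = lim (\<lambda>N. interp_coeff N (qnode q N) mu ka)"

lemma interp_A_coeff: "is_partition mu \<Longrightarrow> ka \<in> below mu \<Longrightarrow> (\<lambda>N. interp_coeff N (qnode q N) mu ka) \<longlonglongrightarrow> interp_A_coeff mu ka"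
  unfolding interp_A_coeff_def using interp_coeff_convergent[OF q0 q1] by (simp only: convergent_LIMSEQ_iff)

definition Psi :: "(nat \<Rightarrow> nat) \<Rightarrow> symfun"
  where "Psi la = (\<Sum>mu\<in>below la. sym_scale (sigma0 la mu) (interp_A mu q))"

definition psi_coeff :: "nat \<Rightarrow> (nat \<Rightarrow> nat) \<Rightarrow> (nat \<Rightarrow> nat) \<Rightarrow> complex"
  where "psi_coeff N la ka = (\<Sum>mu\<in>below la. sigmaN N la mu * (if ka \<le> mu then interp_coeff N (qnode q N) mu ka else 0))"

definition Psi_coeff :: "(nat \<Rightarrow> nat) \<Rightarrow> (nat \<Rightarrow> nat) \<Rightarrow> complex"
  where "Psi_coeff la ka = (\<Sum>mu\<in>below la. sigma0 la mu * (if ka \<le> mu then interp_A_coeff mu ka else 0))"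

lemma psi_expansion: "is_partition la \<Longrightarrow> psi N la = (\<Sum>ka\<in>below la. sym_scale (psi_coeff N la ka) (schur ka))"
  unfolding psi_def interp_sym_def psi_coeff_def by (rule compose_below)

lemma Psi_expansion:
  assumes la: "is_partition la"
  shows "Psi la = (\<Sum>ka\<in>below la. sym_scale (Psi_coeff la ka) (schur ka))"
proof -
  have "Psi la = (\<Sum>mu\<in>below la. sym_scale (sigma0 la mu) (\<Sum>ka\<in>below mu. sym_scale (interp_A_coeff mu ka) (schur ka)))"
    unfolding Psi_def by (intro sum.cong refl arg_cong2[of _ _ _ _ sym_scale] interp_A_expand[OF q0 q1] interp_A_coeff) auto
  then show ?thesis unfolding Psi_coeff_def compose_below[OF la] .
qed

lemma sigmaN_tendsto:
  assumes la: "is_partition la" and mu: "mu \<in> below la"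
  shows "(\<lambda>N. sigmaN N la mu) \<longlonglongrightarrow> sigma0 la mu"
proof -
  have "(\<lambda>N. qfac_ratio N la / qfac_ratio N mu * sigma0 la mu) \<longlonglongrightarrow> 1 / 1 * sigma0 la mu"
    using la mu by (intro tendsto_intros qfac_ratio_tendsto) auto
  moreover have "eventually (\<lambda>N. qfac_ratio N la / qfac_ratio N mu * sigma0 la mu = sigmaN N la mu) sequentially"
    using eventually_ge_at_top[of "plen la"]
    by eventually_elim (use la mu in \<open>simp add: sigmaN_sigma0 parts_iff\<close>)
  ultimately show ?thesis by (simp add: Lim_transform_eventually)
qed

lemma psi_coeff_tendsto:
  assumes la: "is_partition la" and ka: "is_partition ka"
  shows "(\<lambda>N. psi_coeff N la ka) \<longlonglongrightarrow> Psi_coeff la ka"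
  unfolding psi_coeff_def Psi_coeff_def
proof (intro tendsto_sum tendsto_mult)
  fix mu assume mu: "mu \<in> below la"
  show "(\<lambda>N. sigmaN N la mu) \<longlonglongrightarrow> sigma0 la mu" by (rule sigmaN_tendsto[OF la mu])
  show "(\<lambda>N. if ka \<le> mu then interp_coeff N (qnode q N) mu ka else 0) \<longlonglongrightarrow> (if ka \<le> mu then interp_A_coeff mu ka else 0)"
    using interp_A_coeff[of mu ka] mu ka by auto
qed

lemma psi_coeff_self:
  assumes "la \<in> parts N" shows "psi_coeff N la la = 1"
proof -
  have la: "is_partition la" using assms by (simp add: parts_iff)
  have "psi_coeff N la la = (\<Sum>mu\<in>{la}. sigmaN N la mu * (if la \<le> mu then interp_coeff N (qnode q N) mu la else 0))"
    unfolding psi_coeff_def using finite_below[OF la] la by (intro sum.mono_neutral_right) auto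
  then show ?thesis using assms by (simp add: sigmaN_self interp_coeff_self)
qed

lemma Psi_coeff_self:
  assumes la: "is_partition la" shows "Psi_coeff la la = 1"
proof (rule LIMSEQ_unique[OF psi_coeff_tendsto[OF la la]])
  have "eventually (\<lambda>N. 1 = psi_coeff N la la) sequentially"
    using eventually_ge_at_top[of "plen la"] by eventually_elim (use la in \<open>simp add: psi_coeff_self parts_iff\<close>)
  then show "(\<lambda>N. psi_coeff N la la) \<longlonglongrightarrow> 1" by (rule Lim_transform_eventually[OF tendsto_const])
qed

lemma Psi_orthogonal:
  fixes E :: "symfun \<Rightarrow> complex"
  assumes Eadd: "\<And>F G. E (F + G) = E F + E G" and Escale: "\<And>z F. E (sym_scale z F) = z * E F"
    and EPsi: "\<And>la. is_partition la \<Longrightarrow> E (Psi la) = (if la = (\<lambda>_. 0) then 1 else 0)"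
    and la: "is_partition la" and mu: "is_partition mu"
  shows "E (Psi la * Psi mu) = (if la = mu then h0 la else 0)"
proof -
  have E0: "E 0 = 0" using Escale[of 0 0] by simp
  have Esum: "E (sum f A) = (\<Sum>x\<in>A. E (f x))" for f :: "(nat \<Rightarrow> nat) \<Rightarrow> symfun" and A
    by (induction A rule: infinite_finite_induct) (simp_all add: E0 Eadd)
  \<comment> \<open>The relation for the mean of \<open>psi N nu\<close> is solved for the Schur
    function of nu, whose coefficient is 1. All other terms belong to smaller partitions and
    converge by induction.\<close>
  have schur: "(\<lambda>N. ensemble_mean N (schur nu)) \<longlonglongrightarrow> E (schur nu)" if "is_partition nu" for nu
    using that
  proof (induction "psize nu" arbitrary: nu rule: less_induct)
    case less
    let ?b = "below nu - {nu}"
    have IH: "(\<lambda>N. ensemble_mean N (schur ka)) \<longlonglongrightarrow> E (schur ka)" if "ka \<in> ?b" for ka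
      using that less.prems psize_less[of nu ka] by (intro less.hyps) auto
    have split: "(\<Sum>ka\<in>below nu. f ka) = f nu + (\<Sum>ka\<in>?b. f ka)" for f :: "(nat \<Rightarrow> nat) \<Rightarrow> complex"
      using finite_below[OF less.prems] less.prems by (intro sum.remove) auto
    have "E (Psi nu) = (\<Sum>ka\<in>below nu. Psi_coeff nu ka * E (schur ka))"
      by (simp add: Psi_expansion[OF less.prems] Esum Escale)
    then have "E (schur nu) = E (Psi nu) - (\<Sum>ka\<in>?b. Psi_coeff nu ka * E (schur ka))"
      unfolding split by (simp add: Psi_coeff_self[OF less.prems])
    moreover have "(\<lambda>N. E (Psi nu) - (\<Sum>ka\<in>?b. psi_coeff N nu ka * ensemble_mean N (schur ka))) \<longlonglongrightarrow>
      E (Psi nu) - (\<Sum>ka\<in>?b. Psi_coeff nu ka * E (schur ka))"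
      using less.prems by (intro tendsto_intros psi_coeff_tendsto IH) auto
    moreover have "eventually (\<lambda>N. E (Psi nu) - (\<Sum>ka\<in>?b. psi_coeff N nu ka * ensemble_mean N (schur ka)) = ensemble_mean N (schur nu)) sequentially"
      using eventually_ge_at_top[of "plen nu"]
    proof eventually_elim
      case (elim N)
      then have nu: "nu \<in> parts N" using less.prems by (simp add: parts_iff)
      \<comment> \<open>Since \<open>psi N\<close> is 1 at the empty partition, the mean of
        \<open>psi N nu\<close> is a scalar product with it.\<close>
      have "ensemble_mean N (psi N nu * psi N (\<lambda>_. 0)) = (if nu = (\<lambda>_. 0) then qfac_ratio N nu * h0 nu else 0)"
        by (rule ensemble_mean_psi[OF nu parts_0])
      moreover have "ensemble_mean N (psi N (\<lambda>_. 0) * psi N (\<lambda>_. 0)) = qfac_ratio N (\<lambda>_. 0) * h0 (\<lambda>_. 0)"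
        using ensemble_mean_psi[OF parts_0 parts_0] by simp
      moreover have "qfac_ratio N (\<lambda>_. 0) * h0 (\<lambda>_. 0) = 1"
      proof -
        have "qfac_ratio N (\<lambda>_. 0) = 1" using M.qfac_nz by (simp add: qfac_ratio_def shifted_def)
        moreover have "content_sum (\<lambda>_. 0) = 0"
          using pn_ptranspose[OF parts_0, of 0] pn_parts[OF parts_0, of 0] by (simp add: content_sum_def)
        then have "h0 (\<lambda>_. 0) = 1"
          using psize_parts[OF parts_0, of 0] by (simp add: h0_def qpoch_partition_parts[OF parts_0, of _ _ 0])
        ultimately show ?thesis by simp
      qed
      ultimately have "ensemble_mean N (psi N nu) = E (Psi nu)"
        using EPsi[OF less.prems] by (auto simp: psi_0)
      moreover have "ensemble_mean N (psi N nu) = (\<Sum>ka\<in>below nu. psi_coeff N nu ka * ensemble_mean N (schur ka))"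
        by (simp add: psi_expansion[OF less.prems] ensemble_mean_sum ensemble_mean_scale)
      ultimately show ?case unfolding split using psi_coeff_self[OF nu] by (auto simp: diff_eq_eq)
    qed
    ultimately show ?case by (simp add: Lim_transform_eventually)
  qed
  have lim: "(\<lambda>N. ensemble_mean N F) \<longlonglongrightarrow> E F" for F
  proof -
    \<comment> \<open>Convergence to E is stable under linear combinations, so the Schur functions
      suffice. This makes products of Schur functions accessible as well.\<close>
    have "F \<in> {F. (\<lambda>N. ensemble_mean N F) \<longlonglongrightarrow> E F}"
    proof (rule subsetD[OF Sym.span_minimal schur_span])
      show "schur ` {la. is_partition la} \<subseteq> {F. (\<lambda>N. ensemble_mean N F) \<longlonglongrightarrow> E F}" using schur by auto
      show "Sym.subspace {F. (\<lambda>N. ensemble_mean N F) \<longlonglongrightarrow> E F}"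
        unfolding Sym.subspace_def by (auto simp: ensemble_mean_zero E0 ensemble_mean_add Eadd ensemble_mean_scale Escale intro!: tendsto_add tendsto_mult)
    qed
    then show ?thesis by simp
  qed
  have prod: "(\<Sum>ka\<in>A. sym_scale (x ka) (schur ka)) * (\<Sum>nu\<in>B. sym_scale (y nu) (schur nu)) =
    (\<Sum>ka\<in>A. \<Sum>nu\<in>B. sym_scale (x ka * y nu) (schur ka * schur nu))" for x y A B
    unfolding sum_product by (intro sum.cong refl symfun_eqI)
      (simp add: times_symfun.rep_eq sym_scale.rep_eq sum_distrib_left case_prod_unfold mult_ac)
  have "(\<lambda>N. \<Sum>ka\<in>below la. \<Sum>nu\<in>below mu. psi_coeff N la ka * psi_coeff N mu nu * ensemble_mean N (schur ka * schur nu)) \<longlonglongrightarrow>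
    (\<Sum>ka\<in>below la. \<Sum>nu\<in>below mu. Psi_coeff la ka * Psi_coeff mu nu * E (schur ka * schur nu))"
    using la mu by (intro tendsto_sum tendsto_mult psi_coeff_tendsto lim) auto
  then have "(\<lambda>N. ensemble_mean N (psi N la * psi N mu)) \<longlonglongrightarrow> E (Psi la * Psi mu)"
    unfolding psi_expansion[OF la] psi_expansion[OF mu] Psi_expansion[OF la] Psi_expansion[OF mu] prod ensemble_mean_sum ensemble_mean_scale Esum Escale .
  moreover have "(\<lambda>N. ensemble_mean N (psi N la * psi N mu)) \<longlonglongrightarrow> (if la = mu then h0 la else 0)"
  proof (rule Lim_transform_eventually)
    have "(\<lambda>N. qfac_ratio N la * h0 la) \<longlonglongrightarrow> 1 * h0 la" by (intro tendsto_intros qfac_ratio_tendsto la)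
    then show "(\<lambda>N. if la = mu then qfac_ratio N la * h0 la else 0) \<longlonglongrightarrow> (if la = mu then h0 la else 0)"
      by (cases "la = mu") simp_all
    show "eventually (\<lambda>N. (if la = mu then qfac_ratio N la * h0 la else 0) = ensemble_mean N (psi N la * psi N mu)) sequentially"
      using eventually_ge_at_top[of "max (plen la) (plen mu)"]
      by eventually_elim (use la mu in \<open>simp add: ensemble_mean_psi parts_iff\<close>)
  qed
  ultimately show ?thesis by (rule LIMSEQ_unique)
qed

end

section \<open>Dilation of the variables, bases and admissible parameters\<close>

lemma sym_dilate_add: "sym_dilate c (F + G) = sym_dilate c F + sym_dilate c G"
  by (rule symfun_eqI) (simp add: sym_dilate.rep_eq plus_symfun.rep_eq distrib_left)

lemma sym_dilate_scale: "sym_dilate c (sym_scale z F) = sym_scale z (sym_dilate c F)"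
  by (rule symfun_eqI) (simp add: sym_dilate.rep_eq sym_scale.rep_eq)

lemma sym_dilate_0: "sym_dilate c 0 = 0"
  by (rule symfun_eqI) (simp add: sym_dilate.rep_eq zero_symfun.rep_eq)

lemma sym_dilate_sum: "sym_dilate c (sum f A) = (\<Sum>x\<in>A. sym_dilate c (f x))"
  by (induction A rule: infinite_finite_induct) (simp_all add: sym_dilate_0 sym_dilate_add)

lemma sym_dilate_mult: "sym_dilate c (F * G) = sym_dilate c F * sym_dilate c G"
proof (rule symfun_eqI)
  fix \<gamma>
  have *: "c ^ mdeg \<gamma> * (sym_coeff F (fst x) * sym_coeff G (snd x)) =
    c ^ mdeg (fst x) * sym_coeff F (fst x) * (c ^ mdeg (snd x) * sym_coeff G (snd x))" if "x \<in> splits \<gamma>" for x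
    using that by (auto simp: splits_def mdeg_add power_add)
  then show "sym_coeff (sym_dilate c (F * G)) \<gamma> = sym_coeff (sym_dilate c F * sym_dilate c G) \<gamma>"
    unfolding sym_dilate.rep_eq times_symfun.rep_eq sum_distrib_left case_prod_unfold
    by (intro sum.cong refl *)
qed

lemma sym_dilate_inverse: "c \<noteq> 0 \<Longrightarrow> sym_dilate (inverse c) (sym_dilate c F) = F"
  by (rule symfun_eqI) (simp add: sym_dilate.rep_eq power_inverse)

lemma sym_scale_mult: "sym_scale x F * sym_scale y G = sym_scale (x * y) (F * G)"
  by (rule symfun_eqI)
    (simp add: times_symfun.rep_eq sym_scale.rep_eq sum_distrib_left case_prod_unfold mult_ac)

text \<open>\<open>Sym.independent\<close> speaks of a set and would not notice two equal members of
  the family. Injectivity is obtained from the relation B x - B y = 0.\<close>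

lemma independent_family:
  assumes "\<And>J c. finite J \<Longrightarrow> J \<subseteq> P \<Longrightarrow> (\<Sum>x\<in>J. sym_scale (c x) (B x)) = 0 \<Longrightarrow> \<forall>x\<in>J. c x = 0"
  shows "inj_on B P" "Sym.independent (B ` P)"
proof -
  show inj: "inj_on B P"
  proof (rule inj_onI, rule ccontr)
    fix x y assume xy: "x \<in> P" "y \<in> P" "B x = B y" "x \<noteq> y"
    let ?c = "\<lambda>z. if z = x then 1 else - (1 :: complex)"
    have "(\<Sum>z\<in>{x, y}. sym_scale (?c z) (B z)) = 0"
      using xy by (simp add: Sym.scale_one Sym.scale_minus_left)
    then have "\<forall>z\<in>{x, y}. ?c z = 0" by (intro assms[of "{x, y}" ?c]) (use xy in auto)
    then show False by simp
  qed
  show "Sym.independent (B ` P)"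
  proof
    assume "Sym.dependent (B ` P)"
    then obtain t u v where t: "finite t" "t \<subseteq> B ` P" "(\<Sum>v\<in>t. sym_scale (u v) v) = 0" "v \<in> t" "u v \<noteq> 0"
      unfolding Sym.dependent_explicit by blast
    obtain J where J: "J \<subseteq> P" "t = B ` J" using t(2) by (auto simp: subset_image_iff)
    have injJ: "inj_on B J" using inj J(1) by (rule inj_on_subset)
    have "finite J" using t(1) injJ unfolding J(2) by (simp add: finite_image_iff)
    moreover have "(\<Sum>x\<in>J. sym_scale (u (B x)) (B x)) = 0"
      using t(3) unfolding J(2) by (simp add: sum.reindex[OF injJ])
    ultimately have "\<forall>x\<in>J. u (B x) = 0" using J(1) by (intro assms)
    then show False using t(4,5) J(2) by auto
  qed
qed

text \<open>The three cases yield numbers that are not real, or strictly between two consecutive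
  points of the lattice a q^k, or negative. None of these is 0 or a point of the lattice.\<close>

lemma admissible_parameters:
  fixes q a :: real
  assumes q: "0 < q" "q < 1" and adm: "qM_admissible q a c d"
  shows "qM_parameters (complex_of_real q) (complex_of_real a) c d"
proof -
  have a: "a > 0" using adm by (simp add: qM_admissible_def)
  have real: "complex_of_real a * complex_of_real q powi k = complex_of_real (a * q powi k)" for k
    by (simp add: of_real_power_int)
  have "e \<noteq> 0 \<and> (\<forall>k. e \<noteq> complex_of_real (a * q powi k))"
    if "e \<notin> \<real> \<or> (\<exists>x. e = complex_of_real x \<and> (x < 0 \<or> (\<exists>m. a * q powi m < x \<and> x < a * q powi (m - 1))))" for e
    using that
  proof (elim disjE exE conjE)
    assume "e \<notin> \<real>"
    then have n: "e \<noteq> complex_of_real r" for r by auto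
    show ?thesis using n[of 0] by (intro conjI allI n) simp
  next
    fix x assume "e = complex_of_real x" "x < 0"
    moreover have "a * q powi k > 0" for k using a q by simp
    ultimately show ?thesis by (metis less_irrefl less_trans of_real_eq_0_iff of_real_eq_iff)
  next
    fix x m assume e: "e = complex_of_real x" and m: "a * q powi m < x" "x < a * q powi (m - 1)"
    have "x \<noteq> a * q powi k" for k
    proof
      assume x: "x = a * q powi k"
      have "q powi m < q powi k" "q powi k < q powi (m - 1)" using m a by (simp_all add: x)
      moreover have "q powi j \<le> q powi i" if "i \<le> j" for i j
        using that q by (intro power_int_decreasing) auto
      ultimately have "k < m" "m - 1 < k" by (metis not_le)+
      then show False by simp
    qed
    moreover have "0 < x" using m(1) a q by (metis less_trans mult_pos_pos zero_less_power_int)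
    ultimately show ?thesis unfolding e by (simp only: of_real_eq_iff of_real_eq_0_iff) auto
  qed
  moreover have "e \<notin> \<real> \<or> (\<exists>x. e = complex_of_real x \<and> (x < 0 \<or> (\<exists>m. a * q powi m < x \<and> x < a * q powi (m - 1))))"
    if "e = c \<or> e = d" for e
    using adm that unfolding qM_admissible_def by (auto simp: complex_is_Real_iff)
  ultimately have "c \<noteq> 0" "\<And>k. c \<noteq> complex_of_real (a * q powi k)" "d \<noteq> 0" "\<And>k. d \<noteq> complex_of_real (a * q powi k)"
    by blast+
  then show ?thesis using a q by unfold_locales (simp_all only: real, auto)
qed

theorem theorem5p5:
  fixes q a :: real and c d :: complex
    and \<Phi> :: "(nat \<Rightarrow> nat) \<Rightarrow> symfun"
  assumes "0 < q" and "q < 1" and "qM_admissible q a c d"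
  defines "\<Phi> \<equiv> qM_Phi (complex_of_real q) (complex_of_real a) c d"
  shows "inj_on \<Phi> {la. is_partition la} \<and>
    Sym.independent (\<Phi> ` {la. is_partition la}) \<and>
    Sym.span (\<Phi> ` {la. is_partition la}) = UNIV \<and>
    (\<forall>E :: symfun \<Rightarrow> complex.
       Vector_Spaces.linear sym_scale (*) E \<longrightarrow>
       (\<forall>la. is_partition la \<longrightarrow> E (\<Phi> la) = (if la = (\<lambda>_. 0) then 1 else 0)) \<longrightarrow>
       (\<forall>la mu. is_partition la \<longrightarrow> is_partition mu \<longrightarrow>
          E (\<Phi> la * \<Phi> mu) =
            (if la = mu then qM_h (complex_of_real q) (complex_of_real a) c d la else 0)))"
proof -
  interpret qM_parameters "complex_of_real q" "complex_of_real a" c d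
    using assms(1-3) by (rule admissible_parameters)
  let ?P = "{la. is_partition la}"
  have \<Phi>: "\<Phi> la = sym_scale (c powi (- int (psize la))) (sym_dilate c (Psi la))" for la
    by (simp add: \<Phi>_def qM_Phi_def Psi_def qM_sigma_sigma0 sym_dilate_sum sym_dilate_scale Sym.scale_sum_right)
  have ind: "\<forall>x\<in>J. b x = 0" if J: "finite J" "J \<subseteq> ?P" and z: "(\<Sum>x\<in>J. sym_scale (b x) (\<Phi> x)) = 0" for J b
  proof
    fix la assume la: "la \<in> J"
    \<comment> \<open>Dilation by 1/c turns the relation among the \<Phi> into one among the
      \<open>Psi\<close>, whose Schur expansion is unitriangular.\<close>
    have "(\<Sum>x\<in>J. sym_scale (b x * c powi (- int (psize x))) (Psi x)) =
      sym_dilate (inverse c) (\<Sum>x\<in>J. sym_scale (b x) (\<Phi> x))"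
      by (simp add: \<Phi> sym_dilate_sum sym_dilate_scale sym_dilate_inverse[OF c0])
    also have "\<dots> = 0" unfolding z by (rule sym_dilate_0)
    finally have "b la * c powi (- int (psize la)) = 0"
      by (intro triangular_independent[where B = Psi and D = Psi_coeff and J = J and mu = la
          and c = "\<lambda>x. b x * c powi (- int (psize x))"] Psi_expansion Psi_coeff_self) (use J la in auto)
    then show "b la = 0" using c0 by simp
  qed
  note inj_ind = independent_family[of ?P \<Phi>, OF ind]
  have span: "F \<in> Sym.span (\<Phi> ` ?P)" for F
  proof -
    have sub: "Sym.span (Psi ` ?P) \<subseteq> {G. sym_dilate c G \<in> Sym.span (\<Phi> ` ?P)}"
    proof (rule Sym.span_minimal)
      show "Sym.subspace {G. sym_dilate c G \<in> Sym.span (\<Phi> ` ?P)}"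
        unfolding Sym.subspace_def
        by (simp add: sym_dilate_0 sym_dilate_add sym_dilate_scale Sym.span_zero Sym.span_add Sym.span_scale)
      show "Psi ` ?P \<subseteq> {G. sym_dilate c G \<in> Sym.span (\<Phi> ` ?P)}"
      proof clarify
        fix la assume "is_partition la"
        then have "sym_scale (c powi (int (psize la))) (\<Phi> la) \<in> Sym.span (\<Phi> ` ?P)"
          by (intro Sym.span_scale Sym.span_base) auto
        then show "sym_dilate c (Psi la) \<in> Sym.span (\<Phi> ` ?P)"
          using c0 by (simp add: \<Phi> power_int_minus Sym.scale_one)
      qed
    qed
    have "schur ` ?P \<subseteq> Sym.span (Psi ` ?P)"
      using triangular_span[where B = Psi and D = Psi_coeff and S = schur, OF Psi_expansion Psi_coeff_self] by auto
    then have "Sym.span (schur ` ?P) \<subseteq> Sym.span (Psi ` ?P)"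
      by (rule Sym.span_minimal) (rule Sym.subspace_span)
    \<comment> \<open>F is the dilation by c of F(X/c), and F(X/c) is a combination of the
      \<open>Psi\<close>.\<close>
    then have "sym_dilate (inverse c) F \<in> Sym.span (Psi ` ?P)" using schur_span by blast
    then have "sym_dilate c (sym_dilate (inverse c) F) \<in> Sym.span (\<Phi> ` ?P)" using sub by blast
    then show ?thesis using sym_dilate_inverse[of "inverse c" F] c0 by simp
  qed
  have orth: "E (\<Phi> la * \<Phi> mu) = (if la = mu then qM_h (complex_of_real q) (complex_of_real a) c d la else 0)"
    if lin: "Vector_Spaces.linear sym_scale (*) E"
      and E: "\<forall>la. is_partition la \<longrightarrow> E (\<Phi> la) = (if la = (\<lambda>_. 0) then 1 else 0)"
      and la: "is_partition la" and mu: "is_partition mu" for E la mu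
  proof -
    interpret E: Vector_Spaces.linear sym_scale "(*)" E by (rule lin)
    have "E (sym_dilate c (Psi la * Psi mu)) = (if la = mu then h0 la else 0)"
    \<comment> \<open>The functional to be used is F \<mapsto> E(F(Xc)), which satisfies on the
      \<open>Psi\<close> what E satisfies on the \<Phi>.\<close>
    proof (rule Psi_orthogonal[of "\<lambda>F. E (sym_dilate c F)", OF _ _ _ la mu])
      show "E (sym_dilate c (F + G)) = E (sym_dilate c F) + E (sym_dilate c G)" for F G
        by (simp add: sym_dilate_add E.add)
      show "E (sym_dilate c (sym_scale z F)) = z * E (sym_dilate c F)" for z F
        by (simp add: sym_dilate_scale E.scale)
      show "E (sym_dilate c (Psi nu)) = (if nu = (\<lambda>_. 0) then 1 else 0)" if nu: "is_partition nu" for nu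
      proof -
        \<comment> \<open>The factor c^(-|nu|) is invertible, and it equals 1 at the empty
          partition, the one place where the value is not 0.\<close>
        have "c powi (- int (psize nu)) * E (sym_dilate c (Psi nu)) = (if nu = (\<lambda>_. 0) then 1 else 0)"
          using E nu by (simp add: \<Phi> E.scale)
        moreover have "psize (\<lambda>_. 0) = 0" by (simp add: psize_def)
        ultimately show ?thesis using c0 by (auto split: if_splits)
      qed
    qed
    then have "E (\<Phi> la * \<Phi> mu) = c powi (- int (psize la)) * c powi (- int (psize mu)) * (if la = mu then h0 la else 0)"
      by (simp add: \<Phi> sym_scale_mult E.scale flip: sym_dilate_mult)
    \<comment> \<open>On the diagonal the two powers of c combine to c^(-2|la|), the ratio of
      \<open>qM_h\<close> to \<open>h0\<close>.\<close>
    also have "\<dots> = (if la = mu then qM_h (complex_of_real q) (complex_of_real a) c d la else 0)"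
      using c0 by (auto simp: qM_h_h0 simp flip: power_int_add)
    finally show ?thesis .
  qed
  show ?thesis using inj_ind span orth by blast
qed

end
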